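(* Let $(N,g)$ be a compact smooth Riemannian manifold with smooth boundary $\partial N$. There exists a constant $C>0$ depending only on $N$ such that for every square integrable function $f$ on $N$ and every $\lambda\geq 1$, $$\|\nabla \chi_\lambda f\|_\infty\leq C\left(\lambda\,\|\chi_\lambda f\|_\infty+\lambda^{-1}\|\Delta_N\,\chi_\lambda f\|_\infty\right),$$ where $\chi_\lambda$ is the unit band spectral projection operator of the Dirichlet Laplacian $\Delta_N$.
   Context: $(N,g)$ is an $n$-dimensional compact smooth Riemannian manifold with smooth boundary $\partial N$, and $\Delta_N$ is the positive Dirichlet Laplacian on $N$; in local coordinates $\Delta_N u=-\frac{1}{\sqrt{\det(g_{ij})}}\sum_{i,j}\partial_{x_i}\left(g^{ij}\sqrt{\det(g_{ij})}\,\partial_{x_j}u\right)$, with Dirichlet boundary condition $u=0$ on $\partial N$. $L^2(N)$ is the space of square integrable functions on $N$ with respect to the Riemannian density. Let $e_1,e_2,\dots$ be a complete orthonormal basis of $L^2(N)$ consisting of real-valued smooth Dirichlet eigenfunctions of $\Delta_N$, with $\Delta_N e_j=\lambda_j^2e_j$, $\lambda_j>0$, and $0<\lambda_1^2<\lambda_2^2\leq\lambda_3^2\leq\cdots$. Let $\mathbf{e}_j$ denote the orthogonal projection of $L^2(N)$ onto the one-dimensional space $\mathbf{C}e_j$. For $\lambda\geq 1$ define $\chi_\lambda f:=\sum_{\lambda_j\in(\lambda,\lambda+1]}\mathbf{e}_j(f)$ (a finite sum), so that $\Delta_N\chi_\lambda f=\sum_{\lambda_j\in(\lambda,\lambda+1]}\lambda_j^2\,\mathbf{e}_j(f)$.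 $\nabla u$ is the gradient vector field of $u$, with squared pointwise length $\sum_{i,j}g^{ij}\frac{\partial u}{\partial x_i}\frac{\partial u}{\partial x_j}$ for real-valued $u$ (with the second factor conjugated if $u$ is complex-valued). $\|\cdot\|_\infty$ is the $L^\infty$ norm on $N$; for a vector field it is the $L^\infty$ norm of its pointwise length. *)

theory Defs
  imports "HOL-Analysis.Analysis" "HOL-Probability.Essential_Supremum"
begin

section \<open>Smooth functions on subsets of Euclidean space\<close>

text \<open>The derivative is taken within \<open>S\<close>: at a boundary point of a half space the transversal
  partial derivative is one-sided, and it does not depend on values outside \<open>S\<close>.\<close>

definition partial_within ::
    "(real^'n) set \<Rightarrow> 'n \<Rightarrow> (real^'n \<Rightarrow> 'b::real_normed_vector) \<Rightarrow> real^'n \<Rightarrow> 'b" where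
  "partial_within S i f x = frechet_derivative f (at x within S) (axis i 1)"

text \<open>\<open>C\<^sup>\<infinity>\<close> on an open set: all iterated partial derivatives, of every order, are differentiable.\<close>

definition smooth_on_open :: "(real^'n) set \<Rightarrow> (real^'n \<Rightarrow> 'b::real_normed_vector) \<Rightarrow> bool" where
  "smooth_on_open U f \<longleftrightarrow>
     open U \<and> (\<forall>is. foldr (partial_within U) is f differentiable_on U)"

text \<open>On an arbitrary set: local existence of smooth extensions to open sets.\<close>

definition smooth_on :: "(real^'n) set \<Rightarrow> (real^'n \<Rightarrow> 'b::real_normed_vector) \<Rightarrow> bool" where
  "smooth_on S f \<longleftrightarrow>
     (\<forall>x\<in>S. \<exists>U F. x \<in> U \<and> smooth_on_open U F \<and> (\<forall>y\<in>U \<inter> S. F y = f y))"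


section \<open>Smooth manifolds with boundary\<close>

text \<open>Only the choice of one distinguished coordinate matters; conventionally it is the last one.\<close>

definition bd_coord :: "'n::finite" where
  "bd_coord = (SOME i. True)"

definition half_space :: "(real^'n::finite) set" where
  "half_space = {x. 0 \<le> x $ bd_coord}"

text \<open>A chart is a pair of a domain and a coordinate map; values of the map outside of the
  domain are irrelevant.\<close>

type_synonym ('m, 'n) chart = "'m set \<times> ('m \<Rightarrow> real^'n)"

definition cdom :: "('m, 'n) chart \<Rightarrow> 'm set" where
  "cdom c = fst c"

definition cmap :: "('m, 'n) chart \<Rightarrow> 'm \<Rightarrow> real^'n" where
  "cmap c = snd c"

definition cinv :: "('m, 'n) chart \<Rightarrow> real^'n \<Rightarrow> 'm" where
  "cinv c = inv_into (cdom c) (cmap c)"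

definition cimg :: "('m, 'n) chart \<Rightarrow> (real^'n) set" where
  "cimg c = cmap c ` cdom c"

definition is_chart :: "('m::topological_space, 'n::finite) chart \<Rightarrow> bool" where
  "is_chart c \<longleftrightarrow>
     open (cdom c) \<and> openin (top_of_set half_space) (cimg c) \<and>
     homeomorphism (cdom c) (cimg c) (cmap c) (cinv c)"

text \<open>The manifold is the whole type \<open>'m\<close>. The atlas need not be maximal; all notions below
  depend only on the smooth structure which it generates.\<close>

definition smooth_atlas :: "('m::topological_space, 'n::finite) chart set \<Rightarrow> bool" where
  "smooth_atlas A \<longleftrightarrow>
     (\<forall>c\<in>A. is_chart c) \<and> (\<Union>c\<in>A. cdom c) = UNIV \<and>
     (\<forall>c\<in>A. \<forall>d\<in>A. smooth_on (cmap c ` (cdom c \<inter> cdom d)) (cmap d \<circ> cinv c))"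

definition manifold_boundary :: "('m, 'n::finite) chart set \<Rightarrow> 'm set" where
  "manifold_boundary A = {p. \<exists>c\<in>A. p \<in> cdom c \<and> cmap c p $ bd_coord = 0}"

definition smooth_fun :: "('m, 'n::finite) chart set \<Rightarrow> ('m \<Rightarrow> 'b::real_normed_vector) \<Rightarrow> bool" where
  "smooth_fun A u \<longleftrightarrow> (\<forall>c\<in>A. smooth_on (cimg c) (u \<circ> cinv c))"


section \<open>Riemannian metrics\<close>

text \<open>A metric is given by its components: \<open>g c x $ i $ j\<close> is the component \<open>g\<^sub>i\<^sub>j\<close> in the chart
  \<open>c\<close> at the point with coordinates \<open>x\<close>. The last clause is the transformation law of
  covariant 2-tensors.\<close>

type_synonym ('m, 'n) metric = "('m, 'n) chart \<Rightarrow> real^'n \<Rightarrow> real^'n^'n"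

definition transition_jacobian ::
    "('m, 'n::finite) chart \<Rightarrow> ('m, 'n) chart \<Rightarrow> 'm \<Rightarrow> real^'n^'n" where
  "transition_jacobian c d p =
     matrix (frechet_derivative (cmap d \<circ> cinv c)
       (at (cmap c p) within cmap c ` (cdom c \<inter> cdom d)))"

definition riemannian_metric ::
    "('m::topological_space, 'n::finite) chart set \<Rightarrow> ('m, 'n) metric \<Rightarrow> bool" where
  "riemannian_metric A g \<longleftrightarrow>
     (\<forall>c\<in>A. \<forall>i j. smooth_on (cimg c) (\<lambda>x. g c x $ i $ j)) \<and>
     (\<forall>c\<in>A. \<forall>x\<in>cimg c. transpose (g c x) = g c x \<and> (\<forall>v. v \<noteq> 0 \<longrightarrow> 0 < v \<bullet> (g c x *v v))) \<and>
     (\<forall>c\<in>A. \<forall>d\<in>A. \<forall>p\<in>cdom c \<inter> cdom d.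
        g c (cmap c p) =
          transpose (transition_jacobian c d p) ** g d (cmap d p) ** transition_jacobian c d p)"

text \<open>The Borel measure with density \<open>sqrt (det (g\<^sub>i\<^sub>j))\<close> in every chart. As countably many chart
  domains cover the manifold, it is determined uniquely by the metric.\<close>

definition riemannian_density ::
    "('m::topological_space, 'n::finite) chart set \<Rightarrow> ('m, 'n) metric \<Rightarrow> 'm measure \<Rightarrow> bool" where
  "riemannian_density A g vol \<longleftrightarrow>
     sets vol = sets borel \<and>
     (\<forall>c\<in>A. \<forall>B\<in>sets borel. B \<subseteq> cdom c \<longrightarrow>
        emeasure vol B = (\<integral>\<^sup>+x\<in>cmap c ` B. ennreal (sqrt (det (g c x))) \<partial>lborel))"


section \<open>Laplacian and gradient\<close>

definition coord_partial ::
    "('m, 'n::finite) chart \<Rightarrow> 'n \<Rightarrow> ('m \<Rightarrow> 'b::real_normed_vector) \<Rightarrow> real^'n \<Rightarrow> 'b" where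
  "coord_partial c i u = partial_within (cimg c) i (u \<circ> cinv c)"

definition chart_laplacian ::
    "('m, 'n::finite) metric \<Rightarrow> ('m, 'n) chart \<Rightarrow> ('m \<Rightarrow> 'b::real_normed_vector) \<Rightarrow> 'm \<Rightarrow> 'b" where
  "chart_laplacian g c u p =
     - ((1 / sqrt (det (g c (cmap c p)))) *\<^sub>R
        (\<Sum>i\<in>UNIV. \<Sum>j\<in>UNIV.
           partial_within (cimg c) i
             (\<lambda>x. (matrix_inv (g c x) $ i $ j * sqrt (det (g c x))) *\<^sub>R coord_partial c j u x)
             (cmap c p)))"

text \<open>\<open>h\<close> is the Laplacian of \<open>u\<close>: the coordinate formula for \<open>\<Delta>u\<close> gives \<open>h\<close> in every chart.
  (As the formula is coordinate invariant on smooth \<open>u\<close>, one chart around each point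
  would do.)\<close>

definition has_laplacian ::
    "('m, 'n::finite) chart set \<Rightarrow> ('m, 'n) metric \<Rightarrow> ('m \<Rightarrow> 'b::real_normed_vector) \<Rightarrow> ('m \<Rightarrow> 'b) \<Rightarrow> bool"
  where "has_laplacian A g u h \<longleftrightarrow> (\<forall>c\<in>A. \<forall>p\<in>cdom c. h p = chart_laplacian g c u p)"

definition laplacian ::
    "('m, 'n::finite) chart set \<Rightarrow> ('m, 'n) metric \<Rightarrow> ('m \<Rightarrow> 'b::real_normed_vector) \<Rightarrow> 'm \<Rightarrow> 'b" where
  "laplacian A g u = (THE h. has_laplacian A g u h)"

text \<open>Pointwise length of the gradient of a complex-valued function, the square root of
  \<open>\<Sum>\<^sub>i\<^sub>j g\<^sup>i\<^sup>j \<partial>\<^sub>i u (cnj (\<partial>\<^sub>j u))\<close>; the sum is a nonnegative real number, so that taking the real part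
  only changes the type.\<close>

definition chart_gradient_length ::
    "('m, 'n::finite) metric \<Rightarrow> ('m, 'n) chart \<Rightarrow> ('m \<Rightarrow> complex) \<Rightarrow> 'm \<Rightarrow> real" where
  "chart_gradient_length g c u p =
     sqrt (Re (\<Sum>i\<in>UNIV. \<Sum>j\<in>UNIV.
       complex_of_real (matrix_inv (g c (cmap c p)) $ i $ j) *
         coord_partial c i u (cmap c p) * cnj (coord_partial c j u (cmap c p))))"

definition has_gradient_length ::
    "('m, 'n::finite) chart set \<Rightarrow> ('m, 'n) metric \<Rightarrow> ('m \<Rightarrow> complex) \<Rightarrow> ('m \<Rightarrow> real) \<Rightarrow> bool"
  where "has_gradient_length A g u r \<longleftrightarrow>
    (\<forall>c\<in>A. \<forall>p\<in>cdom c. r p = chart_gradient_length g c u p)"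

definition gradient_length ::
    "('m, 'n::finite) chart set \<Rightarrow> ('m, 'n) metric \<Rightarrow> ('m \<Rightarrow> complex) \<Rightarrow> 'm \<Rightarrow> real" where
  "gradient_length A g u = (THE r. has_gradient_length A g u r)"


section \<open>Function spaces and the spectral projections\<close>

text \<open>\<open>Linf_norm\<close> takes values in the extended reals: it is \<open>\<infinity>\<close> for essentially unbounded functions.\<close>

definition Linf_norm :: "'m measure \<Rightarrow> ('m \<Rightarrow> 'b::real_normed_vector) \<Rightarrow> ereal" where
  "Linf_norm vol u = esssup vol (\<lambda>p. ereal (norm (u p)))"

definition square_integrable :: "'m measure \<Rightarrow> ('m \<Rightarrow> complex) \<Rightarrow> bool" where
  "square_integrable vol f \<longleftrightarrow>
     f \<in> borel_measurable vol \<and> integrable vol (\<lambda>p. (cmod (f p))\<^sup>2)"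

definition eigen_projection :: "'m measure \<Rightarrow> ('m \<Rightarrow> real) \<Rightarrow> ('m \<Rightarrow> complex) \<Rightarrow> 'm \<Rightarrow> complex" where
  "eigen_projection vol w f p = (LINT q|vol. f q * complex_of_real (w q)) * complex_of_real (w p)"

text \<open>Indices start from 0, so that \<open>e 0\<close>, \<open>lam 0\<close> are what is usually called \<open>e\<^sub>1\<close>, \<open>\<lambda>\<^sub>1\<close>. The
  eigenvalues are the squares of \<open>lam j\<close>. Completeness of the orthonormal system means that
  every \<open>f\<close> in \<open>L\<^sup>2\<close> is the \<open>L\<^sup>2\<close>-limit of its expansion.\<close>

definition dirichlet_eigenbasis ::
    "('m::topological_space, 'n::finite) chart set \<Rightarrow> ('m, 'n) metric \<Rightarrow> 'm measure \<Rightarrow>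
     (nat \<Rightarrow> 'm \<Rightarrow> real) \<Rightarrow> (nat \<Rightarrow> real) \<Rightarrow> bool" where
  "dirichlet_eigenbasis A g vol e lam \<longleftrightarrow>
     (\<forall>j. smooth_fun A (e j)) \<and>
     (\<forall>j. \<forall>p\<in>manifold_boundary A. e j p = 0) \<and>
     (\<forall>j. has_laplacian A g (e j) (\<lambda>p. (lam j)\<^sup>2 * e j p)) \<and>
     (\<forall>j. 0 < lam j) \<and> (lam 0)\<^sup>2 < (lam 1)\<^sup>2 \<and> (\<forall>j\<ge>1. (lam j)\<^sup>2 \<le> (lam (Suc j))\<^sup>2) \<and>
     (\<forall>i j. (LINT p|vol. e i p * e j p) = (if i = j then 1 else 0)) \<and>
     (\<forall>f. square_integrable vol f \<longrightarrow>
        (\<lambda>n. LINT p|vol. (cmod (f p - (\<Sum>j<n. eigen_projection vol (e j) f p)))\<^sup>2)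
          \<longlonglongrightarrow> 0)"

text \<open>The unit band spectral projection operator \<open>\<chi>\<^sub>\<lambda>\<close>. On a compact manifold \<open>lam j\<close> tends to
  infinity, so that the sum is finite.\<close>

definition spectral_band ::
    "'m measure \<Rightarrow> (nat \<Rightarrow> 'm \<Rightarrow> real) \<Rightarrow> (nat \<Rightarrow> real) \<Rightarrow> real \<Rightarrow> ('m \<Rightarrow> complex) \<Rightarrow> 'm \<Rightarrow> complex"
  where "spectral_band vol e lam \<mu> f p =
    (\<Sum>j | lam j \<in> {\<mu><..\<mu> + 1}. eigen_projection vol (e j) f p)"

end

theory Submission
  imports Defs
begin

text \<open>The operator \<open>\<chi>\<^sub>\<lambda> f\<close> enters only as a smooth function \<open>u\<close> that vanishes on the boundary, and
  the inequality is a scaled gradient estimate for the Dirichlet problem on balls of radius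
  \<open>\<rho> \<approx> 1/\<lambda>\<close>, proved by the maximum principle alone. A quadratic barrier bounds \<open>u\<close> by a multiple of
  the distance to the boundary. In the interior the variables are doubled, following Ishii and Lions:
  if \<open>u x - u y - M (r - r\<^sup>2 / (8 \<rho>)) - k (\<bar>x - z\<bar>\<^sup>2 + \<bar>y - z\<bar>\<^sup>2)\<close> with \<open>r = \<bar>x - y\<bar>\<close> had a positive maximum, then the
  second order conditions in the directions that reflect \<open>x\<close> and \<open>y\<close> along \<open>x - y\<close> and translate them
  otherwise would contradict the equation, since the concave profile gains \<open>M / \<rho>\<close> while the Lipschitz
  coefficients cost only \<open>O(M)\<close>. Hence \<open>\<bar>u x - u z\<bar> \<le> M \<bar>x - z\<bar> + O(\<bar>x - z\<bar>\<^sup>2)\<close> with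
  \<open>M = O(\<lambda> \<parallel>u\<parallel> + \<parallel>\<Delta>u\<parallel> / \<lambda>)\<close>, and compactness makes the constant uniform.\<close>

section \<open>Quadratic forms and second derivatives at maxima\<close>

text \<open>The singular term shapes the argument. Moving x or y alone meets a curvature of size M /
  r, which blows up as the doubled points merge. The Lipschitz bound on the coefficients leaves only
  a remainder of order L * r for such uncoupled motions, so their product is O(L * M), uniformly in
  r. Reflection sees the full concavity of the profile, translation does not see the profile at all.
  The barrier has to come before the doubling because a doubled maximum might have exactly one point
  on the flat boundary, where no equation holds; a linear boundary rate of at most M / 2 excludes
  this. The penalty is quadratic and centred at z, so with y = z it vanishes to first order and the
  bound on differences becomes a bound on the derivative at z. On a ball of radius \<rho> the
  estimate is a multiple of m / \<rho> + \<rho> * h; a radius proportional to 1 / \<lambda> gives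
  the two terms of the claim. The real estimate is applied to real and imaginary parts. Essential
  suprema control values at every point because nonempty open sets have positive volume.\<close>

lemma quad_form_sum:
  fixes X :: "real^'n^'n" and v w :: "real^'n"
  shows "v \<bullet> (X *v w) = (\<Sum>i\<in>UNIV. \<Sum>j\<in>UNIV. v$i * w$j * X$i$j)"
  by (simp add: inner_vec_def matrix_vector_mult_def sum_distrib_left mult_ac)

text \<open>Cholesky: eliminating one coordinate at a time, by completing the square.\<close>

lemma psd_factorization:
  fixes P :: "real^'n^'n"
  assumes "finite S" "transpose P = P" "\<And>v. 0 \<le> v \<bullet> (P *v v)"
    "\<And>i j. i \<notin> S \<Longrightarrow> P$i$j = 0"
  shows "\<exists>F::'n \<Rightarrow> real^'n. \<forall>i j. P$i$j = (\<Sum>k\<in>S. F k $ i * F k $ j)"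
  using assms
proof (induction S arbitrary: P rule: finite_induct)
  case empty
  then show ?case by simp
next
  case (insert s S)
  have sym: "P$i$j = P$j$i" for i j
    using insert.prems(1) by (metis transpose_def vec_lambda_beta)
  have bil: "(v + t *\<^sub>R axis s 1) \<bullet> (P *v (v + t *\<^sub>R axis s 1)) =
      v \<bullet> (P *v v) + 2 * t * (P *v v) $ s + t\<^sup>2 * P$s$s" for v t
  proof -
    have "v \<bullet> (P *v axis s 1) = (P *v v) $ s"
      unfolding matrix_vector_mult_basis
      by (simp add: column_def inner_vec_def matrix_vector_mult_def sym[of s] mult.commute)
    moreover have "axis s 1 \<bullet> (P *v x) = (P *v x) $ s" for x
      by (simp add: inner_axis')
    moreover have "(P *v axis s 1) $ s = P$s$s"
      by (simp add: matrix_vector_mult_basis column_def)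
    ultimately show ?thesis
      by (simp add: matrix_vector_right_distrib scaleR_matrix_vector_assoc[symmetric] matrix_vector_mult_scaleR inner_add_left inner_add_right power2_eq_square algebra_simps)
  qed
  show ?case
  proof (cases "P$s$s = 0")
    case True
    have z: "(P *v v) $ s = 0" for v
    proof (rule ccontr)
      assume n: "(P *v v) $ s \<noteq> 0"
      \<comment> \<open>As \<open>P$s$s = 0\<close>, the form is affine in \<open>t\<close> along
        axis \<open>s\<close>; this \<open>t\<close> gives it the value -1.\<close>
      define t where "t = - (v \<bullet> (P *v v) + 1) / (2 * (P *v v) $ s)"
      have "0 \<le> v \<bullet> (P *v v) + 2 * t * (P *v v) $ s"
        using insert.prems(2)[of "v + t *\<^sub>R axis s 1"] True unfolding bil by simp
      moreover have "2 * t * (P *v v) $ s = - (v \<bullet> (P *v v) + 1)"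
        using n by (simp add: t_def field_simps)
      ultimately show False by simp
    qed
    have "P$s$j = 0" for j
      using z[of "axis j 1"] by (simp add: matrix_vector_mult_basis column_def)
    then have "P$i$j = 0" if "i \<notin> S" for i j
      using that insert.prems(3) by (cases "i = s") auto
    then obtain F :: "'n \<Rightarrow> real^'n" where F: "\<forall>i j. P$i$j = (\<Sum>k\<in>S. F k $ i * F k $ j)"
      using insert.IH[OF insert.prems(1,2)] by metis
    have "P$i$j = (\<Sum>k\<in>insert s S. (F(s := 0)) k $ i * (F(s := 0)) k $ j)" for i j
    proof -
      have "(\<Sum>k\<in>S. (F(s := 0)) k $ i * (F(s := 0)) k $ j) = (\<Sum>k\<in>S. F k $ i * F k $ j)"
        using insert.hyps by (intro sum.cong) auto
      then show ?thesis using insert.hyps F by simp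
    qed
    then show ?thesis by blast
  next
    case False
    have pos: "P$s$s > 0"
    proof -
      have "axis s 1 \<bullet> (P *v axis s 1) = P$s$s"
        by (simp add: matrix_vector_mult_basis column_def inner_axis' )
      then show ?thesis using insert.prems(2)[of "axis s 1"] False by simp
    qed
    \<comment> \<open>The Schur complement of the pivot: row and column \<open>s\<close> vanish, and
      its form at \<open>v\<close> is the minimum of the form of \<open>P\<close> over the line
      through \<open>v\<close> along axis \<open>s\<close>, hence nonnegative.\<close>
    define Q :: "real^'n^'n" where "Q = (\<chi> i j. P$i$j - P$i$s * P$j$s / P$s$s)"
    have Qv: "v \<bullet> (Q *v v) = v \<bullet> (P *v v) - ((P *v v) $ s)\<^sup>2 / P$s$s" for v
    proof -
      have "((P *v v) $ s)\<^sup>2 = (\<Sum>i\<in>UNIV. \<Sum>j\<in>UNIV. v$i * v$j * (P$i$s * P$j$s))"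
        by (simp add: matrix_vector_mult_def power2_eq_square sum_product sym[of s] mult_ac)
      then show ?thesis
        by (simp add: quad_form_sum Q_def right_diff_distrib sum_subtractf sum_divide_distrib)
    qed
    have "transpose Q = Q"
      by (simp add: Q_def transpose_def vec_eq_iff sym mult.commute)
    moreover have "0 \<le> v \<bullet> (Q *v v)" for v
    proof -
      define t where "t = - (P *v v) $ s / P$s$s"
      have "0 \<le> v \<bullet> (P *v v) + 2 * t * (P *v v) $ s + t\<^sup>2 * P$s$s"
        using insert.prems(2)[of "v + t *\<^sub>R axis s 1"] unfolding bil .
      also have "\<dots> = v \<bullet> (Q *v v)"
        using False by (simp add: Qv t_def power2_eq_square field_simps)
      finally show ?thesis .
    qed
    moreover have "Q$i$j = 0" if "i \<notin> S" for i j
      using that insert.prems(3) False by (cases "i = s") (auto simp: Q_def sym)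
    ultimately obtain F :: "'n \<Rightarrow> real^'n" where F: "\<forall>i j. Q$i$j = (\<Sum>k\<in>S. F k $ i * F k $ j)"
      using insert.IH[of Q] by metis
    define F' where "F' = F(s := (\<chi> i. P$i$s / sqrt (P$s$s)))"
    have "P$i$j = (\<Sum>k\<in>insert s S. F' k $ i * F' k $ j)" for i j
    proof -
      have "(\<Sum>k\<in>S. F' k $ i * F' k $ j) = Q$i$j"
        using insert.hyps F by (auto simp: F'_def intro!: sum.cong)
      then show ?thesis using insert.hyps pos by (simp add: F'_def Q_def)
    qed
    then show ?thesis by blast
  qed
qed

text \<open>A factorization of \<open>P\<close> turns the double sum into a sum of values of the
  form of \<open>X\<close> at the vectors \<open>F k\<close>. In this way second order conditions at
  a maximum, which are known one direction at a time, enter the equation.\<close>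

lemma psd_trace_le:
  fixes P X :: "real^'n^'n"
  assumes "transpose P = P" "\<And>v. 0 \<le> v \<bullet> (P *v v)" "\<And>v. v \<bullet> (X *v v) \<le> c * (v \<bullet> v)"
  shows "(\<Sum>i\<in>UNIV. \<Sum>j\<in>UNIV. P$i$j * X$i$j) \<le> c * (\<Sum>i\<in>UNIV. P$i$i)"
proof -
  obtain F :: "'n \<Rightarrow> real^'n" where F: "\<And>i j. P$i$j = (\<Sum>k\<in>UNIV. F k $ i * F k $ j)"
    using psd_factorization[of UNIV P] assms by auto
  have "(\<Sum>i\<in>UNIV. \<Sum>j\<in>UNIV. P$i$j * X$i$j) = (\<Sum>k\<in>UNIV. F k \<bullet> (X *v F k))"
    unfolding quad_form_sum F sum_distrib_right
    by (intro trans[OF sum.cong[OF refl sum.swap] sum.swap])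
  also have "\<dots> \<le> (\<Sum>k\<in>UNIV. c * (F k \<bullet> F k))"
    by (intro sum_mono assms)
  also have "\<dots> = c * (\<Sum>i\<in>UNIV. P$i$i)"
    unfolding F sum_distrib_left inner_vec_def by (subst sum.swap) simp
  finally show ?thesis .
qed

text \<open>If \<open>l\<close> were positive, \<open>f'\<close> would be positive just to the right
  of its zero at 0, and the mean value theorem would push \<open>f\<close> above its
  maximum.\<close>

lemma second_derivative_nonpos_at_local_max:
  fixes f f' :: "real \<Rightarrow> real"
  assumes "\<epsilon> > 0" "\<And>t. \<bar>t\<bar> < \<epsilon> \<Longrightarrow> (f has_real_derivative f' t) (at t)"
    and "(f' has_real_derivative l) (at 0)"
    and "\<And>t. \<bar>t\<bar> < \<epsilon> \<Longrightarrow> f t \<le> f 0"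
  shows "f' 0 = 0" "l \<le> 0"
proof -
  show 0: "f' 0 = 0"
    using DERIV_local_max[OF assms(2)[of 0], of \<epsilon>] assms by auto
  show "l \<le> 0"
  proof (rule ccontr)
    assume "\<not> l \<le> 0"
    then obtain d where d: "d > 0" "\<And>h. 0 < h \<Longrightarrow> h < d \<Longrightarrow> f' 0 < f' h"
      using DERIV_pos_inc_right[OF assms(3)] by auto
    define h where "h = min d \<epsilon> / 2"
    have h: "0 < h" "h < d" "h < \<epsilon>" using d assms(1) by (auto simp: h_def)
    obtain z where "0 < z" "z < h" "f h - f 0 = (h - 0) * f' z"
      using MVT2[of 0 h f f'] assms(2) h by (metis (no_types, lifting) abs_of_nonneg dual_order.strict_trans2)
    then show False using d(2)[of z] 0 h assms(4)[of h] by (smt (verit, best) mult_pos_pos)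
  qed
qed

section \<open>Boundary barriers and doubling of variables\<close>

text \<open>The comparison runs along one line in the product space, x moving along \<xi> and y
  along \<eta>. Reflection, translation and motion of a single point are choices of \<xi> and
  \<eta>; the barrier argument takes y = x and \<eta> = 0.\<close>

lemma quadratic_touching_at_local_max:
  fixes u :: "real^'n \<Rightarrow> real"
  assumes "open W" "x \<in> W" "y \<in> W" "\<epsilon> > 0"
    and du: "\<And>p. p \<in> W \<Longrightarrow> (u has_derivative (\<lambda>v. Du p \<bullet> v)) (at p)"
    and d2u: "\<And>p. p \<in> W \<Longrightarrow> (Du has_derivative (\<lambda>v. D2u p *v v)) (at p)"
    and max: "\<And>t. x + t *\<^sub>R \<xi> \<in> W \<Longrightarrow> y + t *\<^sub>R \<eta> \<in> W \<Longrightarrow> \<bar>t\<bar> < \<epsilon> \<Longrightarrow>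
       u (x + t *\<^sub>R \<xi>) - u (y + t *\<^sub>R \<eta>) \<le> u x - u y + (q1 * t + q2 * t\<^sup>2)"
  shows "Du x \<bullet> \<xi> - Du y \<bullet> \<eta> = q1" "\<xi> \<bullet> (D2u x *v \<xi>) - \<eta> \<bullet> (D2u y *v \<eta>) \<le> 2 * q2"
proof -
  have "((\<lambda>t. x + t *\<^sub>R \<xi>) \<longlongrightarrow> x + 0 *\<^sub>R \<xi>) (at 0)" "((\<lambda>t. y + t *\<^sub>R \<eta>) \<longlongrightarrow> y + 0 *\<^sub>R \<eta>) (at 0)"
    by (intro tendsto_intros)+
  then have "\<forall>\<^sub>F t in at 0. x + t *\<^sub>R \<xi> \<in> W" "\<forall>\<^sub>F t in at 0. y + t *\<^sub>R \<eta> \<in> W"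
    using assms(1-3) by (auto dest: topological_tendstoD)
  then have "\<forall>\<^sub>F t in at 0. x + t *\<^sub>R \<xi> \<in> W \<and> y + t *\<^sub>R \<eta> \<in> W"
    by eventually_elim auto
  then obtain d where "d > 0" and "\<And>t. t \<noteq> 0 \<Longrightarrow> \<bar>t\<bar> < d \<Longrightarrow> x + t *\<^sub>R \<xi> \<in> W \<and> y + t *\<^sub>R \<eta> \<in> W"
    unfolding eventually_at by (auto simp: dist_real_def)
  then have d: "x + t *\<^sub>R \<xi> \<in> W" "y + t *\<^sub>R \<eta> \<in> W" if "\<bar>t\<bar> < d" for t
    using that assms(2,3) by (cases "t = 0"; force)+
  define f where "f t = u (x + t *\<^sub>R \<xi>) - u (y + t *\<^sub>R \<eta>) - (q1 * t + q2 * t\<^sup>2)" for t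
  define f' where "f' t = Du (x + t *\<^sub>R \<xi>) \<bullet> \<xi> - Du (y + t *\<^sub>R \<eta>) \<bullet> \<eta> - (q1 + 2 * q2 * t)" for t
  have line: "((\<lambda>t. p + t *\<^sub>R v) has_derivative (\<lambda>t. t *\<^sub>R v)) (at s)" for p v :: "real^'n" and s :: real
    by (auto intro!: derivative_eq_intros)
  have 1: "((\<lambda>t. u (p + t *\<^sub>R v)) has_real_derivative Du (p + s *\<^sub>R v) \<bullet> v) (at s)"
    if "p + s *\<^sub>R v \<in> W" for p v s
    using diff_chain_at[OF line du[OF that]]
    by (simp add: has_field_derivative_def o_def mult_commute_abs)
  have 2: "((\<lambda>t. Du (p + t *\<^sub>R v) \<bullet> v) has_real_derivative v \<bullet> (D2u p *v v)) (at 0)"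
    if "p \<in> W" for p v
  proof -
    have "((\<lambda>t. Du (p + t *\<^sub>R v)) has_derivative (\<lambda>t. D2u p *v (t *\<^sub>R v))) (at 0)"
      using diff_chain_at[OF line, of Du "\<lambda>v. D2u p *v v" p 0 v] d2u[OF that] by (simp add: o_def)
    then have "((\<lambda>t. Du (p + t *\<^sub>R v) \<bullet> v) has_derivative (\<lambda>t. (D2u p *v (t *\<^sub>R v)) \<bullet> v)) (at 0)"
      by (rule has_derivative_inner_left)
    then show ?thesis
      by (simp add: has_field_derivative_def matrix_vector_mult_scaleR inner_commute mult_commute_abs)
  qed
  have f1: "(f has_real_derivative f' t) (at t)" if "\<bar>t\<bar> < min d \<epsilon>" for t
    unfolding f_def f'_def using that d[of t]
    by (auto intro!: derivative_eq_intros 1)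
  have f2: "(f' has_real_derivative \<xi> \<bullet> (D2u x *v \<xi>) - \<eta> \<bullet> (D2u y *v \<eta>) - 2 * q2) (at 0)"
    unfolding f'_def using assms(2,3) by (auto intro!: derivative_eq_intros 2)
  have f3: "f t \<le> f 0" if "\<bar>t\<bar> < min d \<epsilon>" for t
    using max[of t] d[of t] that by (simp add: f_def)
  have "f' 0 = 0" "\<xi> \<bullet> (D2u x *v \<xi>) - \<eta> \<bullet> (D2u y *v \<eta>) - 2 * q2 \<le> 0"
    using second_derivative_nonpos_at_local_max[of "min d \<epsilon>", OF _ f1 f2 f3] \<open>d > 0\<close> \<open>\<epsilon> > 0\<close> by auto
  then show "Du x \<bullet> \<xi> - Du y \<bullet> \<eta> = q1" "\<xi> \<bullet> (D2u x *v \<xi>) - \<eta> \<bullet> (D2u y *v \<eta>) \<le> 2 * q2"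
    by (auto simp: f'_def)
qed

lemma sum_single_entry:
  fixes f :: "'n::finite \<Rightarrow> 'n \<Rightarrow> real"
  shows "(\<Sum>i\<in>UNIV. \<Sum>j\<in>UNIV. f i j * (if i = a \<and> j = a then c else 0)) = f a a * c"
proof -
  have "(\<Sum>j\<in>UNIV. f i j * (if i = a \<and> j = a then c else 0)) = (if i = a then f a a * c else 0)" for i
    by (cases "i = a") (auto simp: if_distrib cong: if_cong)
  then show ?thesis by simp
qed

lemma closed_half_space: "closed (half_space :: (real^'n) set)"
  unfolding half_space_def
  by (intro closed_Collect_le continuous_intros)

text \<open>The equation in one chart, in nondivergence form: \<open>A\<close> stands for the
  inverse metric, \<open>bv\<close> for the first order coefficients that appear when the divergence
  form is differentiated out. Ellipticity is stated with 2 * \<theta> so that \<theta> times the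
  projection onto one direction and up to \<theta> times the identity can both be split off from
  \<open>A\<close> with a nonnegative rest.\<close>

locale half_space_dirichlet_problem =
  fixes K :: "(real^'n) set" and A :: "real^'n \<Rightarrow> real^'n^'n" and bv :: "real^'n \<Rightarrow> real^'n"
    and u :: "real^'n \<Rightarrow> real" and Du :: "real^'n \<Rightarrow> real^'n" and D2u :: "real^'n \<Rightarrow> real^'n^'n"
    and \<theta> T \<beta> L m h :: real
  assumes pos: "0 < \<theta>" "0 < m" "0 < h" "0 \<le> T" "0 \<le> \<beta>" "0 \<le> L"
    and sym: "x \<in> K \<Longrightarrow> transpose (A x) = A x"
    and elliptic: "x \<in> K \<Longrightarrow> 2 * \<theta> * (v \<bullet> v) \<le> v \<bullet> (A x *v v)"
    and trace_le: "x \<in> K \<Longrightarrow> (\<Sum>i\<in>UNIV. A x $ i $ i) \<le> T"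
    and drift_le: "x \<in> K \<Longrightarrow> norm (bv x) \<le> \<beta>"
    and lipschitz: "x \<in> K \<Longrightarrow> y \<in> K \<Longrightarrow>
      \<bar>v \<bullet> (A x *v v) - v \<bullet> (A y *v v)\<bar> \<le> L * norm (x - y) * (v \<bullet> v)"
    and cont: "continuous_on K u"
    and bounded: "x \<in> K \<Longrightarrow> \<bar>u x\<bar> \<le> m"
    and dirichlet: "x \<in> K \<Longrightarrow> x $ bd_coord = 0 \<Longrightarrow> u x = 0"
    and deriv: "x \<in> K \<Longrightarrow> 0 < x $ bd_coord \<Longrightarrow> (u has_derivative (\<lambda>v. Du x \<bullet> v)) (at x)"
    and deriv2: "x \<in> K \<Longrightarrow> 0 < x $ bd_coord \<Longrightarrow> (Du has_derivative (\<lambda>v. D2u x *v v)) (at x)"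
    and pde: "x \<in> K \<Longrightarrow> 0 < x $ bd_coord \<Longrightarrow>
      \<bar>(\<Sum>i\<in>UNIV. \<Sum>j\<in>UNIV. A x $ i $ j * D2u x $ i $ j) + bv x \<bullet> Du x\<bar> \<le> h"
begin

text \<open>With s the distance to the flat boundary, the barrier is N * (s - s^2 / (4 * \<rho>)) +
  k * |y - x'|^2. It dominates u on the flat part, where u = 0, and on the sphere, where k *
  \<rho>^2 = m. At an interior positive maximum of the difference, concavity in s contributes at
  most -N * \<theta> / \<rho>; by \<open>small\<close> the drift uses up at most half of it, and by
  \<open>N\<close> the other half exceeds h and the terms from the penalty.\<close>

lemma upper_barrier:
  assumes \<rho>: "0 < \<rho>" and x': "x' $ bd_coord = 0" and sub: "cball x' \<rho> \<inter> half_space \<subseteq> K"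
    and small: "\<rho> * \<beta> \<le> \<theta> / 2"
    and N: "N * \<theta> / (2 * \<rho>) > h + (m / \<rho>\<^sup>2) * (2 * T + 2 * \<beta> * \<rho>)"
    and x: "x \<in> cball x' \<rho> \<inter> half_space"
  shows "u x \<le> N * x $ bd_coord + (m / \<rho>\<^sup>2) * (norm (x - x'))\<^sup>2"
proof -
  define k where "k = m / \<rho>\<^sup>2"
  have k: "0 < k" "k * \<rho>\<^sup>2 = m" using pos \<rho> by (auto simp: k_def)
  define w where "w y = N * (y $ bd_coord - (y $ bd_coord)\<^sup>2 / (4 * \<rho>)) + k * (norm (y - x'))\<^sup>2" for y
  have "0 < h + (m / \<rho>\<^sup>2) * (2 * T + 2 * \<beta> * \<rho>)"
    using pos \<rho> by (intro add_pos_nonneg mult_nonneg_nonneg) auto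
  with N have "0 < N * (\<theta> / (2 * \<rho>))" by simp
  then have N0: "0 < N" using pos \<rho> by (simp add: zero_less_mult_iff zero_less_divide_iff)
  define C where "C = cball x' \<rho> \<inter> half_space"
  have C: "compact C" "x \<in> C"
    unfolding C_def using x by (auto intro: compact_Int_closed closed_half_space)
  have "continuous_on C (\<lambda>y. u y - w y)"
    unfolding w_def using cont sub \<rho>
    by (intro continuous_intros) (auto simp: C_def elim: continuous_on_subset)
  then obtain y where y: "y \<in> C" "\<And>p. p \<in> C \<Longrightarrow> u p - w p \<le> u y - w y"
    using continuous_attains_sup[of C] C by fastforce
  have yK: "y \<in> K" and y0: "0 \<le> y $ bd_coord" and yr: "norm (y - x') \<le> \<rho>"
    using y sub by (auto simp: C_def half_space_def dist_norm norm_minus_commute)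
  have yb: "y $ bd_coord \<le> \<rho>"
    using component_le_norm_cart[of "y - x'" bd_coord] yr x' by simp
  have "u y - w y \<le> 0"
  proof (rule ccontr)
    assume n: "\<not> u y - w y \<le> 0"
    have wN: "0 \<le> N * (y $ bd_coord - (y $ bd_coord)\<^sup>2 / (4 * \<rho>))"
    proof -
      have "(y $ bd_coord)\<^sup>2 \<le> y $ bd_coord * \<rho>"
        using y0 yb by (simp add: power2_eq_square mult_left_mono)
      also have "\<dots> \<le> y $ bd_coord * (4 * \<rho>)" using y0 \<rho> by (intro mult_left_mono) auto
      finally show ?thesis using N0 \<rho> by (simp add: divide_simps)
    qed
    have "y $ bd_coord \<noteq> 0"
      using n dirichlet[OF yK] k by (auto simp: w_def)
    moreover have "norm (y - x') \<noteq> \<rho>"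
    proof
      assume "norm (y - x') = \<rho>"
      then have "w y \<ge> m" using wN k by (simp add: w_def)
      then show False using bounded[OF yK] n by auto
    qed
    ultimately have yW: "y \<in> ball x' \<rho> \<inter> {p. 0 < p $ bd_coord}"
      using y0 yr by (auto simp: dist_norm norm_minus_commute)
    have W: "open (ball x' \<rho> \<inter> {p. 0 < p $ bd_coord})"
      by (intro open_Int open_Collect_less continuous_intros) auto
    have WK: "p \<in> K \<and> 0 < p $ bd_coord \<and> p \<in> C" if "p \<in> ball x' \<rho> \<inter> {p. 0 < p $ bd_coord}" for p
      using that sub by (auto simp: half_space_def C_def)
    have du: "(u has_derivative (\<lambda>v. Du p \<bullet> v)) (at p)" "(Du has_derivative (\<lambda>v. D2u p *v v)) (at p)"
      if "p \<in> ball x' \<rho> \<inter> {p. 0 < p $ bd_coord}" for p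
      using deriv deriv2 WK[OF that] by blast+
    define q1 where "q1 \<xi> = N * \<xi> $ bd_coord * (1 - y $ bd_coord / (2 * \<rho>)) + 2 * k * ((y - x') \<bullet> \<xi>)" for \<xi> :: "real^'n"
    define q2 where "q2 \<xi> = k * (\<xi> \<bullet> \<xi>) - N * (\<xi> $ bd_coord)\<^sup>2 / (4 * \<rho>)" for \<xi> :: "real^'n"
    \<comment> \<open>\<open>w\<close> is a polynomial of degree two, so its expansion is exact and
      is itself the touching quadratic.\<close>
    have we: "w (y + t *\<^sub>R \<xi>) - w y = q1 \<xi> * t + q2 \<xi> * t\<^sup>2" for t \<xi>
    proof -
      have "(norm (y + t *\<^sub>R \<xi> - x'))\<^sup>2 = (norm (y - x'))\<^sup>2 + 2 * t * ((y - x') \<bullet> \<xi>) + t\<^sup>2 * (\<xi> \<bullet> \<xi>)"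
        unfolding power2_norm_eq_inner by (simp add: algebra_simps inner_commute power2_eq_square)
      then show ?thesis using \<rho> unfolding w_def q1_def q2_def
        by (simp add: field_simps power2_eq_square)
    qed
    have t1: "Du y \<bullet> \<xi> = q1 \<xi>" and t2: "\<xi> \<bullet> (D2u y *v \<xi>) \<le> 2 * q2 \<xi>" for \<xi>
    proof -
      have "u (y + t *\<^sub>R \<xi>) - u (y + t *\<^sub>R 0) \<le> u y - u y + (q1 \<xi> * t + q2 \<xi> * t\<^sup>2)"
        if "y + t *\<^sub>R \<xi> \<in> ball x' \<rho> \<inter> {p. 0 < p $ bd_coord}" for t
        using y(2)[of "y + t *\<^sub>R \<xi>"] WK[OF that] we[of t \<xi>] by simp
      from quadratic_touching_at_local_max[OF W yW yW zero_less_one du this]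
      show "Du y \<bullet> \<xi> = q1 \<xi>" "\<xi> \<bullet> (D2u y *v \<xi>) \<le> 2 * q2 \<xi>"
        by simp_all
    qed
    \<comment> \<open>Moving the second derivative -N / (2 * \<rho>) of the concave profile to the
      side of \<open>D2u\<close> leaves a form bounded by the penalty alone.\<close>
    define X :: "real^'n^'n" where
      "X = (\<chi> i j. D2u y $ i $ j + (if i = bd_coord \<and> j = bd_coord then N / (2 * \<rho>) else 0))"
    have Xv: "v \<bullet> (X *v v) = v \<bullet> (D2u y *v v) + N / (2 * \<rho>) * (v $ bd_coord)\<^sup>2" for v
    proof -
      show ?thesis
        using sum_single_entry[of "\<lambda>i j. v $ i * v $ j" bd_coord "N / (2 * \<rho>)"]
        by (simp add: quad_form_sum X_def distrib_left sum.distrib power2_eq_square mult_ac)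
    qed
    have "(\<Sum>i\<in>UNIV. \<Sum>j\<in>UNIV. A y $ i $ j * X $ i $ j) \<le> 2 * k * (\<Sum>i\<in>UNIV. A y $ i $ i)"
    proof (rule psd_trace_le[OF sym[OF yK]])
      show "0 \<le> v \<bullet> (A y *v v)" for v
        using elliptic[OF yK, of v] pos by (smt (verit) inner_ge_zero mult_nonneg_nonneg)
      show "v \<bullet> (X *v v) \<le> 2 * k * (v \<bullet> v)" for v
        using t2[of v] unfolding Xv q2_def using \<rho> by (simp add: field_simps)
    qed
    also have "\<dots> \<le> 2 * k * T" using trace_le[OF yK] k by simp
    finally have "(\<Sum>i\<in>UNIV. \<Sum>j\<in>UNIV. A y $ i $ j * X $ i $ j) \<le> 2 * k * T" .
    moreover have "(\<Sum>i\<in>UNIV. \<Sum>j\<in>UNIV. A y $ i $ j * X $ i $ j) =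
       (\<Sum>i\<in>UNIV. \<Sum>j\<in>UNIV. A y $ i $ j * D2u y $ i $ j) + A y $ bd_coord $ bd_coord * (N / (2 * \<rho>))"
    proof -
      show ?thesis
        using sum_single_entry[of "\<lambda>i j. A y $ i $ j" bd_coord "N / (2 * \<rho>)"]
        by (simp add: X_def distrib_left sum.distrib)
    qed
    moreover have "2 * \<theta> * (N / (2 * \<rho>)) \<le> A y $ bd_coord $ bd_coord * (N / (2 * \<rho>))"
    proof (rule mult_right_mono)
      show "2 * \<theta> \<le> A y $ bd_coord $ bd_coord"
        using elliptic[OF yK, of "axis bd_coord 1"]
        by (simp add: matrix_vector_mult_basis column_def inner_axis')
    qed (use N0 \<rho> in auto)
    moreover have "bv y \<bullet> Du y \<le> \<beta> * N + 2 * k * (\<beta> * \<rho>)"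
    proof -
      have "bv y \<bullet> Du y = N * (bv y $ bd_coord * (1 - y $ bd_coord / (2 * \<rho>))) + 2 * k * ((y - x') \<bullet> bv y)"
        using t1[of "bv y"] by (simp add: q1_def inner_commute)
      also have "\<dots> \<le> N * \<beta> + 2 * k * (\<beta> * \<rho>)"
      proof (intro add_mono mult_left_mono)
        have "\<bar>bv y $ bd_coord * (1 - y $ bd_coord / (2 * \<rho>))\<bar> \<le> \<beta> * 1"
          unfolding abs_mult using component_le_norm_cart[of "bv y" bd_coord] drift_le[OF yK] y0 yb \<rho>
          by (intro mult_mono) (auto simp: field_simps)
        then show "bv y $ bd_coord * (1 - y $ bd_coord / (2 * \<rho>)) \<le> \<beta>" by linarith
        have "(y - x') \<bullet> bv y \<le> norm (y - x') * norm (bv y)" by (rule norm_cauchy_schwarz)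
        also have "\<dots> \<le> \<rho> * \<beta>" using yr drift_le[OF yK] \<rho> by (intro mult_mono) auto
        finally show "(y - x') \<bullet> bv y \<le> \<beta> * \<rho>" by (simp add: mult.commute)
      qed (use N0 k in auto)
      finally show ?thesis by (simp add: mult.commute)
    qed
    moreover have "\<beta> * N \<le> N * \<theta> / (2 * \<rho>)"
    proof -
      have "\<beta> \<le> \<theta> / (2 * \<rho>)" using small \<rho> by (simp add: field_simps)
      then have "\<beta> * N \<le> \<theta> / (2 * \<rho>) * N" using N0 by (intro mult_right_mono) auto
      then show ?thesis by (simp add: mult.commute)
    qed
    moreover have "2 * \<theta> * (N / (2 * \<rho>)) = 2 * (N * \<theta> / (2 * \<rho>))" by simp
    moreover have "k * (2 * T + 2 * \<beta> * \<rho>) = 2 * k * T + 2 * k * (\<beta> * \<rho>)"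
      by (simp add: algebra_simps)
    moreover have "\<bar>(\<Sum>i\<in>UNIV. \<Sum>j\<in>UNIV. A y $ i $ j * D2u y $ i $ j) + bv y \<bullet> Du y\<bar> \<le> h"
      using pde[OF yK] yW by simp
    ultimately show False
      using N unfolding k_def[symmetric] by linarith
  qed
  then have "u x \<le> w x" using y(2)[OF C(2)] by simp
  also have "\<dots> \<le> N * x $ bd_coord + k * (norm (x - x'))\<^sup>2"
    unfolding w_def using N0 \<rho> k by (intro add_mono mult_left_mono) auto
  finally show ?thesis by (simp add: k_def)
qed

text \<open>All bounds in the locale are two-sided, so it is closed under change of sign; this
  yields the lower bound that goes with \<open>upper_barrier\<close>.\<close>

lemma dirichlet_problem_uminus:
  "half_space_dirichlet_problem K A bv (\<lambda>x. - u x) (\<lambda>x. - Du x) (\<lambda>x. - D2u x) \<theta> T \<beta> L m h"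
proof
  fix x assume x: "x \<in> K" "0 < x $ bd_coord"
  show "((\<lambda>x. - u x) has_derivative (\<lambda>v. - Du x \<bullet> v)) (at x)"
    using deriv[OF x] by (auto intro!: derivative_eq_intros)
  have "(- D2u x) *v v = - (D2u x *v v)" for v
    by (simp add: matrix_vector_mult_def vec_eq_iff sum_negf)
  then show "((\<lambda>x. - Du x) has_derivative (\<lambda>v. - D2u x *v v)) (at x)"
    using deriv2[OF x] by (auto intro!: derivative_eq_intros)
  show "\<bar>(\<Sum>i\<in>UNIV. \<Sum>j\<in>UNIV. A x $ i $ j * (- D2u x) $ i $ j) + bv x \<bullet> - Du x\<bar> \<le> h"
    using pde[OF x] by (simp add: sum_negf)
qed (use pos sym elliptic trace_le drift_le lipschitz bounded dirichlet cont in
    \<open>auto intro: continuous_intros\<close>)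

text \<open>Near the boundary the barrier is centred at the foot x' of the perpendicular from x.
  There |x - x'| is the distance to the boundary, so the quadratic term is linear too, with rate m /
  \<rho>. Farther away than \<rho> the bound by m already suffices. The radius 3 * \<rho> covers the
  steps from z to x and from x to x' and the ball around x', one \<rho> each.\<close>

lemma boundary_lipschitz:
  assumes \<rho>: "0 < \<rho>" and z: "z \<in> half_space" and sub: "cball z (3 * \<rho>) \<inter> half_space \<subseteq> K"
    and small: "\<rho> * \<beta> \<le> \<theta> / 2"
    and N: "N * \<theta> / (2 * \<rho>) > h + (m / \<rho>\<^sup>2) * (2 * T + 2 * \<beta> * \<rho>)"
    and x: "x \<in> cball z \<rho> \<inter> half_space"
  shows "\<bar>u x\<bar> \<le> (N + m / \<rho>) * x $ bd_coord"
proof -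
  have xb: "0 \<le> x $ bd_coord" and xz: "dist z x \<le> \<rho>" using x by (auto simp: half_space_def)
  have xK: "x \<in> K" using x sub \<rho> by auto
  have "0 < h + (m / \<rho>\<^sup>2) * (2 * T + 2 * \<beta> * \<rho>)"
    using pos \<rho> by (intro add_pos_nonneg mult_nonneg_nonneg) auto
  with N have "0 < N * (\<theta> / (2 * \<rho>))" by simp
  then have N0: "0 < N" using pos \<rho> by (simp add: zero_less_mult_iff zero_less_divide_iff)
  show ?thesis
  proof (cases "x $ bd_coord \<le> \<rho>")
    case True
    define x' where "x' = x - (x $ bd_coord) *\<^sub>R axis bd_coord 1"
    have nx: "norm (x - x') = x $ bd_coord" using xb by (simp add: x'_def)
    have b: "cball x' \<rho> \<inter> half_space \<subseteq> K"
    proof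
      fix p assume p: "p \<in> cball x' \<rho> \<inter> half_space"
      have "dist z p \<le> dist z x + dist x x' + dist x' p"
        by (metis add.commute add_le_cancel_left dist_triangle dist_triangle_le order_trans add.assoc)
      also have "\<dots> \<le> \<rho> + \<rho> + \<rho>"
        using p xz nx True by (intro add_mono) (auto simp: dist_norm)
      finally show "p \<in> K" using p sub by auto
    qed
    have x'0: "x' $ bd_coord = 0" by (simp add: x'_def)
    have xc: "x \<in> cball x' \<rho> \<inter> half_space"
      using x nx True by (auto simp: dist_norm norm_minus_commute)
    interpret neg: half_space_dirichlet_problem K A bv "\<lambda>x. - u x" "\<lambda>x. - Du x" "\<lambda>x. - D2u x" \<theta> T \<beta> L m h
      by (rule dirichlet_problem_uminus)
    have "\<bar>u x\<bar> \<le> N * x $ bd_coord + (m / \<rho>\<^sup>2) * (x $ bd_coord)\<^sup>2"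
      using upper_barrier[OF \<rho> x'0 b small N xc] neg.upper_barrier[OF \<rho> x'0 b small N xc]
      unfolding nx by auto
    also have "(m / \<rho>\<^sup>2) * (x $ bd_coord)\<^sup>2 \<le> (m / \<rho>\<^sup>2) * (\<rho> * x $ bd_coord)"
      using xb True pos by (intro mult_left_mono) (auto simp: power2_eq_square intro: mult_right_mono)
    also have "\<dots> = (m / \<rho>) * x $ bd_coord" using \<rho> by (simp add: power2_eq_square)
    finally show ?thesis by (simp add: algebra_simps)
  next
    case False
    have "m \<le> m / \<rho> * x $ bd_coord"
      using False \<rho> pos by (simp add: field_simps)
    also have "\<dots> \<le> (N + m / \<rho>) * x $ bd_coord"
      using N0 xb by (intro mult_right_mono) auto
    finally show ?thesis using bounded[OF xK] by simp
  qed
qed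


text \<open>At a positive maximum of the doubled function neither point lies on the sphere, since k
  * \<rho>^2 = 2 * m, nor on the flat boundary, since 2 * N \<le> M and \<open>\<psi> r\<close> is
  at least r / 2. In the interior the equations at x and y are subtracted. By \<open>small\<close>
  the drift and the variation of the coefficients use up at most half of the gain M * \<theta> /
  \<rho>, and \<open>M\<close> says that the other half exceeds everything else.\<close>

lemma doubled_comparison:
  assumes \<rho>: "0 < \<rho>" and z: "z \<in> half_space" and sub: "cball z \<rho> \<inter> half_space \<subseteq> K"
    and small: "\<rho> * (2 * \<beta> + 3 * real CARD('n) * L) \<le> \<theta> / 2"
    and N: "\<And>x. x \<in> cball z \<rho> \<inter> half_space \<Longrightarrow> \<bar>u x\<bar> \<le> N * x $ bd_coord" "0 \<le> N" "2 * N \<le> M"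
    and M: "M * \<theta> / (2 * \<rho>) > 2 * h + (2 * m / \<rho>\<^sup>2) *
       (4 * \<beta> * \<rho> + 4 * \<theta> + 4 * T + 12 * real CARD('n) * L * \<rho>)"
    and xy: "x0 \<in> cball z \<rho> \<inter> half_space" "y0 \<in> cball z \<rho> \<inter> half_space"
  shows "u x0 - u y0 \<le> M * norm (x0 - y0) + (2 * m / \<rho>\<^sup>2) * ((norm (x0 - z))\<^sup>2 + (norm (y0 - z))\<^sup>2)"
proof -
  define k where "k = 2 * m / \<rho>\<^sup>2"
  have k: "0 < k" "k * \<rho>\<^sup>2 = 2 * m" using pos \<rho> by (auto simp: k_def)
  \<comment> \<open>As r \<le> 2 * \<rho>, this keeps \<open>\<psi> r\<close> between 3 * r / 4 and
    r, with second derivative -1 / (4 * \<rho>).\<close>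
  define \<kappa> where "\<kappa> = 1 / (8 * \<rho>)"
  have \<kappa>: "0 < \<kappa>" "8 * \<kappa> * \<rho> = 1" using \<rho> by (auto simp: \<kappa>_def)
  define n where "n = real CARD('n)"
  have n1: "1 \<le> n" by (simp add: n_def Suc_le_eq)
  define \<psi> where "\<psi> r = r - \<kappa> * r\<^sup>2" for r :: real
  define \<Phi> where "\<Phi> p = u (fst p) - u (snd p) - M * \<psi> (norm (fst p - snd p))
    - k * (norm (fst p - z))\<^sup>2 - k * (norm (snd p - z))\<^sup>2" for p :: "(real^'n) \<times> (real^'n)"
  have M0: "0 \<le> M" using N by linarith
  define C where "C = cball z \<rho> \<inter> half_space"
  have C: "compact (C \<times> C)" "(x0, y0) \<in> C \<times> C"
    unfolding C_def using xy by (auto intro!: compact_Times compact_Int_closed closed_half_space)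
  have cu: "continuous_on (C \<times> C) (\<lambda>p. u (fst p))" "continuous_on (C \<times> C) (\<lambda>p. u (snd p))"
    by (rule continuous_on_compose2[OF cont]; use sub in \<open>auto simp: C_def intro!: continuous_intros\<close>)+
  have "continuous_on (C \<times> C) \<Phi>"
    unfolding \<Phi>_def \<psi>_def by (intro continuous_intros cu)
  then obtain q where q: "q \<in> C \<times> C" "\<And>p. p \<in> C \<times> C \<Longrightarrow> \<Phi> p \<le> \<Phi> q"
    using continuous_attains_sup[of "C \<times> C" \<Phi>] C by fastforce
  define x y where "x = fst q" and "y = snd q"
  have xC: "x \<in> C" and yC: "y \<in> C" and q_eq: "q = (x, y)" using q(1) by (auto simp: x_def y_def)
  have xK: "x \<in> K" "y \<in> K" and x0: "0 \<le> x $ bd_coord" "0 \<le> y $ bd_coord"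
    and xr: "norm (x - z) \<le> \<rho>" "norm (y - z) \<le> \<rho>"
    using xC yC sub by (auto simp: C_def half_space_def dist_norm norm_minus_commute)
  define r where "r = norm (x - y)"
  have r0: "0 \<le> r" by (simp add: r_def)
  have r2: "r \<le> 2 * \<rho>"
    using norm_triangle_ineq4[of "x - z" "y - z"] xr by (simp add: r_def)
  have psi: "r / 2 \<le> \<psi> r"
  proof -
    have "\<kappa> * r\<^sup>2 = (\<kappa> * r) * r" by (simp add: power2_eq_square)
    also have "\<dots> \<le> (\<kappa> * (2 * \<rho>)) * r" using r0 r2 \<kappa> by (intro mult_right_mono mult_left_mono) auto
    also have "\<dots> = r / 4" using \<kappa> by (simp add: \<kappa>_def)
    finally show ?thesis using r0 by (simp add: \<psi>_def)
  qed
  have "\<Phi> q \<le> 0"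
  proof (rule ccontr)
    assume neg: "\<not> \<Phi> q \<le> 0"
    have Mpsi: "M * (r / 2) \<le> M * \<psi> r" using psi M0 by (rule mult_left_mono)
    have P: "\<Phi> q = u x - u y - M * \<psi> r - k * (norm (x - z))\<^sup>2 - k * (norm (y - z))\<^sup>2"
      by (simp add: \<Phi>_def q_eq r_def)
    have kp: "0 \<le> k * (norm (p - z))\<^sup>2" for p using k by simp
    have Mr: "0 \<le> M * (r / 2)" using M0 r0 by simp
    have "r \<noteq> 0" using neg P kp[of x] kp[of y] Mr Mpsi by (auto simp: r_def)
    then have r: "0 < r" using r0 by simp
    have "norm (x - z) \<noteq> \<rho>" "norm (y - z) \<noteq> \<rho>"
      using neg P kp[of x] kp[of y] Mr Mpsi bounded[OF xK(1)] bounded[OF xK(2)] k(2) by auto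
    moreover have side: "M * (x $ bd_coord / 2) \<le> M * (r / 2)" if "y $ bd_coord = 0"
      using component_le_norm_cart[of "x - y" bd_coord] that M0
      by (intro mult_left_mono) (auto simp: r_def)
    have side': "M * (y $ bd_coord / 2) \<le> M * (r / 2)" if "x $ bd_coord = 0"
      using component_le_norm_cart[of "x - y" bd_coord] that M0
      by (intro mult_left_mono) (auto simp: r_def)
    have Nx: "\<bar>u p\<bar> \<le> M * (p $ bd_coord / 2)" if "p \<in> C" for p
    proof -
      have "\<bar>u p\<bar> \<le> N * p $ bd_coord" using N(1) that by (auto simp: C_def)
      also have "\<dots> \<le> (M / 2) * p $ bd_coord"
        using N(3) that by (intro mult_right_mono) (auto simp: C_def half_space_def)
      finally show ?thesis by simp
    qed
    have "y $ bd_coord \<noteq> 0"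
    proof
      assume y: "y $ bd_coord = 0"
      then have "u y = 0" using dirichlet xK by auto
      then show False using neg P kp[of x] kp[of y] Mpsi side[OF y] Nx[OF xC] by auto
    qed
    moreover have "x $ bd_coord \<noteq> 0"
    proof
      assume x: "x $ bd_coord = 0"
      then have "u x = 0" using dirichlet xK by auto
      then show False using neg P kp[of x] kp[of y] Mpsi side'[OF x] Nx[OF yC] by auto
    qed
    ultimately have xW: "x \<in> ball z \<rho> \<inter> {p. 0 < p $ bd_coord}" "y \<in> ball z \<rho> \<inter> {p. 0 < p $ bd_coord}"
      using x0 xr by (auto simp: dist_norm norm_minus_commute)
    have W: "open (ball z \<rho> \<inter> {p. 0 < p $ bd_coord})"
      by (intro open_Int open_Collect_less continuous_intros) auto
    have WK: "p \<in> K \<and> 0 < p $ bd_coord \<and> p \<in> C" if "p \<in> ball z \<rho> \<inter> {p. 0 < p $ bd_coord}" for p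
      using that sub by (auto simp: half_space_def C_def)
    have du: "(u has_derivative (\<lambda>v. Du p \<bullet> v)) (at p)" "(Du has_derivative (\<lambda>v. D2u p *v v)) (at p)"
      if "p \<in> ball z \<rho> \<inter> {p. 0 < p $ bd_coord}" for p
      using deriv deriv2 WK[OF that] by blast+
    \<comment> \<open>The parabola c * s^2 + r / 2 touches \<open>\<psi>\<close> from above at s =
      r, because s \<le> s^2 / (2 * r) + r / 2. Composed with the norm it is a polynomial, so the
      norm itself is never differentiated.\<close>
    define c where "c = 1 / (2 * r) - \<kappa>"
    have c: "0 \<le> c" "c \<le> 1 / (2 * r)"
      using r r2 \<kappa>(1) \<rho> unfolding c_def \<kappa>_def by (auto simp: field_simps)
    define e where "e = (1 / r) *\<^sub>R (x - y)"
    have e1: "x - y = r *\<^sub>R e" "norm e = 1"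
      using r by (auto simp: e_def r_def)
    then have e: "x - y = r *\<^sub>R e" "e \<bullet> e = 1" "norm e = 1"
      by (auto simp: norm_eq_1)
    have sq: "(norm (p + t *\<^sub>R v - z))\<^sup>2 = (norm (p - z))\<^sup>2 + 2 * t * ((p - z) \<bullet> v) + t\<^sup>2 * (v \<bullet> v)" for p v t
      unfolding power2_norm_eq_inner by (simp add: algebra_simps inner_commute power2_eq_square)
    \<comment> \<open>For any joint motion of x and y it is enough to bound \<open>\<psi>\<close> by
      a quadratic along \<xi> - \<eta>; the penalty expands exactly.\<close>
    have test: "Du x \<bullet> \<xi> - Du y \<bullet> \<eta> = M * a1 + k * (2 * ((x - z) \<bullet> \<xi>) + 2 * ((y - z) \<bullet> \<eta>))"
        "\<xi> \<bullet> (D2u x *v \<xi>) - \<eta> \<bullet> (D2u y *v \<eta>) \<le> 2 * (M * a2 + k * (\<xi> \<bullet> \<xi> + \<eta> \<bullet> \<eta>))"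
      if a: "\<And>t. \<bar>t\<bar> < r / 2 \<Longrightarrow> \<psi> (norm (x - y + t *\<^sub>R (\<xi> - \<eta>))) \<le> \<psi> r + a1 * t + a2 * t\<^sup>2" for \<xi> \<eta> a1 a2
    proof -
      let ?q1 = "M * a1 + k * (2 * ((x - z) \<bullet> \<xi>) + 2 * ((y - z) \<bullet> \<eta>))"
      let ?q2 = "M * a2 + k * (\<xi> \<bullet> \<xi> + \<eta> \<bullet> \<eta>)"
      have "u (x + t *\<^sub>R \<xi>) - u (y + t *\<^sub>R \<eta>) \<le> u x - u y + (?q1 * t + ?q2 * t\<^sup>2)"
        if t: "x + t *\<^sub>R \<xi> \<in> ball z \<rho> \<inter> {p. 0 < p $ bd_coord}" "y + t *\<^sub>R \<eta> \<in> ball z \<rho> \<inter> {p. 0 < p $ bd_coord}"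
          "\<bar>t\<bar> < r / 2" for t
      proof -
        have "\<Phi> (x + t *\<^sub>R \<xi>, y + t *\<^sub>R \<eta>) \<le> \<Phi> q"
          using WK[OF t(1)] WK[OF t(2)] by (intro q(2)) auto
        moreover have "x + t *\<^sub>R \<xi> - (y + t *\<^sub>R \<eta>) = x - y + t *\<^sub>R (\<xi> - \<eta>)"
          by (simp add: algebra_simps)
        ultimately have 1: "u (x + t *\<^sub>R \<xi>) - u (y + t *\<^sub>R \<eta>) - M * \<psi> (norm (x - y + t *\<^sub>R (\<xi> - \<eta>)))
            - k * ((norm (x - z))\<^sup>2 + 2 * t * ((x - z) \<bullet> \<xi>) + t\<^sup>2 * (\<xi> \<bullet> \<xi>))
            - k * ((norm (y - z))\<^sup>2 + 2 * t * ((y - z) \<bullet> \<eta>) + t\<^sup>2 * (\<eta> \<bullet> \<eta>))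
          \<le> u x - u y - M * \<psi> r - k * (norm (x - z))\<^sup>2 - k * (norm (y - z))\<^sup>2"
          unfolding P unfolding \<Phi>_def fst_conv snd_conv sq by simp
        have 2: "M * \<psi> (norm (x - y + t *\<^sub>R (\<xi> - \<eta>))) \<le> M * (\<psi> r + a1 * t + a2 * t\<^sup>2)"
          using a[OF t(3)] M0 by (rule mult_left_mono)
        have "d \<le> d0 + ((M * a1 + k * (2 * A1 + 2 * B1)) * t + (M * a2 + k * (A2 + B2)) * t\<^sup>2)"
          if "d - M * p' - k * (n1 + 2 * t * A1 + t\<^sup>2 * A2) - k * (n2 + 2 * t * B1 + t\<^sup>2 * B2) \<le> d0 - M * p - k * n1 - k * n2"
            "M * p' \<le> M * (p + a1 * t + a2 * t\<^sup>2)" for d d0 p p' n1 n2 A1 A2 B1 B2 :: real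
          using that by (simp add: algebra_simps)
        from this[OF 1 2] show ?thesis .
      qed
      from quadratic_touching_at_local_max[where \<epsilon> = "r / 2", OF W xW _ du this] r
      show "Du x \<bullet> \<xi> - Du y \<bullet> \<eta> = ?q1" "\<xi> \<bullet> (D2u x *v \<xi>) - \<eta> \<bullet> (D2u y *v \<eta>) \<le> 2 * ?q2"
        by simp_all
    qed
    \<comment> \<open>Opposite motions along \<open>e\<close> make the distance exactly r + 2 * t,
      so the whole concavity -8 * \<kappa> * M = -M / \<rho> is seen. The range |t| < r / 2 keeps
      the distance positive.\<close>
    have mirror: "e \<bullet> (D2u x *v e) - e \<bullet> (D2u y *v e) \<le> - M / \<rho> + 4 * k"
    proof -
      have "\<psi> (norm (x - y + t *\<^sub>R (e - (- e)))) \<le> \<psi> r + (2 - 4 * \<kappa> * r) * t + (- 4 * \<kappa>) * t\<^sup>2" if "\<bar>t\<bar> < r / 2" for t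
      proof -
        have "x - y + t *\<^sub>R (e - (- e)) = (r + 2 * t) *\<^sub>R e"
          unfolding e(1) by (simp add: algebra_simps scaleR_2[symmetric])
        then have "norm (x - y + t *\<^sub>R (e - (- e))) = r + 2 * t"
          using that e(3) by simp
        then show ?thesis by (simp add: \<psi>_def power2_eq_square algebra_simps)
      qed
      from test(2)[of e "- e", OF this] have "e \<bullet> (D2u x *v e) - e \<bullet> (D2u y *v e) \<le> 2 * (M * (- 4 * \<kappa>) + k * 2)"
        using e(2) by (simp add: linear_neg[OF matrix_vector_mul_linear])
      also have "\<dots> = - M / \<rho> + 4 * k" using \<rho> by (simp add: \<kappa>_def field_simps)
      finally show ?thesis .
    qed
    \<comment> \<open>Equal motions leave x - y fixed, and only the penalty contributes.\<close>
    have parallel: "v \<bullet> ((D2u x - D2u y) *v v) \<le> 4 * k * (v \<bullet> v)" for v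
      using test(2)[of v v 0 0] r_def by (simp add: matrix_vector_mult_diff_rdistrib inner_diff_right)
    have touch: "\<psi> (norm (x - y + t *\<^sub>R v)) \<le> \<psi> r + (2 * c * ((x - y) \<bullet> v)) * t + (c * (v \<bullet> v)) * t\<^sup>2" for t v
    proof -
      define s where "s = norm (x - y + t *\<^sub>R v)"
      have s2: "s\<^sup>2 = r\<^sup>2 + 2 * t * ((x - y) \<bullet> v) + t\<^sup>2 * (v \<bullet> v)"
        unfolding s_def r_def power2_norm_eq_inner
        by (simp add: algebra_simps inner_commute power2_eq_square)
      have "0 \<le> (s - r)\<^sup>2 / (2 * r)" using r by simp
      also have "\<dots> = s\<^sup>2 / (2 * r) + r / 2 - s"
        using r by (simp add: power2_eq_square field_simps)
      finally have "s \<le> s\<^sup>2 / (2 * r) + r / 2" by simp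
      then have "\<psi> s \<le> c * s\<^sup>2 + r / 2" by (simp add: \<psi>_def c_def algebra_simps)
      also have "\<dots> = c * (2 * t * ((x - y) \<bullet> v) + t\<^sup>2 * (v \<bullet> v)) + \<psi> r"
        unfolding s2 \<psi>_def c_def using r by (simp add: field_simps power2_eq_square)
      finally show ?thesis by (simp add: s_def algebra_simps)
    qed
    \<comment> \<open>Motion of x alone. The Hessian bound of order M / r is used only against the
      remainder \<open>Ex\<close>, whose trace is of order L * r; the gradient formula serves the
      drift.\<close>
    have left: "Du x \<bullet> v = M * (2 * c * ((x - y) \<bullet> v)) + 2 * k * ((x - z) \<bullet> v)"
      "v \<bullet> (D2u x *v v) \<le> (M / r + 2 * k) * (v \<bullet> v)" for v
    proof -
      show "Du x \<bullet> v = M * (2 * c * ((x - y) \<bullet> v)) + 2 * k * ((x - z) \<bullet> v)"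
        using test(1)[of v 0, OF touch[of _ "v - 0"]] by simp
      have "v \<bullet> (D2u x *v v) \<le> 2 * (M * (c * (v \<bullet> v)) + k * (v \<bullet> v))"
        using test(2)[of v 0, OF touch[of _ "v - 0"]] by simp
      also have "\<dots> = (M * (2 * c) + 2 * k) * (v \<bullet> v)" by (simp add: algebra_simps)
      also have "\<dots> \<le> (M * (1 / r) + 2 * k) * (v \<bullet> v)"
        using c M0 by (intro mult_right_mono add_right_mono mult_left_mono) auto
      finally show "v \<bullet> (D2u x *v v) \<le> (M / r + 2 * k) * (v \<bullet> v)" by simp
    qed
    have right: "- (Du y \<bullet> v) = M * (2 * c * ((x - y) \<bullet> (- v))) + 2 * k * ((y - z) \<bullet> v)"
      "v \<bullet> ((- D2u y) *v v) \<le> (M / r + 2 * k) * (v \<bullet> v)" for v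
    proof -
      show "- (Du y \<bullet> v) = M * (2 * c * ((x - y) \<bullet> (- v))) + 2 * k * ((y - z) \<bullet> v)"
        using test(1)[of 0 v, OF touch[of _ "0 - v"]] by simp
      have "(- D2u y) *v v = - (D2u y *v v)"
        by (simp add: matrix_vector_mult_def vec_eq_iff sum_negf)
      then have "v \<bullet> ((- D2u y) *v v) \<le> 2 * (M * (c * (v \<bullet> v)) + k * (v \<bullet> v))"
        using test(2)[of 0 v, OF touch[of _ "0 - v"]] by simp
      also have "\<dots> = (M * (2 * c) + 2 * k) * (v \<bullet> v)" by (simp add: algebra_simps)
      also have "\<dots> \<le> (M * (1 / r) + 2 * k) * (v \<bullet> v)"
        using c M0 by (intro mult_right_mono add_right_mono mult_left_mono) auto
      finally show "v \<bullet> ((- D2u y) *v v) \<le> (M / r + 2 * k) * (v \<bullet> v)" by simp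
    qed
    have cr: "\<bar>M * (2 * c * ((x - y) \<bullet> v))\<bar> \<le> M * norm v" for v
    proof -
      have "\<bar>2 * c * ((x - y) \<bullet> v)\<bar> \<le> (1 / r) * (r * norm v)"
        unfolding abs_mult using c Cauchy_Schwarz_ineq2[of "x - y" v]
        by (intro mult_mono) (auto simp: r_def)
      then have "M * \<bar>2 * c * ((x - y) \<bullet> v)\<bar> \<le> M * norm v"
        using M0 r by (intro mult_left_mono) auto
      then show ?thesis using M0 by (simp add: abs_mult)
    qed
    have zr: "\<bar>2 * k * ((p - z) \<bullet> v)\<bar> \<le> 2 * k * \<rho> * norm v" if "norm (p - z) \<le> \<rho>" for p v
    proof -
      have "\<bar>(p - z) \<bullet> v\<bar> \<le> \<rho> * norm v"
        using Cauchy_Schwarz_ineq2[of "p - z" v] that by (meson mult_right_mono norm_ge_zero order_trans)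
      then show ?thesis using k by (simp add: abs_mult)
    qed
    have drift: "\<bar>bv x \<bullet> Du x\<bar> \<le> \<beta> * (M + 2 * k * \<rho>)" "\<bar>bv y \<bullet> Du y\<bar> \<le> \<beta> * (M + 2 * k * \<rho>)"
    proof -
      have *: "M * norm (bv p) + 2 * k * \<rho> * norm (bv p) \<le> \<beta> * (M + 2 * k * \<rho>)" if "p \<in> K" for p
        using mult_right_mono[OF drift_le[OF that], of "M + 2 * k * \<rho>"] M0 k \<rho> by (simp add: algebra_simps)
      show "\<bar>bv x \<bullet> Du x\<bar> \<le> \<beta> * (M + 2 * k * \<rho>)"
        using left(1)[of "bv x"] cr[of "bv x"] zr[OF xr(1), of "bv x"] *[OF xK(1)] inner_commute[of "bv x" "Du x"] by linarith
      show "\<bar>bv y \<bullet> Du y\<bar> \<le> \<beta> * (M + 2 * k * \<rho>)"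
        using right(1)[of "bv y"] cr[of "- bv y"] zr[OF xr(2), of "bv y"] *[OF xK(2)] inner_commute[of "bv y" "Du y"]
        by (simp only: norm_minus_cancel)
    qed
    text \<open>\<open>A x = \<theta> e e\<^sup>T + B + Ex\<close> and \<open>A y = \<theta> e e\<^sup>T + B + Ey\<close>: the first part is coupled
      by reflection, the second synchronously, and the small remainders are not coupled.\<close>
    define B Ex Ey :: "real^'n^'n" where
      "B = (\<chi> i j. A y $ i $ j - \<theta> * (e $ i * e $ j) - (if i = j then L * r else 0))" and
      "Ex = (\<chi> i j. A x $ i $ j - A y $ i $ j + (if i = j then L * r else 0))" and
      "Ey = (\<chi> i j. if i = j then L * r else 0)"
    have dq: "(\<Sum>i\<in>UNIV. \<Sum>j\<in>UNIV. v $ i * v $ j * (if i = j then L * r else 0)) = L * r * (v \<bullet> v)" for v :: "real^'n"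
      by (simp add: inner_vec_def sum_distrib_left if_distrib cong: if_cong) (simp add: mult_ac)
    have eq: "(\<Sum>i\<in>UNIV. \<Sum>j\<in>UNIV. v $ i * v $ j * (\<theta> * (e $ i * e $ j))) = \<theta> * (v \<bullet> e)\<^sup>2" for v :: "real^'n"
      by (simp add: inner_vec_def power2_eq_square sum_product sum_distrib_left mult_ac)
    have Bq: "v \<bullet> (B *v v) = v \<bullet> (A y *v v) - \<theta> * (v \<bullet> e)\<^sup>2 - L * r * (v \<bullet> v)" for v
      unfolding quad_form_sum B_def dq[symmetric] eq[symmetric]
      by (simp add: right_diff_distrib sum_subtractf)
    have Exq: "v \<bullet> (Ex *v v) = v \<bullet> (A x *v v) - v \<bullet> (A y *v v) + L * r * (v \<bullet> v)" for v
      unfolding quad_form_sum Ex_def dq[symmetric]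
      by (simp add: distrib_left right_diff_distrib sum_subtractf sum.distrib)
    have Eyq: "v \<bullet> (Ey *v v) = L * r * (v \<bullet> v)" for v
      unfolding quad_form_sum Ey_def dq[symmetric] by simp
    have symA: "A p $ i $ j = A p $ j $ i" if "p \<in> K" for p i j
      using sym[OF that] by (metis transpose_def vec_lambda_beta)
    \<comment> \<open>This makes \<open>B\<close> nonnegative: of the 2 * \<theta> from ellipticity,
      one half pays for the projection onto \<open>e\<close>, the other for the shift by L *
      r.\<close>
    have Lr: "L * r \<le> \<theta>"
    proof -
      have "L * r \<le> L * (2 * \<rho>)" using pos r2 by (intro mult_left_mono) auto
      also have "\<dots> \<le> (3 * n * L) * \<rho>"
        using mult_mono[of 2 "3 * n" "L * \<rho>" "L * \<rho>"] n1 pos \<rho> by (simp add: mult_ac)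
      also have "\<dots> \<le> \<rho> * (2 * \<beta> + 3 * n * L)" using pos \<rho> by (simp add: algebra_simps)
      also have "\<dots> \<le> \<theta>" using small pos by (simp add: n_def)
      finally show ?thesis .
    qed
    have trA: "\<bar>A x $ i $ i - A y $ i $ i\<bar> \<le> L * r" for i
      using lipschitz[OF xK, of "axis i 1"]
      by (simp add: matrix_vector_mult_basis column_def inner_axis' r_def)
    have diag: "0 \<le> A y $ i $ i" for i
      using elliptic[OF xK(2), of "axis i 1"] pos
      by (simp add: matrix_vector_mult_basis column_def inner_axis')
    have "(\<Sum>i\<in>UNIV. \<Sum>j\<in>UNIV. B $ i $ j * (D2u x - D2u y) $ i $ j) \<le> 4 * k * (\<Sum>i\<in>UNIV. B $ i $ i)"
    proof (rule psd_trace_le[OF _ _ parallel])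
      show "transpose B = B"
        by (auto simp: B_def transpose_def vec_eq_iff symA[OF xK(2)] mult.commute)
      show "0 \<le> v \<bullet> (B *v v)" for v
      proof -
        have "\<theta> * (v \<bullet> e)\<^sup>2 \<le> \<theta> * (v \<bullet> v)"
          using Cauchy_Schwarz_ineq[of v e] e(2) pos by (intro mult_left_mono) auto
        moreover have "L * r * (v \<bullet> v) \<le> \<theta> * (v \<bullet> v)" using Lr by (intro mult_right_mono) auto
        ultimately show ?thesis using elliptic[OF xK(2), of v] unfolding Bq by linarith
      qed
    qed
    also have "\<dots> \<le> 4 * k * T"
    proof -
      have "(\<Sum>i\<in>UNIV. B $ i $ i) \<le> (\<Sum>i\<in>UNIV. A y $ i $ i)"
      proof (rule sum_mono)
        fix i
        have "0 \<le> \<theta> * (e $ i * e $ i)" "0 \<le> L * r" using pos r by simp_all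
        then show "B $ i $ i \<le> A y $ i $ i" by (simp add: B_def)
      qed
      then show ?thesis using trace_le[OF xK(2)] k by simp
    qed
    finally have IB: "(\<Sum>i\<in>UNIV. \<Sum>j\<in>UNIV. B $ i $ j * (D2u x - D2u y) $ i $ j) \<le> 4 * k * T" .
    have Mk: "0 \<le> M / r + 2 * k" using M0 r k by simp
    have "(\<Sum>i\<in>UNIV. \<Sum>j\<in>UNIV. Ex $ i $ j * D2u x $ i $ j) \<le> (M / r + 2 * k) * (\<Sum>i\<in>UNIV. Ex $ i $ i)"
    proof (rule psd_trace_le[OF _ _ left(2)])
      show "transpose Ex = Ex"
        by (auto simp: Ex_def transpose_def vec_eq_iff symA[OF xK(1)] symA[OF xK(2)])
      show "0 \<le> v \<bullet> (Ex *v v)" for v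
        using lipschitz[OF xK, of v] unfolding Exq r_def by linarith
    qed
    \<comment> \<open>A diagonal entry of \<open>Ex\<close> is at most 2 * L * r, so the factor 1 /
      r cancels and 2 * n * L * M remains. Together with n * L * M from \<open>Ey\<close> this is
      the origin of 3 * n * L in \<open>small\<close>.\<close>
    also have "\<dots> \<le> (M / r + 2 * k) * (\<Sum>i\<in>(UNIV::'n set). 2 * (L * r))"
      using trA Mk by (intro mult_left_mono sum_mono) (auto simp: Ex_def abs_le_iff)
    finally have IEx: "(\<Sum>i\<in>UNIV. \<Sum>j\<in>UNIV. Ex $ i $ j * D2u x $ i $ j) \<le> (M / r + 2 * k) * (2 * n * (L * r))"
      by (simp add: n_def mult_ac)
    have "(\<Sum>i\<in>UNIV. \<Sum>j\<in>UNIV. Ey $ i $ j * (- D2u y) $ i $ j) \<le> (M / r + 2 * k) * (\<Sum>i\<in>UNIV. Ey $ i $ i)"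
    proof (rule psd_trace_le[OF _ _ right(2)])
      show "transpose Ey = Ey"
        by (auto simp: Ey_def transpose_def vec_eq_iff)
      show "0 \<le> v \<bullet> (Ey *v v)" for v
        unfolding Eyq using pos r by simp
    qed
    then have IEy: "(\<Sum>i\<in>UNIV. \<Sum>j\<in>UNIV. Ey $ i $ j * (- D2u y) $ i $ j) \<le> (M / r + 2 * k) * (n * (L * r))"
      by (simp add: Ey_def n_def mult_ac)
    have "(\<Sum>i\<in>UNIV. \<Sum>j\<in>UNIV. \<theta> * (e $ i * e $ j) * (D2u x $ i $ j - D2u y $ i $ j)) =
        \<theta> * (e \<bullet> (D2u x *v e) - e \<bullet> (D2u y *v e))"
      unfolding quad_form_sum sum_subtractf[symmetric] sum_distrib_left
      by (simp add: algebra_simps)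
    also have "\<dots> \<le> \<theta> * (- M / \<rho> + 4 * k)"
      using mirror pos by (intro mult_left_mono) auto
    finally have Ie: "(\<Sum>i\<in>UNIV. \<Sum>j\<in>UNIV. \<theta> * (e $ i * e $ j) * (D2u x $ i $ j - D2u y $ i $ j)) \<le> \<theta> * (- M / \<rho> + 4 * k)" .
    have split: "A x $ i $ j * D2u x $ i $ j - A y $ i $ j * D2u y $ i $ j =
      \<theta> * (e $ i * e $ j) * (D2u x $ i $ j - D2u y $ i $ j) + B $ i $ j * (D2u x - D2u y) $ i $ j
      + Ex $ i $ j * D2u x $ i $ j + Ey $ i $ j * (- D2u y) $ i $ j" for i j
      by (simp add: B_def Ex_def Ey_def algebra_simps)
    have "(\<Sum>i\<in>UNIV. \<Sum>j\<in>UNIV. A x $ i $ j * D2u x $ i $ j) - (\<Sum>i\<in>UNIV. \<Sum>j\<in>UNIV. A y $ i $ j * D2u y $ i $ j)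
      \<le> \<theta> * (- M / \<rho> + 4 * k) + 4 * k * T + (M / r + 2 * k) * (2 * n * (L * r)) + (M / r + 2 * k) * (n * (L * r))"
      unfolding sum_subtractf[symmetric] split sum.distrib using Ie IB IEx IEy by linarith
    also have "\<dots> = - (M * \<theta> / \<rho>) + 3 * n * L * M + k * (4 * \<theta> + 4 * T + 6 * n * L * r)"
      using r \<rho> by (simp add: field_simps)
    also have "\<dots> \<le> - (M * \<theta> / \<rho>) + 3 * n * L * M + k * (4 * \<theta> + 4 * T + 12 * n * L * \<rho>)"
    proof -
      have "(6 * n * L) * r \<le> (6 * n * L) * (2 * \<rho>)"
        using r2 n1 pos by (intro mult_left_mono) auto
      then show ?thesis using k by simp
    qed
    finally have up: "(\<Sum>i\<in>UNIV. \<Sum>j\<in>UNIV. A x $ i $ j * D2u x $ i $ j) - (\<Sum>i\<in>UNIV. \<Sum>j\<in>UNIV. A y $ i $ j * D2u y $ i $ j)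
      \<le> - (M * \<theta> / \<rho>) + 3 * n * L * M + k * (4 * \<theta> + 4 * T + 12 * n * L * \<rho>)" .
    have lo: "- 2 * h - 2 * (\<beta> * (M + 2 * k * \<rho>)) \<le> (\<Sum>i\<in>UNIV. \<Sum>j\<in>UNIV. A x $ i $ j * D2u x $ i $ j) - (\<Sum>i\<in>UNIV. \<Sum>j\<in>UNIV. A y $ i $ j * D2u y $ i $ j)"
      using pde[of x] pde[of y] xK xW drift by auto
    have "(2 * \<beta> + 3 * n * L) * M \<le> (\<theta> / (2 * \<rho>)) * M"
      using small M0 \<rho> by (intro mult_right_mono) (auto simp: field_simps n_def)
    then have "2 * \<beta> * M + 3 * n * L * M \<le> M * \<theta> / (2 * \<rho>)"
      by (simp add: algebra_simps)
    moreover have "M * \<theta> / \<rho> = 2 * (M * \<theta> / (2 * \<rho>))" by simp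
    moreover have "M * \<theta> / (2 * \<rho>) > 2 * h + k * (4 * \<beta> * \<rho> + 4 * \<theta> + 4 * T + 12 * n * L * \<rho>)"
      using M by (simp add: k_def n_def)
    moreover have "k * (4 * \<beta> * \<rho> + 4 * \<theta> + 4 * T + 12 * n * L * \<rho>) =
      2 * (\<beta> * (2 * k * \<rho>)) + k * (4 * \<theta> + 4 * T + 12 * n * L * \<rho>)"
      by (simp add: algebra_simps)
    moreover have "\<beta> * (M + 2 * k * \<rho>) = \<beta> * M + \<beta> * (2 * k * \<rho>)" by (simp add: algebra_simps)
    ultimately show False using up lo by linarith
  qed
  then have "\<Phi> (x0, y0) \<le> 0" using q(2)[OF C(2)] by simp
  moreover have "M * \<psi> (norm (x0 - y0)) \<le> M * norm (x0 - y0)"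
    using M0 \<kappa> by (intro mult_left_mono) (auto simp: \<psi>_def)
  ultimately show ?thesis unfolding k_def[symmetric] by (simp add: \<Phi>_def algebra_simps)
qed

end

section \<open>Calculus in relatively open subsets of the half space\<close>

abbreviation rel_open :: "(real^'n) set \<Rightarrow> bool" where
  "rel_open W \<equiv> openin (top_of_set half_space) W"

text \<open>From a boundary point the transversal axis can be followed inward only, the other axes
  both ways. Such one-sided segments suffice for uniqueness of derivatives and for difference
  quotients, and they also lead from the boundary into the interior.\<close>

lemma rel_open_path:
  assumes "rel_open W" "x \<in> W" "i = bd_coord \<Longrightarrow> 0 \<le> c"
  obtains d where "d > 0" "\<And>t. 0 \<le> t \<Longrightarrow> t < d \<Longrightarrow> x + t *\<^sub>R axis i c \<in> W"
proof -
  obtain U where U: "open U" "W = half_space \<inter> U"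
    using assms(1) by (auto simp: openin_open)
  have "((\<lambda>t. x + t *\<^sub>R axis i c) \<longlongrightarrow> x + 0 *\<^sub>R axis i c) (at_right 0)"
    by (intro tendsto_intros)
  then have "\<forall>\<^sub>F t in at_right 0. x + t *\<^sub>R axis i c \<in> U"
    using U assms by (auto dest: topological_tendstoD)
  then obtain d where d: "d > 0" "\<And>t. 0 < t \<Longrightarrow> t < d \<Longrightarrow> x + t *\<^sub>R axis i c \<in> U"
    unfolding eventually_at_right[OF zero_less_one] by auto
  have "x + t *\<^sub>R axis i c \<in> W" if "0 \<le> t" "t < d" for t
  proof (cases "t = 0")
    case False
    then have "x + t *\<^sub>R axis i c \<in> half_space"
      using that assms U by (auto simp: half_space_def axis_def)
    then show ?thesis using U d that False by auto
  qed (use assms in auto)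
  then show ?thesis using that d(1) by blast
qed

text \<open>Every coordinate axis can be followed a short way forward inside W, even from a boundary
  point, and this determines a derivative within W. Hence \<open>partial_within\<close> can be read
  off from any derivative at hand.\<close>

lemma rel_open_deriv_unique:
  fixes f :: "real^'n \<Rightarrow> 'b::real_normed_vector"
  assumes "rel_open W" "x \<in> W" "(f has_derivative D) (at x within W)" "(f has_derivative E) (at x within W)"
  shows "D = E"
proof (rule frechet_derivative_unique_within[OF assms(3,4)])
  fix v :: "real^'n" and e :: real assume v: "v \<in> Basis" and e: "0 < e"
  then obtain i where i: "v = axis i 1" by (auto simp: Basis_vec_def)
  obtain d where "d > 0" "\<And>t. 0 \<le> t \<Longrightarrow> t < d \<Longrightarrow> x + t *\<^sub>R axis i 1 \<in> W"
    using rel_open_path[OF assms(1,2), of i 1] by auto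
  then show "\<exists>d. 0 < \<bar>d\<bar> \<and> \<bar>d\<bar> < e \<and> x + d *\<^sub>R v \<in> W"
    using e i by (intro exI[of _ "min d e / 2"]) auto
qed

lemma partial_within_eq:
  assumes "rel_open W" "x \<in> W" "(f has_derivative D) (at x within W)"
  shows "partial_within W i f x = D (axis i 1)"
proof -
  have "(f has_derivative frechet_derivative f (at x within W)) (at x within W)"
    using assms(3) by (auto simp: frechet_derivative_works[symmetric] differentiable_def)
  then show ?thesis
    using rel_open_deriv_unique[OF assms(1,2) _ assms(3)] by (simp add: partial_within_def)
qed

lemma has_derivative_partial_within:
  fixes f :: "real^'n \<Rightarrow> 'b::real_normed_vector"
  assumes "f differentiable (at x within W)"
  shows "(f has_derivative (\<lambda>v. \<Sum>i\<in>UNIV. v $ i *\<^sub>R partial_within W i f x)) (at x within W)"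
proof -
  let ?D = "frechet_derivative f (at x within W)"
  have D: "(f has_derivative ?D) (at x within W)"
    using assms by (simp add: frechet_derivative_works)
  then interpret bounded_linear ?D by (rule has_derivative_bounded_linear)
  have "?D v = (\<Sum>i\<in>UNIV. v $ i *\<^sub>R partial_within W i f x)" for v
  proof -
    have "v = (\<Sum>i\<in>UNIV. v $ i *\<^sub>R axis i 1)"
      using basis_expansion[of v] by (simp add: scalar_mult_eq_scaleR)
    then have "?D v = ?D (\<Sum>i\<in>UNIV. v $ i *\<^sub>R axis i 1)" by (rule arg_cong)
    also have "\<dots> = (\<Sum>i\<in>UNIV. v $ i *\<^sub>R ?D (axis i 1))" by (simp only: sum scaleR)
    finally show ?thesis by (simp only: partial_within_def)
  qed
  then have "?D = (\<lambda>v. \<Sum>i\<in>UNIV. v $ i *\<^sub>R partial_within W i f x)" by (rule ext)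
  with D show ?thesis by metis
qed

text \<open>Second order differentiability point by point, one-sided at the boundary. It makes the
  first partials continuous, hence bounded on compact sets, and it is the regularity at which the
  maximum principle operates.\<close>

definition C2_on :: "(real^'n) set \<Rightarrow> (real^'n \<Rightarrow> 'b::real_normed_vector) \<Rightarrow> bool" where
  "C2_on W f \<longleftrightarrow> f differentiable_on W \<and> (\<forall>i. partial_within W i f differentiable_on W)"

lemma differentiable_within_extension:
  assumes "open U" "x \<in> U" "x \<in> W" "\<And>y. y \<in> U \<inter> W \<Longrightarrow> F y = f y" "(F has_derivative D) (at x)"
  shows "(f has_derivative D) (at x within W)"
proof -
  obtain d where d: "d > 0" "ball x d \<subseteq> U" using assms(1,2) by (auto simp: open_contains_ball)
  show ?thesis
    by (rule has_derivative_transform_within[OF has_derivative_at_withinI[OF assms(5)] d(1) assms(3)])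
      (use assms(4) subsetD[OF d(2)] in \<open>auto simp: dist_commute\<close>)
qed

text \<open>By uniqueness of derivatives within W, the partials of a local extension agree on W with
  the partials taken within W. So these in turn have differentiable local extensions.\<close>

lemma smooth_on_C2:
  fixes f :: "real^'n \<Rightarrow> 'b::real_normed_vector"
  assumes W: "rel_open W" and "smooth_on W f"
  shows "C2_on W f"
proof -
  have "f differentiable (at x within W) \<and> (\<forall>i. partial_within W i f differentiable (at x within W))"
    if x: "x \<in> W" for x
  proof -
    obtain U F where "x \<in> U" "smooth_on_open U F" "\<forall>y\<in>U \<inter> W. F y = f y"
      using bspec[OF assms(2)[unfolded smooth_on_def] x] by blast
    then have U: "x \<in> U" "smooth_on_open U F" "\<And>y. y \<in> U \<inter> W \<Longrightarrow> F y = f y" by blast+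
    then have op: "open U" and s: "\<And>is. foldr (partial_within U) is F differentiable_on U"
      by (auto simp: smooth_on_open_def)
    have F: "(F has_derivative frechet_derivative F (at y within U)) (at y)" if "y \<in> U" for y
      using s[of "[]"] that op
      by (metis at_within_open differentiable_on_def foldr.simps(1) frechet_derivative_works id_apply)
    have f: "(f has_derivative frechet_derivative F (at y within U)) (at y within W)" if "y \<in> U \<inter> W" for y
      by (rule differentiable_within_extension[OF op _ _ U(3) F]) (use that in auto)
    have p: "partial_within U i F y = partial_within W i f y" if "y \<in> U \<inter> W" for i y
      using partial_within_eq[OF W _ f[OF that]] that by (simp add: partial_within_def)
    have P: "(partial_within U i F has_derivative frechet_derivative (partial_within U i F) (at x)) (at x)" for i
    proof -
      have "partial_within U i F differentiable (at x within U)"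
        using s[of "[i]"] U(1) by (simp add: differentiable_on_def)
      then have "partial_within U i F differentiable (at x)"
        by (simp only: at_within_open[OF U(1) op])
      then show ?thesis by (simp only: frechet_derivative_works)
    qed
    have "(partial_within W i f has_derivative frechet_derivative (partial_within U i F) (at x)) (at x within W)" for i
      by (rule differentiable_within_extension[OF op U(1) x _ P]) (rule p)
    moreover have "(f has_derivative frechet_derivative F (at x within U)) (at x within W)"
      using f x U(1) by blast
    ultimately show ?thesis unfolding differentiable_def by blast
  qed
  then show ?thesis by (auto simp: C2_on_def differentiable_on_def)
qed

lemma partial_within_linear:
  assumes "rel_open W" "x \<in> W" "bounded_linear l" "f differentiable (at x within W)"
  shows "partial_within W i (\<lambda>y. l (f y)) x = l (partial_within W i f x)"
proof -
  have D: "(f has_derivative frechet_derivative f (at x within W)) (at x within W)"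
    using assms(4) by (simp add: frechet_derivative_works)
  show ?thesis
    using partial_within_eq[OF assms(1,2) bounded_linear.has_derivative[OF assms(3) D]]
    by (simp add: partial_within_def)
qed

lemma partial_within_sum:
  assumes "rel_open W" "x \<in> W" "\<And>j. j \<in> J \<Longrightarrow> f j differentiable (at x within W)"
  shows "partial_within W i (\<lambda>y. \<Sum>j\<in>J. f j y) x = (\<Sum>j\<in>J. partial_within W i (f j) x)"
proof -
  have D: "(f j has_derivative frechet_derivative (f j) (at x within W)) (at x within W)" if "j \<in> J" for j
    using assms(3)[OF that] by (simp add: frechet_derivative_works)
  show ?thesis
    using partial_within_eq[OF assms(1,2) has_derivative_sum[of J, OF D]]
    by (simp add: partial_within_def)
qed

lemma partial_within_cong:
  assumes "x \<in> W" "\<And>y. y \<in> W \<Longrightarrow> f y = h y"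
  shows "partial_within W i f x = partial_within W i h x"
proof -
  have "(f has_derivative D) (at x within W) \<longleftrightarrow> (h has_derivative D) (at x within W)" for D
    using assms by (intro iffI; elim has_derivative_transform[rotated 2]) auto
  then show ?thesis by (simp add: partial_within_def frechet_derivative_def)
qed

lemma differentiable_within_cong:
  assumes "f differentiable (at x within W)" "x \<in> W" "\<And>y. y \<in> W \<Longrightarrow> f y = h y"
  shows "h differentiable (at x within W)"
  using assms has_derivative_transform[of x W h f] by (metis differentiable_def)

lemma partial_within_scaleR:
  fixes f :: "real^'n \<Rightarrow> real" and p :: "real^'n \<Rightarrow> 'b::real_normed_vector"
  assumes "rel_open W" "x \<in> W" "f differentiable (at x within W)" "p differentiable (at x within W)"
  shows "partial_within W i (\<lambda>y. f y *\<^sub>R p y) x =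
    partial_within W i f x *\<^sub>R p x + f x *\<^sub>R partial_within W i p x"
proof -
  have "(f has_derivative frechet_derivative f (at x within W)) (at x within W)"
    "(p has_derivative frechet_derivative p (at x within W)) (at x within W)"
    using assms(3,4) by (simp_all add: frechet_derivative_works)
  from partial_within_eq[OF assms(1,2) has_derivative_scaleR[OF this]]
  show ?thesis by (simp add: partial_within_def)
qed

lemma C2_on_linear:
  assumes W: "rel_open W" and l: "bounded_linear l" and f: "C2_on W f"
  shows "C2_on W (\<lambda>y. l (f y))"
proof -
  have 1: "(\<lambda>y. l (f y)) differentiable (at x within W)" if "f differentiable (at x within W)" for f x
    using that bounded_linear.has_derivative[OF l] by (auto simp: differentiable_def)
  have "partial_within W i (\<lambda>y. l (f y)) differentiable (at x within W)" if "x \<in> W" for i x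
    by (rule differentiable_within_cong[OF 1[of "partial_within W i f"]])
      (use f W l that in \<open>auto simp: C2_on_def differentiable_on_def partial_within_linear\<close>)
  then show ?thesis using f 1 by (auto simp: C2_on_def differentiable_on_def)
qed

lemma C2_on_sum:
  assumes W: "rel_open W" and f: "\<And>j. j \<in> J \<Longrightarrow> C2_on W (f j)"
  shows "C2_on W (\<lambda>y. \<Sum>j\<in>J. f j y)"
proof -
  have 1: "(\<lambda>y. \<Sum>j\<in>J. f j y) differentiable (at x within W)"
    if "\<And>j. j \<in> J \<Longrightarrow> f j differentiable (at x within W)" for f x
    using has_derivative_sum[of J f, OF frechet_derivative_works[THEN iffD1, OF that]]
    by (auto simp: differentiable_def)
  have "partial_within W i (\<lambda>y. \<Sum>j\<in>J. f j y) differentiable (at x within W)" if "x \<in> W" for i x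
    by (rule differentiable_within_cong[OF 1[of "\<lambda>j. partial_within W i (f j)"]])
      (use f W that in \<open>auto simp: C2_on_def differentiable_on_def partial_within_sum\<close>)
  then show ?thesis using f 1[of f] by (auto simp: C2_on_def differentiable_on_def)
qed

section \<open>Functions with uniformly bounded values and derivatives\<close>

text \<open>A class closed under sums, products, inverses and square roots away from 0, so that
  coefficients built from the metric can be handled by following their formulas. The derivative is
  taken within W while the bound is uniform over S: this controls \<open>partial_within W\<close> on
  S, and for convex S inside W it gives a Lipschitz constant.\<close>

definition lip_on :: "(real^'n) set \<Rightarrow> (real^'n) set \<Rightarrow> (real^'n \<Rightarrow> real) \<Rightarrow> bool" where
  "lip_on W S f \<longleftrightarrow> (\<exists>C. \<forall>x\<in>S. \<exists>D. (f has_derivative D) (at x within W) \<and> \<bar>f x\<bar> \<le> C \<and> (\<forall>v. \<bar>D v\<bar> \<le> C * norm v))"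

lemma lip_onD:
  assumes "lip_on W S f"
  shows "\<exists>C D. 0 \<le> C \<and> (\<forall>x\<in>S. (f has_derivative D x) (at x within W) \<and> \<bar>f x\<bar> \<le> C \<and> (\<forall>v. \<bar>D x v\<bar> \<le> C * norm v))"
proof -
  obtain C where C: "\<forall>x\<in>S. \<exists>D. (f has_derivative D) (at x within W) \<and> \<bar>f x\<bar> \<le> C \<and> (\<forall>v. \<bar>D v\<bar> \<le> C * norm v)"
    using assms by (auto simp: lip_on_def)
  then obtain D where D: "\<forall>x\<in>S. (f has_derivative D x) (at x within W) \<and> \<bar>f x\<bar> \<le> C \<and> (\<forall>v. \<bar>D x v\<bar> \<le> C * norm v)"
    by metis
  have "C * norm v \<le> \<bar>C\<bar> * norm v" for v :: "real^'n" by (intro mult_right_mono) auto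
  with D show ?thesis
    by (intro exI[of _ "\<bar>C\<bar>"] exI[of _ D]) (auto intro: order_trans)
qed

lemma lip_onI:
  assumes "\<And>x. x \<in> S \<Longrightarrow> (f has_derivative D x) (at x within W)"
    "\<And>x. x \<in> S \<Longrightarrow> \<bar>f x\<bar> \<le> C1" "\<And>x v. x \<in> S \<Longrightarrow> \<bar>D x v\<bar> \<le> C2 * norm v"
  shows "lip_on W S f"
  unfolding lip_on_def
proof (intro exI[of _ "max C1 C2"] ballI)
  fix x assume x: "x \<in> S"
  have "\<bar>D x v\<bar> \<le> max C1 C2 * norm v" for v
    using assms(3)[OF x, of v] mult_right_mono[of C2 "max C1 C2" "norm v"] by auto
  then show "\<exists>D. (f has_derivative D) (at x within W) \<and> \<bar>f x\<bar> \<le> max C1 C2 \<and> (\<forall>v. \<bar>D v\<bar> \<le> max C1 C2 * norm v)"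
    using assms(1,2)[OF x] by (intro exI[of _ "D x"]) (auto simp: le_max_iff_disj)
qed

lemma lip_on_const: "lip_on W S (\<lambda>x. c)"
  by (rule lip_onI[where D = "\<lambda>x v. 0" and ?C1.0 = "\<bar>c\<bar>" and ?C2.0 = 0]) auto

lemma lip_on_add:
  assumes "lip_on W S f" "lip_on W S h"
  shows "lip_on W S (\<lambda>x. f x + h x)"
proof -
  obtain C D where "0 \<le> C" "\<forall>x\<in>S. (f has_derivative D x) (at x within W) \<and> \<bar>f x\<bar> \<le> C \<and> (\<forall>v. \<bar>D x v\<bar> \<le> C * norm v)"
    using lip_onD[OF assms(1)] by blast
  then have 1: "0 \<le> C" "\<And>x. x \<in> S \<Longrightarrow> (f has_derivative D x) (at x within W)"
    "\<And>x. x \<in> S \<Longrightarrow> \<bar>f x\<bar> \<le> C" "\<And>x v. x \<in> S \<Longrightarrow> \<bar>D x v\<bar> \<le> C * norm v"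
    by blast+
  obtain C' D' where "0 \<le> C'" "\<forall>x\<in>S. (h has_derivative D' x) (at x within W) \<and> \<bar>h x\<bar> \<le> C' \<and> (\<forall>v. \<bar>D' x v\<bar> \<le> C' * norm v)"
    using lip_onD[OF assms(2)] by blast
  then have 2: "0 \<le> C'" "\<And>x. x \<in> S \<Longrightarrow> (h has_derivative D' x) (at x within W)"
    "\<And>x. x \<in> S \<Longrightarrow> \<bar>h x\<bar> \<le> C'" "\<And>x v. x \<in> S \<Longrightarrow> \<bar>D' x v\<bar> \<le> C' * norm v"
    by blast+
  show ?thesis
  proof (rule lip_onI)
    fix x assume x: "x \<in> S"
    show "((\<lambda>x. f x + h x) has_derivative (\<lambda>v. D x v + D' x v)) (at x within W)"
      by (rule has_derivative_add[OF 1(2)[OF x] 2(2)[OF x]])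
    show "\<bar>f x + h x\<bar> \<le> C + C'" using 1(3)[OF x] 2(3)[OF x] by linarith
    fix v show "\<bar>D x v + D' x v\<bar> \<le> (C + C') * norm v"
      using 1(4)[OF x, of v] 2(4)[OF x, of v] by (simp add: distrib_right)
  qed
qed

lemma lip_on_mult:
  assumes "lip_on W S f" "lip_on W S h"
  shows "lip_on W S (\<lambda>x. f x * h x)"
proof -
  obtain C D where "0 \<le> C" "\<forall>x\<in>S. (f has_derivative D x) (at x within W) \<and> \<bar>f x\<bar> \<le> C \<and> (\<forall>v. \<bar>D x v\<bar> \<le> C * norm v)"
    using lip_onD[OF assms(1)] by blast
  then have 1: "0 \<le> C" "\<And>x. x \<in> S \<Longrightarrow> (f has_derivative D x) (at x within W)"
    "\<And>x. x \<in> S \<Longrightarrow> \<bar>f x\<bar> \<le> C" "\<And>x v. x \<in> S \<Longrightarrow> \<bar>D x v\<bar> \<le> C * norm v"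
    by blast+
  obtain C' D' where "0 \<le> C'" "\<forall>x\<in>S. (h has_derivative D' x) (at x within W) \<and> \<bar>h x\<bar> \<le> C' \<and> (\<forall>v. \<bar>D' x v\<bar> \<le> C' * norm v)"
    using lip_onD[OF assms(2)] by blast
  then have 2: "0 \<le> C'" "\<And>x. x \<in> S \<Longrightarrow> (h has_derivative D' x) (at x within W)"
    "\<And>x. x \<in> S \<Longrightarrow> \<bar>h x\<bar> \<le> C'" "\<And>x v. x \<in> S \<Longrightarrow> \<bar>D' x v\<bar> \<le> C' * norm v"
    by blast+
  show ?thesis
  proof (rule lip_onI)
    fix x assume x: "x \<in> S"
    show "((\<lambda>x. f x * h x) has_derivative (\<lambda>v. f x * D' x v + D x v * h x)) (at x within W)"
      by (rule has_derivative_mult[OF 1(2)[OF x] 2(2)[OF x]])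
    show "\<bar>f x * h x\<bar> \<le> C * C'" using 1(1) 1(3)[OF x] 2(3)[OF x] by (simp add: abs_mult mult_mono)
    fix v
    have "\<bar>f x * D' x v\<bar> \<le> C * (C' * norm v)" "\<bar>D x v * h x\<bar> \<le> (C * norm v) * C'"
      unfolding abs_mult using 1(1) 2(1) 1(3)[OF x] 2(3)[OF x] 1(4)[OF x, of v] 2(4)[OF x, of v]
      by (auto intro!: mult_mono)
    then show "\<bar>f x * D' x v + D x v * h x\<bar> \<le> (2 * C * C') * norm v"
      by (simp add: algebra_simps abs_le_iff)
  qed
qed

lemma lip_on_sum: "(\<And>j. j \<in> J \<Longrightarrow> lip_on W S (f j)) \<Longrightarrow> lip_on W S (\<lambda>x. \<Sum>j\<in>J. f j x)"
  by (induction J rule: infinite_finite_induct) (auto intro: lip_on_const lip_on_add)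

lemma lip_on_prod: "(\<And>j. j \<in> J \<Longrightarrow> lip_on W S (f j)) \<Longrightarrow> lip_on W S (\<lambda>x. \<Prod>j\<in>J. f j x)"
  by (induction J rule: infinite_finite_induct) (auto intro: lip_on_const lip_on_mult)

lemma lip_on_compose:
  fixes \<phi> :: "real \<Rightarrow> real"
  assumes "lip_on W S f" and "\<And>x. x \<in> S \<Longrightarrow> (\<phi> has_real_derivative \<phi>' (f x)) (at (f x))"
    and "\<And>x. x \<in> S \<Longrightarrow> \<bar>\<phi> (f x)\<bar> \<le> B" "\<And>x. x \<in> S \<Longrightarrow> \<bar>\<phi>' (f x)\<bar> \<le> B'"
  shows "lip_on W S (\<lambda>x. \<phi> (f x))"
proof -
  obtain C D where "0 \<le> C" "\<forall>x\<in>S. (f has_derivative D x) (at x within W) \<and> \<bar>f x\<bar> \<le> C \<and> (\<forall>v. \<bar>D x v\<bar> \<le> C * norm v)"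
    using lip_onD[OF assms(1)] by blast
  then have 1: "0 \<le> C" "\<And>x. x \<in> S \<Longrightarrow> (f has_derivative D x) (at x within W)"
    "\<And>x. x \<in> S \<Longrightarrow> \<bar>f x\<bar> \<le> C" "\<And>x v. x \<in> S \<Longrightarrow> \<bar>D x v\<bar> \<le> C * norm v"
    by blast+
  show ?thesis
  proof (rule lip_onI)
    fix x assume x: "x \<in> S"
    show "((\<lambda>x. \<phi> (f x)) has_derivative (\<lambda>v. D x v * \<phi>' (f x))) (at x within W)"
      using DERIV_compose_FDERIV[OF assms(2)[OF x] 1(2)[OF x]] .
    show "\<bar>\<phi> (f x)\<bar> \<le> B" by (rule assms(3)[OF x])
    fix v
    have "\<bar>D x v\<bar> * \<bar>\<phi>' (f x)\<bar> \<le> (C * norm v) * B'"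
      using 1(1) 1(4)[OF x, of v] assms(4)[OF x] by (intro mult_mono) auto
    then show "\<bar>D x v * \<phi>' (f x)\<bar> \<le> (C * B') * norm v"
      by (simp add: abs_mult mult_ac)
  qed
qed

lemma lip_on_inverse:
  assumes "lip_on W S f" "c > 0" "\<And>x. x \<in> S \<Longrightarrow> c \<le> f x"
  shows "lip_on W S (\<lambda>x. inverse (f x))"
proof (rule lip_on_compose[OF assms(1), where \<phi>' = "\<lambda>y. - (inverse y * inverse y)" and B = "inverse c" and B' = "inverse c * inverse c"])
  fix x assume x: "x \<in> S"
  then have f: "0 < f x" "inverse (f x) \<le> inverse c" using assms(2,3) by (force intro: le_imp_inverse_le)+
  then show "(inverse has_real_derivative - (inverse (f x) * inverse (f x))) (at (f x))"
    using DERIV_inverse[of "f x" UNIV] by (simp add: power2_eq_square)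
  show "\<bar>inverse (f x)\<bar> \<le> inverse c" using f by simp
  show "\<bar>- (inverse (f x) * inverse (f x))\<bar> \<le> inverse c * inverse c"
    using f assms(2) mult_mono[OF f(2) f(2)] by (simp add: abs_mult)
qed

lemma lip_on_sqrt:
  assumes "lip_on W S f" "c > 0" "\<And>x. x \<in> S \<Longrightarrow> c \<le> f x"
  shows "lip_on W S (\<lambda>x. sqrt (f x))"
proof -
  obtain C where C: "\<And>x. x \<in> S \<Longrightarrow> \<bar>f x\<bar> \<le> C" using lip_onD[OF assms(1)] by blast
  show ?thesis
  proof (rule lip_on_compose[OF assms(1), where \<phi>' = "\<lambda>y. inverse (sqrt y) / 2" and B = "sqrt C" and B' = "inverse (sqrt c)"])
    fix x assume x: "x \<in> S"
    then have f: "0 < f x" using assms by force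
    then show "(sqrt has_real_derivative inverse (sqrt (f x)) / 2) (at (f x))"
      by (rule DERIV_real_sqrt)
    show "\<bar>sqrt (f x)\<bar> \<le> sqrt C" using C[OF x] f by simp
    have "inverse (sqrt (f x)) \<le> inverse (sqrt c)"
      using assms(2,3)[OF ] x by (intro le_imp_inverse_le) auto
    moreover have "0 < inverse (sqrt c)" "0 < inverse (sqrt (f x))" using assms(2) f by simp_all
    ultimately show "\<bar>inverse (sqrt (f x)) / 2\<bar> \<le> inverse (sqrt c)"
      unfolding abs_le_iff by linarith
  qed
qed

lemma lip_on_cong:
  assumes "lip_on W S f" "S \<subseteq> W" "\<And>x. x \<in> W \<Longrightarrow> f x = h x"
  shows "lip_on W S h"
proof -
  obtain C D where "0 \<le> C" "\<forall>x\<in>S. (f has_derivative D x) (at x within W) \<and> \<bar>f x\<bar> \<le> C \<and> (\<forall>v. \<bar>D x v\<bar> \<le> C * norm v)"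
    using lip_onD[OF assms(1)] by blast
  then have 1: "0 \<le> C" "\<And>x. x \<in> S \<Longrightarrow> (f has_derivative D x) (at x within W)"
    "\<And>x. x \<in> S \<Longrightarrow> \<bar>f x\<bar> \<le> C" "\<And>x v. x \<in> S \<Longrightarrow> \<bar>D x v\<bar> \<le> C * norm v"
    by blast+
  have "(h has_derivative D x) (at x within W)" if "x \<in> S" for x
    by (rule has_derivative_transform[OF _ _ 1(2)[OF that]]) (use that assms in auto)
  moreover have "\<bar>h x\<bar> \<le> C" if "x \<in> S" for x
    using 1(3)[OF that] assms(3)[of x] that assms(2) by auto
  ultimately show ?thesis
    using 1(4) by (rule lip_onI)
qed

lemma lip_on_C2:
  assumes W: "rel_open W" and S: "compact S" "S \<subseteq> W" and f: "C2_on W f"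
  shows "lip_on W S f"
proof -
  have cont: "continuous_on S f" "\<And>i. continuous_on S (partial_within W i f)"
    using f S unfolding C2_on_def
    by (meson continuous_on_subset differentiable_imp_continuous_on)+
  obtain C where C: "\<And>x. x \<in> S \<Longrightarrow> \<bar>f x\<bar> \<le> C"
    using compact_imp_bounded[OF compact_continuous_image[OF cont(1) S(1)]]
    by (auto simp: bounded_iff)
  have "\<exists>B. \<forall>x\<in>S. \<bar>partial_within W i f x\<bar> \<le> B" for i
    using compact_imp_bounded[OF compact_continuous_image[OF cont(2)[of i] S(1)]]
    by (auto simp: bounded_iff)
  then obtain B where B: "\<And>i x. x \<in> S \<Longrightarrow> \<bar>partial_within W i f x\<bar> \<le> B i" by metis
  show ?thesis
  proof (rule lip_onI)
    fix x assume x: "x \<in> S"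
    show "(f has_derivative (\<lambda>v. \<Sum>i\<in>UNIV. v $ i *\<^sub>R partial_within W i f x)) (at x within W)"
      using f x S by (intro has_derivative_partial_within) (auto simp: C2_on_def differentiable_on_def)
    show "\<bar>f x\<bar> \<le> C" using C[OF x] .
    fix v :: "real^'a"
    have "\<bar>\<Sum>i\<in>UNIV. v $ i *\<^sub>R partial_within W i f x\<bar> \<le> (\<Sum>i\<in>UNIV. \<bar>v $ i *\<^sub>R partial_within W i f x\<bar>)"
      by (rule sum_abs)
    also have "\<dots> \<le> (\<Sum>i\<in>UNIV. norm v * B i)"
      using B[OF x] component_le_norm_cart[of v] by (intro sum_mono) (auto simp: abs_mult intro!: mult_mono)
    finally show "\<bar>\<Sum>i\<in>UNIV. v $ i *\<^sub>R partial_within W i f x\<bar> \<le> (\<Sum>i\<in>UNIV. B i) * norm v"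
      by (simp add: sum_distrib_right mult.commute[of "norm v"])
  qed
qed

lemma lip_on_lipschitz:
  assumes "lip_on W S f" "convex S" "S \<subseteq> W"
  obtains C where "0 \<le> C" "\<And>x y. x \<in> S \<Longrightarrow> y \<in> S \<Longrightarrow> \<bar>f x - f y\<bar> \<le> C * norm (x - y)"
proof -
  obtain C D where "0 \<le> C" "\<forall>x\<in>S. (f has_derivative D x) (at x within W) \<and> \<bar>f x\<bar> \<le> C \<and> (\<forall>v. \<bar>D x v\<bar> \<le> C * norm v)"
    using lip_onD[OF assms(1)] by blast
  then have 1: "0 \<le> C" "\<And>x. x \<in> S \<Longrightarrow> (f has_derivative D x) (at x within W)"
    "\<And>x. x \<in> S \<Longrightarrow> \<bar>f x\<bar> \<le> C" "\<And>x v. x \<in> S \<Longrightarrow> \<bar>D x v\<bar> \<le> C * norm v"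
    by blast+
  have "\<bar>f x - f y\<bar> \<le> C * norm (x - y)" if "x \<in> S" "y \<in> S" for x y
    using differentiable_bound[OF assms(2) _ _ that, of f D C] that
      has_derivative_subset[OF 1(2) assms(3)] onorm_bound[OF 1(1), of "D _"] 1(4) by auto
  then show ?thesis using that 1(1) by blast
qed

lemma lip_on_det:
  assumes "\<And>i j. lip_on W S (\<lambda>x. G x $ i $ j)"
  shows "lip_on W S (\<lambda>x. det (G x))"
  unfolding det_def by (intro lip_on_sum lip_on_mult lip_on_const lip_on_prod assms)

section \<open>Determinants and inverses of positive definite matrices\<close>

text \<open>The factorization gives P as the transpose of M times M, so the determinant is a square;
  it is nonzero because definiteness makes the kernel trivial.\<close>

lemma det_pos_of_posdef:
  fixes P :: "real^'n^'n"
  assumes "transpose P = P" "\<And>v. v \<noteq> 0 \<Longrightarrow> 0 < v \<bullet> (P *v v)"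
  shows "0 < det P"
proof -
  have "0 \<le> v \<bullet> (P *v v)" for v
    using assms(2)[of v] by (cases "v = 0") auto
  then obtain F :: "'n \<Rightarrow> real^'n" where F: "\<And>i j. P$i$j = (\<Sum>k\<in>UNIV. F k $ i * F k $ j)"
    using psd_factorization[of UNIV P] assms(1) by auto
  define M :: "real^'n^'n" where "M = (\<chi> k. F k)"
  have "P = transpose M ** M"
    by (simp add: vec_eq_iff matrix_matrix_mult_def transpose_def M_def F)
  then have "det P = (det M)\<^sup>2" by (simp add: det_mul det_transpose power2_eq_square)
  moreover have "det P \<noteq> 0"
  proof
    assume "det P = 0"
    then have "\<not> (\<forall>v. P *v v = 0 \<longrightarrow> v = 0)"
      using invertible_det_nz[of P] by (simp add: matrix_left_invertible_ker[symmetric] invertible_left_inverse)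
    then obtain v where "v \<noteq> 0" "P *v v = 0" by blast
    then show False using assms(2)[of v] by simp
  qed
  ultimately show ?thesis by simp
qed

text \<open>Cramer's rule, column by column. It presents the inverse as polynomials in the entries
  times the inverse determinant, a form through which \<open>lip_on\<close> propagates.\<close>

lemma matrix_inv_cramer:
  fixes P :: "real^'n^'n"
  assumes "det P \<noteq> 0"
  shows "matrix_inv P $ k $ l = det (\<chi> i j. if j = k then axis l 1 $ i else P $ i $ j) * inverse (det P)"
proof -
  have "invertible P" using assms by (simp add: invertible_det_nz)
  then have "P ** matrix_inv P = mat 1"
    unfolding invertible_def matrix_inv_def by (rule someI2_ex) simp
  then have "P *v (matrix_inv P *v axis l 1) = axis l 1"
    by (simp add: matrix_vector_mul_assoc)
  then have "matrix_inv P *v axis l 1 = (\<chi> k. det (\<chi> i j. if j = k then axis l 1 $ i else P $ i $ j) / det P)"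
    using cramer[OF assms] by blast
  then show ?thesis
    by (simp add: matrix_vector_mult_basis column_def vec_eq_iff divide_inverse)
qed

lemma lip_on_matrix_inv:
  fixes G :: "real^'n \<Rightarrow> real^'n^'n"
  assumes G: "\<And>i j. lip_on W S (\<lambda>x. G x $ i $ j)" and S: "S \<subseteq> W" and d: "\<And>x. x \<in> W \<Longrightarrow> 0 < det (G x)"
    and c: "c > 0" "\<And>x. x \<in> S \<Longrightarrow> c \<le> det (G x)"
  shows "lip_on W S (\<lambda>x. matrix_inv (G x) $ k $ l)"
proof -
  have "lip_on W S (\<lambda>x. (\<chi> i j. if j = k then axis l 1 $ i else G x $ i $ j) $ i $ j)" for i j
    using G by (cases "j = k") (auto intro: lip_on_const)
  then have "lip_on W S (\<lambda>x. det (\<chi> i j. if j = k then axis l 1 $ i else G x $ i $ j) * inverse (det (G x)))"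
    by (intro lip_on_mult lip_on_det lip_on_inverse[OF _ c] G)
  then show ?thesis
    by (rule lip_on_cong[OF _ S]) (use d in \<open>simp add: matrix_inv_cramer less_imp_neq[THEN not_sym]\<close>)
qed

section \<open>The gradient estimate in a chart\<close>

context half_space_dirichlet_problem
begin

text \<open>The free rates of the barrier and of the doubling are fixed here, as multiples of q = m
  / \<rho> + \<rho> * h. For \<rho> \<le> 1 the constants \<open>c1\<close> and \<open>c2\<close>
  exceed the brackets in the hypotheses on those rates; their summand 1 makes the inequalities
  strict and takes care of the coefficient of h.\<close>

lemma difference_bound:
  defines "c1 \<equiv> 2 * T + 2 * \<beta> + 1"
    and "c2 \<equiv> 4 * \<beta> + 4 * \<theta> + 4 * T + 12 * real CARD('n) * L + 1"
  assumes \<rho>: "0 < \<rho>" "\<rho> \<le> 1" and z: "z \<in> half_space" and sub: "cball z (3 * \<rho>) \<inter> half_space \<subseteq> K"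
    and small: "\<rho> * (2 * \<beta> + 3 * real CARD('n) * L) \<le> \<theta> / 2"
    and x: "x \<in> cball z \<rho> \<inter> half_space"
  shows "\<bar>u x - u z\<bar> \<le> (2 + 4 * (c1 + c2) / \<theta>) * (m / \<rho> + \<rho> * h) * norm (x - z) + (2 * m / \<rho>\<^sup>2) * (norm (x - z))\<^sup>2"
proof -
  define n where "n = real CARD('n)"
  define q where "q = m / \<rho> + \<rho> * h"
  have q: "0 < q" "m / \<rho> \<le> q" using pos \<rho> by (auto simp: q_def add_pos_pos)
  have qr: "q / \<rho> = m / \<rho>\<^sup>2 + h" using \<rho> by (simp add: q_def field_simps power2_eq_square)
  have k: "0 < m / \<rho>\<^sup>2" using pos \<rho> by simp
  \<comment> \<open>Chosen so that N * \<theta> / (2 * \<rho>) equals c1 * (m / \<rho>^2 + h). In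
    \<open>M\<close> below, 4 * c1 / \<theta> * q is 2 * N, the summand 2 * q pays for the
    additional m / \<rho> in the boundary rate, and 4 * c2 / \<theta> * q is for the doubling
    itself.\<close>
  define N where "N = (2 / \<theta>) * c1 * q"
  define M where "M = (2 + 4 * (c1 + c2) / \<theta>) * q"
  have c: "1 \<le> c1" "1 \<le> c2" using pos by (auto simp: c1_def c2_def intro!: add_nonneg_nonneg)
  have "\<rho> * (2 * \<beta>) \<le> \<rho> * (2 * \<beta> + 3 * real CARD('n) * L)"
    using pos \<rho> by (intro mult_left_mono) auto
  then have small1: "\<rho> * \<beta> \<le> \<theta> / 2" using small pos \<rho>(1) mult_nonneg_nonneg[of \<rho> \<beta>] by linarith
  have b\<rho>: "\<beta> * \<rho> \<le> \<beta>" using pos \<rho> by (simp add: mult_left_le)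
  have "N * \<theta> / (2 * \<rho>) = c1 * (q / \<rho>)" using pos by (simp add: N_def)
  also have "\<dots> = c1 * h + c1 * (m / \<rho>\<^sup>2)" by (simp add: qr algebra_simps)
  also have "\<dots> > h + (m / \<rho>\<^sup>2) * (2 * T + 2 * \<beta> * \<rho>)"
  proof -
    have "(m / \<rho>\<^sup>2) * (2 * T + 2 * \<beta> * \<rho>) < (m / \<rho>\<^sup>2) * c1"
      using k b\<rho> by (intro mult_strict_left_mono) (auto simp: c1_def)
    moreover have "1 * h \<le> c1 * h" using c pos by (intro mult_right_mono) auto
    ultimately show ?thesis by (simp add: mult.commute)
  qed
  finally have N: "N * \<theta> / (2 * \<rho>) > h + (m / \<rho>\<^sup>2) * (2 * T + 2 * \<beta> * \<rho>)" .
  have N0: "0 \<le> N + m / \<rho>" using c q pos \<rho> by (simp add: N_def)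
  have NM: "2 * (N + m / \<rho>) \<le> M"
  proof -
    define X where "X = (4 / \<theta>) * c2 * q"
    have "0 \<le> X" using c q pos by (simp add: X_def)
    moreover have "M = 2 * N + 2 * q + X"
      by (simp add: M_def N_def X_def algebra_simps add_divide_distrib)
    moreover have "2 * (N + m / \<rho>) \<le> 2 * (N + q)" using q(2) by (intro mult_left_mono add_left_mono) auto
    ultimately show ?thesis by (simp add: algebra_simps)
  qed
  have M: "M * \<theta> / (2 * \<rho>) > 2 * h + (2 * m / \<rho>\<^sup>2) * (4 * \<beta> * \<rho> + 4 * \<theta> + 4 * T + 12 * real CARD('n) * L * \<rho>)"
  proof -
    have "12 * n * L * \<rho> \<le> 12 * n * L" using pos \<rho> by (intro mult_left_le) (auto simp: n_def)
    moreover have "4 * \<beta> * \<rho> \<le> 4 * \<beta>" using b\<rho> by simp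
    ultimately have "4 * \<beta> * \<rho> + 4 * \<theta> + 4 * T + 12 * n * L * \<rho> < c2"
      unfolding c2_def n_def[symmetric] by linarith
    then have "(2 * (m / \<rho>\<^sup>2)) * (4 * \<beta> * \<rho> + 4 * \<theta> + 4 * T + 12 * n * L * \<rho>) < (2 * (m / \<rho>\<^sup>2)) * c2"
      using k by (intro mult_strict_left_mono) auto
    moreover have "1 * (2 * h) \<le> c2 * (2 * h)" using c pos by (intro mult_right_mono) auto
    ultimately have "2 * h + (2 * m / \<rho>\<^sup>2) * (4 * \<beta> * \<rho> + 4 * \<theta> + 4 * T + 12 * n * L * \<rho>) < 2 * c2 * (m / \<rho>\<^sup>2 + h)"
      by (simp add: algebra_simps)
    also have "\<dots> = (4 * c2 / \<theta> * q) * \<theta> / (2 * \<rho>)" using pos by (simp add: qr[symmetric])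
    also have "\<dots> \<le> M * \<theta> / (2 * \<rho>)"
    proof (intro divide_right_mono mult_right_mono)
      have "4 * c2 / \<theta> \<le> 2 + 4 * (c1 + c2) / \<theta>"
        using c pos by (simp add: add_divide_distrib)
      then show "4 * c2 / \<theta> * q \<le> M" unfolding M_def using q by (intro mult_right_mono) auto
    qed (use pos \<rho> in auto)
    finally show ?thesis by (simp add: n_def)
  qed
  have zz: "z \<in> cball z \<rho> \<inter> half_space" using z \<rho> by auto
  have sub1: "cball z \<rho> \<inter> half_space \<subseteq> K" using sub \<rho> by auto
  have bl: "\<bar>u y\<bar> \<le> (N + m / \<rho>) * y $ bd_coord" if "y \<in> cball z \<rho> \<inter> half_space" for y
    by (rule boundary_lipschitz[OF \<rho>(1) z sub small1 N that])
  \<comment> \<open>With z as one of the two points its half of the penalty is 0; exchanging the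
    points gives the other sign.\<close>
  have "u x - u z \<le> M * norm (x - z) + (2 * m / \<rho>\<^sup>2) * ((norm (x - z))\<^sup>2 + (norm (z - z))\<^sup>2)"
    by (rule doubled_comparison[OF \<rho>(1) z sub1 small bl N0 NM M x zz])
  moreover have "u z - u x \<le> M * norm (z - x) + (2 * m / \<rho>\<^sup>2) * ((norm (z - z))\<^sup>2 + (norm (x - z))\<^sup>2)"
    by (rule doubled_comparison[OF \<rho>(1) z sub1 small bl N0 NM M zz x])
  ultimately show ?thesis by (auto simp: M_def q_def norm_minus_commute abs_le_iff)
qed

end

text \<open>Difference quotients along the positive axis are available even at the boundary. Divided
  by t the bound is M + k * t, so the quadratic term disappears in the limit.\<close>

lemma partial_within_le:
  fixes f :: "real^'n \<Rightarrow> real"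
  assumes W: "rel_open W" "z \<in> W" "f differentiable (at z within W)"
    and "\<rho> > 0" and bound: "\<And>x. x \<in> cball z \<rho> \<inter> W \<Longrightarrow> \<bar>f x - f z\<bar> \<le> M * norm (x - z) + k * (norm (x - z))\<^sup>2"
  shows "\<bar>partial_within W i f z\<bar> \<le> M"
proof -
  obtain d where d: "d > 0" "\<And>t. 0 \<le> t \<Longrightarrow> t < d \<Longrightarrow> z + t *\<^sub>R axis i 1 \<in> W"
    using rel_open_path[OF W(1,2), of i 1] by auto
  let ?e = "axis i (1::real) :: real^'n"
  have line: "((\<lambda>t. z + t *\<^sub>R ?e) has_derivative (\<lambda>t. t *\<^sub>R ?e)) (at 0 within {0..d / 2})"
    by (auto intro!: derivative_eq_intros)
  have "(\<lambda>t. z + t *\<^sub>R ?e) ` {0..d / 2} \<subseteq> W" using d by auto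
  from has_derivative_subset[OF has_derivative_partial_within[OF W(3)] this]
  have "(f has_derivative (\<lambda>v. \<Sum>i\<in>UNIV. v $ i *\<^sub>R partial_within W i f z)) (at (z + 0 *\<^sub>R ?e) within (\<lambda>t. z + t *\<^sub>R ?e) ` {0..d / 2})"
    by simp
  from diff_chain_within[OF line this]
  have "((\<lambda>t. f (z + t *\<^sub>R ?e)) has_real_derivative partial_within W i f z) (at 0 within {0..d / 2})"
    by (simp add: has_field_derivative_def o_def axis_def if_distrib[where f = "\<lambda>c. _ * c"] if_distrib[where f = "\<lambda>c. c * _"] mult_commute_abs cong: if_cong)
  then have "((\<lambda>t. (f (z + t *\<^sub>R ?e) - f z) / t) \<longlongrightarrow> partial_within W i f z) (at 0 within {0..d / 2})"
    by (simp add: has_field_derivative_iff)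
  moreover have "at 0 within {0..d / 2} = at_right (0::real)"
    using d(1) by (intro at_within_Icc_at_right) simp
  ultimately have "((\<lambda>t. (f (z + t *\<^sub>R ?e) - f z) / t) \<longlongrightarrow> partial_within W i f z) (at_right 0)"
    by simp
  then have lim: "((\<lambda>t. \<bar>(f (z + t *\<^sub>R ?e) - f z) / t\<bar>) \<longlongrightarrow> \<bar>partial_within W i f z\<bar>) (at_right 0)"
    by (rule tendsto_rabs)
  have lim': "((\<lambda>t. M + k * t) \<longlongrightarrow> M + k * 0) (at_right 0)"
    by (intro tendsto_intros)
  have "\<forall>\<^sub>F t in at_right 0. \<bar>(f (z + t *\<^sub>R ?e) - f z) / t\<bar> \<le> M + k * t"
    unfolding eventually_at_right[OF zero_less_one]
  proof (intro exI[of _ "min d \<rho>"] conjI allI impI)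
    fix t assume t: "0 < t" "t < min d \<rho>"
    have "\<bar>f (z + t *\<^sub>R ?e) - f z\<bar> \<le> M * t + k * t\<^sup>2"
      using bound[of "z + t *\<^sub>R ?e"] d(2)[of t] t by (simp add: dist_norm)
    then show "\<bar>(f (z + t *\<^sub>R ?e) - f z) / t\<bar> \<le> M + k * t"
      using t by (simp add: field_simps power2_eq_square)
  qed (use d \<open>\<rho> > 0\<close> in auto)
  from tendsto_le[OF _ lim' lim this] show ?thesis by simp
qed

section \<open>The Laplacian in one chart\<close>

text \<open>The coordinate expression of minus the positive Laplacian, so that its leading
  coefficients form a positive definite matrix, as in the locale for the Dirichlet problem.\<close>

definition div_op :: "(real^'n) set \<Rightarrow> (real^'n \<Rightarrow> real^'n^'n) \<Rightarrow> (real^'n \<Rightarrow> 'b::real_normed_vector) \<Rightarrow> real^'n \<Rightarrow> 'b" where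
  "div_op W G w x = (1 / sqrt (det (G x))) *\<^sub>R (\<Sum>i\<in>UNIV. \<Sum>j\<in>UNIV.
     partial_within W i (\<lambda>y. (matrix_inv (G y) $ i $ j * sqrt (det (G y))) *\<^sub>R partial_within W j w y) x)"

lemma matrix_inv_inverse:
  fixes P :: "real^'n^'n"
  assumes "det P \<noteq> 0"
  shows "P ** matrix_inv P = mat 1" "matrix_inv P ** P = mat 1"
proof -
  have "\<exists>B. P ** B = mat 1 \<and> B ** P = mat 1"
    using assms by (simp add: invertible_det_nz[symmetric] invertible_def)
  then have "P ** matrix_inv P = mat 1 \<and> matrix_inv P ** P = mat 1"
    unfolding matrix_inv_def by (rule someI_ex)
  then show "P ** matrix_inv P = mat 1" "matrix_inv P ** P = mat 1" by auto
qed

lemma matrix_inv_symmetric: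
  fixes P :: "real^'n^'n"
  assumes "det P \<noteq> 0" "transpose P = P"
  shows "transpose (matrix_inv P) = matrix_inv P"
proof -
  have "transpose (matrix_inv P) ** P = mat 1"
    using matrix_inv_inverse(1)[OF assms(1)] assms(2) by (metis matrix_transpose_mul transpose_mat)
  then have "transpose (matrix_inv P) ** (P ** matrix_inv P) = matrix_inv P"
    by (simp add: matrix_mul_assoc)
  then show ?thesis using matrix_inv_inverse(1)[OF assms(1)] by simp
qed

lemma lip_on_bounds:
  assumes "lip_on W S f" "rel_open W" "S \<subseteq> W"
  shows "\<exists>C\<ge>0. \<forall>x\<in>S. \<bar>f x\<bar> \<le> C \<and> (\<forall>i. \<bar>partial_within W i f x\<bar> \<le> C)"
proof -
  obtain C D where C: "0 \<le> C" "\<forall>x\<in>S. (f has_derivative D x) (at x within W) \<and> \<bar>f x\<bar> \<le> C \<and> (\<forall>v. \<bar>D x v\<bar> \<le> C * norm v)"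
    using lip_onD[OF assms(1)] by blast
  have "\<bar>partial_within W i f x\<bar> \<le> C" if x: "x \<in> S" for i x
  proof -
    have "partial_within W i f x = D x (axis i 1)"
      using C x assms by (intro partial_within_eq) auto
    then show ?thesis using C(2) x by (metis mult.right_neutral norm_axis_1)
  qed
  then show ?thesis using C by blast
qed

locale chart_metric =
  fixes W :: "(real^'n) set" and G :: "real^'n \<Rightarrow> real^'n^'n"
  assumes W: "rel_open W"
    and C2: "\<And>i j. C2_on W (\<lambda>x. G x $ i $ j)"
    and symmetric: "x \<in> W \<Longrightarrow> transpose (G x) = G x"
    and posdef: "x \<in> W \<Longrightarrow> v \<noteq> 0 \<Longrightarrow> 0 < v \<bullet> (G x *v v)"
begin

lemma det_pos: "x \<in> W \<Longrightarrow> 0 < det (G x)"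
  using det_pos_of_posdef[OF symmetric posdef] .

text \<open>By compactness the determinant stays away from 0 on S, and then inverse matrix and
  square root do not leave the class \<open>lip_on\<close>.\<close>

lemma coefficients_lip:
  assumes S: "compact S" "S \<subseteq> W"
  shows "lip_on W S (\<lambda>x. det (G x))" "lip_on W S (\<lambda>x. matrix_inv (G x) $ i $ j)"
    "lip_on W S (\<lambda>x. matrix_inv (G x) $ i $ j * sqrt (det (G x)))"
    "\<exists>c>0. \<forall>x\<in>S. c \<le> det (G x)"
proof -
  have G: "lip_on W S (\<lambda>x. G x $ i $ j)" for i j
    by (rule lip_on_C2[OF W S C2])
  show d: "lip_on W S (\<lambda>x. det (G x))" by (rule lip_on_det[OF G])
  have "continuous_on S (\<lambda>x. det (G x))"
  proof -
    obtain D where "\<forall>x\<in>S. ((\<lambda>x. det (G x)) has_derivative D x) (at x within W)"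
      using lip_onD[OF d] by blast
    then have "(\<lambda>x. det (G x)) differentiable_on S"
      using S(2) by (auto simp: differentiable_on_def differentiable_def intro: has_derivative_subset)
    then show ?thesis by (rule differentiable_imp_continuous_on)
  qed
  then show ex: "\<exists>c>0. \<forall>x\<in>S. c \<le> det (G x)"
  proof (cases "S = {}")
    case False
    then obtain x where "x \<in> S" "\<forall>y\<in>S. det (G x) \<le> det (G y)"
      using continuous_attains_inf[OF S(1) False \<open>continuous_on S _\<close>] by blast
    then show ?thesis using det_pos S(2) by blast
  qed (auto intro: zero_less_one)
  then obtain c where c: "c > 0" "\<And>x. x \<in> S \<Longrightarrow> c \<le> det (G x)" by blast
  show inv: "lip_on W S (\<lambda>x. matrix_inv (G x) $ i $ j)"
    by (rule lip_on_matrix_inv[OF G S(2) det_pos c])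
  show "lip_on W S (\<lambda>x. matrix_inv (G x) $ i $ j * sqrt (det (G x)))"
    by (rule lip_on_mult[OF inv lip_on_sqrt[OF d c]])
qed

lemma coefficient_differentiable:
  assumes "x \<in> W"
  shows "(\<lambda>x. matrix_inv (G x) $ i $ j * sqrt (det (G x))) differentiable (at x within W)"
    "(\<lambda>x. matrix_inv (G x) $ i $ j) differentiable (at x within W)"
  using lip_onD[OF coefficients_lip(3)[of "{x}" i j]] lip_onD[OF coefficients_lip(2)[of "{x}" i j]] assms
  by (auto simp: differentiable_def)

lemma inverse_symmetric: "x \<in> W \<Longrightarrow> transpose (matrix_inv (G x)) = matrix_inv (G x)"
  using det_pos[of x] symmetric by (intro matrix_inv_symmetric) auto

lemma inverse_posdef:
  assumes "x \<in> W" "v \<noteq> 0"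
  shows "0 < v \<bullet> (matrix_inv (G x) *v v)"
proof -
  define w where "w = matrix_inv (G x) *v v"
  have v: "v = G x *v w"
    using matrix_inv_inverse(1)[of "G x"] det_pos[OF assms(1)] by (simp add: w_def matrix_vector_mul_assoc)
  then have "w \<noteq> 0" using assms(2) by auto
  then have "0 < w \<bullet> (G x *v w)" using posdef assms(1) by blast
  then show ?thesis unfolding w_def[symmetric] by (subst v) (simp add: inner_commute)
qed

text \<open>The form attains a positive minimum on the compact product of S with the unit sphere and
  is homogeneous in v. Half of the minimum is taken because ellipticity is stated with 2 *
  \<theta>.\<close>

lemma inverse_elliptic:
  assumes S: "compact S" "S \<subseteq> W"
  shows "\<exists>\<theta>>0. \<forall>x\<in>S. \<forall>v. 2 * \<theta> * (v \<bullet> v) \<le> v \<bullet> (matrix_inv (G x) *v v)"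
proof (cases "S = {}")
  case False
  let ?f = "\<lambda>p. snd p \<bullet> (matrix_inv (G (fst p)) *v snd p)"
  have c: "continuous_on S (\<lambda>x. matrix_inv (G x) $ i $ j)" for i j
    using coefficient_differentiable(2) S(2)
    by (intro continuous_on_subset[OF differentiable_imp_continuous_on S(2)]) (auto simp: differentiable_on_def)
  have c': "continuous_on (S \<times> sphere 0 1) (\<lambda>p. matrix_inv (G (fst p)) $ i $ j)" for i j
    by (rule continuous_on_compose2[OF c]) (auto intro!: continuous_intros)
  have "continuous_on (S \<times> sphere 0 1) ?f"
    unfolding quad_form_sum by (intro continuous_intros c')
  moreover have "compact (S \<times> sphere (0::real^'n) 1)" using S by (intro compact_Times) auto
  moreover have "S \<times> sphere (0::real^'n) 1 \<noteq> {}"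
    using False by (auto intro: exI[of _ "axis undefined 1"])
  ultimately obtain p where p: "p \<in> S \<times> sphere 0 1" "\<forall>q\<in>S \<times> sphere 0 1. ?f p \<le> ?f q"
    using continuous_attains_inf by blast
  have pos: "0 < ?f p" using p(1) S(2) by (intro inverse_posdef) auto
  have "2 * (?f p / 2) * (v \<bullet> v) \<le> v \<bullet> (matrix_inv (G x) *v v)" if x: "x \<in> S" for x v
  proof (cases "v = 0")
    case False
    define e where "e = (1 / norm v) *\<^sub>R v"
    have v: "v = norm v *\<^sub>R e" using False by (simp add: e_def)
    have "(x, e) \<in> S \<times> sphere 0 1" using x False by (simp add: e_def)
    then have "?f p \<le> e \<bullet> (matrix_inv (G x) *v e)" using p(2) by fastforce
    then have "?f p * (norm v * norm v) \<le> (e \<bullet> (matrix_inv (G x) *v e)) * (norm v * norm v)"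
      by (intro mult_right_mono) auto
    also have "\<dots> = (norm v *\<^sub>R e) \<bullet> (matrix_inv (G x) *v (norm v *\<^sub>R e))"
      by (simp only: matrix_vector_mult_scaleR inner_scaleR_left inner_scaleR_right mult_ac)
    finally show ?thesis using v by (simp add: power2_norm_eq_inner[symmetric] power2_eq_square)
  qed simp
  with pos show ?thesis by (intro exI[of _ "?f p / 2"]) auto
qed (auto intro: zero_less_one)

text \<open>The product rule separates the second order part from the drift. Values in an arbitrary
  normed space are allowed, so the same formula later shows that the operator is linear on complex
  functions.\<close>

lemma div_op_expansion:
  assumes x: "x \<in> W" and w: "C2_on W w"
  shows "div_op W G w x = (\<Sum>i\<in>UNIV. \<Sum>j\<in>UNIV. (matrix_inv (G x) $ i $ j) *\<^sub>R partial_within W i (partial_within W j w) x)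
    + (\<Sum>j\<in>UNIV. ((1 / sqrt (det (G x))) * (\<Sum>i\<in>UNIV. partial_within W i (\<lambda>y. matrix_inv (G y) $ i $ j * sqrt (det (G y))) x)) *\<^sub>R partial_within W j w x)"
proof -
  have d: "sqrt (det (G x)) > 0" using det_pos[OF x] by simp
  have "partial_within W i (\<lambda>y. (matrix_inv (G y) $ i $ j * sqrt (det (G y))) *\<^sub>R partial_within W j w y) x
    = partial_within W i (\<lambda>y. matrix_inv (G y) $ i $ j * sqrt (det (G y))) x *\<^sub>R partial_within W j w x
     + (matrix_inv (G x) $ i $ j * sqrt (det (G x))) *\<^sub>R partial_within W i (partial_within W j w) x" for i j
    by (rule partial_within_scaleR[OF W x coefficient_differentiable(1)[OF x]])
      (use w x in \<open>auto simp: C2_on_def differentiable_on_def\<close>)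
  then have "div_op W G w x = (1 / sqrt (det (G x))) *\<^sub>R
    ((\<Sum>i\<in>UNIV. \<Sum>j\<in>UNIV. partial_within W i (\<lambda>y. matrix_inv (G y) $ i $ j * sqrt (det (G y))) x *\<^sub>R partial_within W j w x)
    + (\<Sum>i\<in>UNIV. \<Sum>j\<in>UNIV. (matrix_inv (G x) $ i $ j * sqrt (det (G x))) *\<^sub>R partial_within W i (partial_within W j w) x))"
    by (simp only: div_op_def sum.distrib)
  also have "\<dots> = (\<Sum>i\<in>UNIV. \<Sum>j\<in>UNIV. (matrix_inv (G x) $ i $ j) *\<^sub>R partial_within W i (partial_within W j w) x)
    + (\<Sum>i\<in>UNIV. \<Sum>j\<in>UNIV. ((1 / sqrt (det (G x))) * partial_within W i (\<lambda>y. matrix_inv (G y) $ i $ j * sqrt (det (G y))) x) *\<^sub>R partial_within W j w x)"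
    using d by (simp add: scaleR_add_right scaleR_sum_right add.commute)
  also have "(\<Sum>i\<in>UNIV. \<Sum>j\<in>UNIV. ((1 / sqrt (det (G x))) * partial_within W i (\<lambda>y. matrix_inv (G y) $ i $ j * sqrt (det (G y))) x) *\<^sub>R partial_within W j w x)
    = (\<Sum>j\<in>UNIV. ((1 / sqrt (det (G x))) * (\<Sum>i\<in>UNIV. partial_within W i (\<lambda>y. matrix_inv (G y) $ i $ j * sqrt (det (G y))) x)) *\<^sub>R partial_within W j w x)"
    by (subst sum.swap) (simp only: sum_distrib_left scaleR_sum_left)
  finally show ?thesis .
qed


text \<open>R and C are produced before w, m, h and \<mu>, so they depend only on the metric near
  x0. On balls of radius \<rho>0 / \<mu> the quantity m / \<rho> + \<rho> * h is \<mu> * m / \<rho>0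
  + \<rho>0 * h / \<mu>.\<close>

lemma local_gradient_estimate:
  assumes x0: "x0 \<in> W"
  obtains R C :: real where "0 < R" "0 < C"
    "\<And>w m h \<mu> z i. C2_on W w \<Longrightarrow> \<forall>x\<in>W. x $ bd_coord = 0 \<longrightarrow> w x = 0 \<Longrightarrow> \<forall>x\<in>W. \<bar>w x\<bar> \<le> m \<Longrightarrow>
      \<forall>x\<in>W. \<bar>div_op W G w x\<bar> \<le> h \<Longrightarrow> 0 < m \<Longrightarrow> 0 < h \<Longrightarrow> 1 \<le> \<mu> \<Longrightarrow> z \<in> W \<inter> ball x0 R \<Longrightarrow>
      \<bar>partial_within W i w z\<bar> \<le> C * (\<mu> * m + h / \<mu>)"
proof -
  obtain U where U: "open U" "W = half_space \<inter> U" using W by (auto simp: openin_open)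
  then obtain R0 where R0: "R0 > 0" "cball x0 R0 \<subseteq> U" using x0 by (auto simp: open_contains_cball)
  define K where "K = cball x0 R0 \<inter> half_space"
  have conv: "convex (half_space :: (real^'n) set)"
  proof -
    have "half_space = {x :: real^'n. inner (axis bd_coord 1) x \<ge> 0}"
      by (simp add: half_space_def inner_axis')
    then show ?thesis using convex_halfspace_ge[of 0 "axis bd_coord (1::real)"] by metis
  qed
  have K: "compact K" "convex K" "K \<subseteq> W"
    using U R0 conv by (auto simp: K_def intro: compact_Int_closed closed_half_space convex_Int)
  define A where "A x = matrix_inv (G x)" for x
  obtain \<theta> where \<theta>: "\<theta> > 0" "\<And>x v. x \<in> K \<Longrightarrow> 2 * \<theta> * (v \<bullet> v) \<le> v \<bullet> (A x *v v)"
    using inverse_elliptic[OF K(1,3)] unfolding A_def by blast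
  have "\<exists>C\<ge>0. \<forall>x\<in>K. \<forall>y\<in>K. \<bar>A x $ i $ j - A y $ i $ j\<bar> \<le> C * norm (x - y)" for i j
    using lip_on_lipschitz[OF coefficients_lip(2)[OF K(1,3), of i j] K(2,3)] unfolding A_def by metis
  then obtain LL where LL: "\<And>i j. 0 \<le> LL i j"
      "\<And>i j x y. x \<in> K \<Longrightarrow> y \<in> K \<Longrightarrow> \<bar>A x $ i $ j - A y $ i $ j\<bar> \<le> LL i j * norm (x - y)"
    by metis
  define L where "L = (\<Sum>i\<in>UNIV. \<Sum>j\<in>UNIV. LL i j)"
  have L: "0 \<le> L" unfolding L_def by (intro sum_nonneg LL)
  have lip: "\<bar>v \<bullet> (A x *v v) - v \<bullet> (A y *v v)\<bar> \<le> L * norm (x - y) * (v \<bullet> v)" if xy: "x \<in> K" "y \<in> K" for x y v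
  proof -
    have "\<bar>v \<bullet> (A x *v v) - v \<bullet> (A y *v v)\<bar> = \<bar>\<Sum>i\<in>UNIV. \<Sum>j\<in>UNIV. v $ i * v $ j * (A x $ i $ j - A y $ i $ j)\<bar>"
      by (simp add: quad_form_sum right_diff_distrib sum_subtractf)
    also have "\<dots> \<le> (\<Sum>i\<in>UNIV. \<Sum>j\<in>UNIV. \<bar>v $ i * v $ j * (A x $ i $ j - A y $ i $ j)\<bar>)"
      by (intro order_trans[OF sum_abs] sum_mono sum_abs)
    also have "\<dots> \<le> (\<Sum>i\<in>UNIV. \<Sum>j\<in>UNIV. (norm v * norm v) * (LL i j * norm (x - y)))"
      unfolding abs_mult using LL xy
      by (intro sum_mono mult_mono component_le_norm_cart) auto
    also have "\<dots> = L * norm (x - y) * (norm v * norm v)"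
      unfolding L_def sum_distrib_right sum_distrib_left by (simp add: mult_ac)
    finally show ?thesis by (simp add: power2_norm_eq_inner[symmetric] power2_eq_square)
  qed
  have "\<exists>C\<ge>0. \<forall>x\<in>K. \<bar>A x $ i $ i\<bar> \<le> C" for i
    using lip_on_bounds[OF coefficients_lip(2)[OF K(1,3), of i i] W K(3)] unfolding A_def by blast
  then obtain TT where TT: "\<And>i. 0 \<le> TT i" "\<And>i x. x \<in> K \<Longrightarrow> \<bar>A x $ i $ i\<bar> \<le> TT i" by metis
  define T where "T = (\<Sum>i\<in>UNIV. TT i)"
  have T: "0 \<le> T" unfolding T_def by (intro sum_nonneg TT)
  have tr: "(\<Sum>i\<in>UNIV. A x $ i $ i) \<le> T" if "x \<in> K" for x
    unfolding T_def using TT(2)[OF that] by (intro sum_mono) (auto simp: abs_le_iff)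
  define pd where "pd i j x = partial_within W i (\<lambda>y. matrix_inv (G y) $ i $ j * sqrt (det (G y))) x" for i j x
  define bv :: "real^'n \<Rightarrow> real^'n" where
    "bv x = (\<chi> j. (1 / sqrt (det (G x))) * (\<Sum>i\<in>UNIV. pd i j x))" for x
  have "\<exists>C\<ge>0. \<forall>x\<in>K. \<bar>pd i j x\<bar> \<le> C" for i j
    using lip_on_bounds[OF coefficients_lip(3)[OF K(1,3), of i j] W K(3)] unfolding pd_def by blast
  then obtain BB where BB: "\<And>i j. 0 \<le> BB i j" "\<And>i j x. x \<in> K \<Longrightarrow> \<bar>pd i j x\<bar> \<le> BB i j"
    by metis
  obtain c where c: "c > 0" "\<And>x. x \<in> K \<Longrightarrow> c \<le> det (G x)" using coefficients_lip(4)[OF K(1,3)] by blast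
  define \<beta> where "\<beta> = (\<Sum>j\<in>UNIV. (1 / sqrt c) * (\<Sum>i\<in>UNIV. BB i j))"
  have \<beta>: "0 \<le> \<beta>" unfolding \<beta>_def using c BB(1) by (intro sum_nonneg mult_nonneg_nonneg) auto
  have drift: "norm (bv x) \<le> \<beta>" if x: "x \<in> K" for x
  proof -
    have "norm (bv x) \<le> (\<Sum>j\<in>UNIV. \<bar>bv x $ j\<bar>)" by (rule norm_le_l1_cart)
    also have "\<dots> \<le> \<beta>" unfolding \<beta>_def
    proof (rule sum_mono)
      fix j
      have "\<bar>\<Sum>i\<in>UNIV. pd i j x\<bar> \<le> (\<Sum>i\<in>UNIV. BB i j)"
        using BB(2)[OF x] by (intro order_trans[OF sum_abs] sum_mono) auto
      moreover have "\<bar>1 / sqrt (det (G x))\<bar> \<le> 1 / sqrt c"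
        using c(1) c(2)[OF x] by (simp add: frac_le)
      ultimately have "\<bar>1 / sqrt (det (G x))\<bar> * \<bar>\<Sum>i\<in>UNIV. pd i j x\<bar>
          \<le> (1 / sqrt c) * (\<Sum>i\<in>UNIV. BB i j)"
        using c(1) by (intro mult_mono) auto
      then show "\<bar>bv x $ j\<bar> \<le> (1 / sqrt c) * (\<Sum>i\<in>UNIV. BB i j)"
        unfolding bv_def vec_lambda_beta abs_mult .
    qed
    finally show ?thesis .
  qed
  define n where "n = real CARD('n)"
  define c1 c2 where "c1 = 2 * T + 2 * \<beta> + 1" and "c2 = 4 * \<beta> + 4 * \<theta> + 4 * T + 12 * n * L + 1"
  \<comment> \<open>R0 / 6 keeps the ball of radius 3 * \<rho> around a point at distance less than
    R0 / 2 from x0 within radius R0; the other two bounds meet the hypotheses of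
    \<open>difference_bound\<close>. The added 1 keeps the denominator positive.\<close>
  define \<rho>0 where "\<rho>0 = min (min (R0 / 6) 1) (\<theta> / (2 * (2 * \<beta> + 3 * n * L + 1)))"
  have n: "0 \<le> n" by (simp add: n_def)
  have den: "0 < 2 * \<beta> + 3 * n * L + 1" using \<beta> L n by (intro add_nonneg_pos) auto
  have \<rho>0: "0 < \<rho>0" "\<rho>0 \<le> 1" "6 * \<rho>0 \<le> R0" "\<rho>0 \<le> \<theta> / (2 * (2 * \<beta> + 3 * n * L + 1))"
    using R0 \<theta>(1) den by (auto simp: \<rho>0_def)
  define C0 where "C0 = 2 + 4 * (c1 + c2) / \<theta>"
  have C0: "0 < C0" using \<theta>(1) T \<beta> L n
    by (auto simp: C0_def c1_def c2_def intro!: add_pos_nonneg divide_nonneg_pos add_nonneg_nonneg)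
  define C where "C = C0 * (1 / \<rho>0 + 1)"
  have C: "0 < C" using C0 \<rho>0 by (auto simp: C_def intro!: mult_pos_pos add_pos_pos)
  have est: "\<bar>partial_within W i w z\<bar> \<le> C * (\<mu> * m + h / \<mu>)"
    if w: "C2_on W w" "\<forall>x\<in>W. x $ bd_coord = 0 \<longrightarrow> w x = 0" "\<forall>x\<in>W. \<bar>w x\<bar> \<le> m"
      "\<forall>x\<in>W. \<bar>div_op W G w x\<bar> \<le> h" and par: "0 < m" "0 < h" "1 \<le> \<mu>" and z: "z \<in> W \<inter> ball x0 (R0 / 2)"
    for w m h \<mu> z i
  proof -
    define Du :: "real^'n \<Rightarrow> real^'n" where "Du x = (\<chi> i. partial_within W i w x)" for x
    \<comment> \<open>Row i is the gradient of the i-th partial, so that this matrix represents the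
      derivative of \<open>Du\<close>.\<close>
    define D2u :: "real^'n \<Rightarrow> real^'n^'n" where "D2u x = (\<chi> i j. partial_within W j (partial_within W i w) x)" for x
    have int: "at x within W = at x" if "x \<in> W" "0 < x $ bd_coord" for x
    proof -
      have "open (U \<inter> {x. 0 < x $ bd_coord})"
        using U(1) by (intro open_Int open_Collect_less continuous_intros) auto
      moreover have "U \<inter> {x. 0 < x $ bd_coord} \<subseteq> W" unfolding U(2) half_space_def by auto
      ultimately have "x \<in> interior W" using that U(2) by (intro interiorI) auto
      then show ?thesis by (rule at_within_interior)
    qed
    have wd: "w differentiable (at x within W)" "\<And>i. partial_within W i w differentiable (at x within W)" if "x \<in> W" for x
      using w(1) that by (auto simp: C2_on_def differentiable_on_def)
    interpret half_space_dirichlet_problem K A bv w Du D2u \<theta> T \<beta> L m h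
    proof
      show "0 < \<theta>" "0 < m" "0 < h" "0 \<le> T" "0 \<le> \<beta>" "0 \<le> L" by fact+
      show "transpose (A x) = A x" if "x \<in> K" for x
        using inverse_symmetric that K(3) by (auto simp: A_def)
      show "2 * \<theta> * (v \<bullet> v) \<le> v \<bullet> (A x *v v)" if "x \<in> K" for x v by (rule \<theta>(2)[OF that])
      show "(\<Sum>i\<in>UNIV. A x $ i $ i) \<le> T" if "x \<in> K" for x by (rule tr[OF that])
      show "norm (bv x) \<le> \<beta>" if "x \<in> K" for x by (rule drift[OF that])
      show "\<bar>v \<bullet> (A x *v v) - v \<bullet> (A y *v v)\<bar> \<le> L * norm (x - y) * (v \<bullet> v)" if "x \<in> K" "y \<in> K" for x y v
        by (rule lip[OF that])
      show "continuous_on K w"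
        using w(1) K(3) continuous_on_subset differentiable_imp_continuous_on unfolding C2_on_def by blast
      show "\<bar>w x\<bar> \<le> m" if "x \<in> K" for x using w(3) that K(3) by auto
      show "w x = 0" if "x \<in> K" "x $ bd_coord = 0" for x using w(2) that K(3) by auto
      show "(w has_derivative (\<lambda>v. Du x \<bullet> v)) (at x)" if x: "x \<in> K" "0 < x $ bd_coord" for x
      proof -
        have xW: "x \<in> W" using x K(3) by auto
        show ?thesis
          using has_derivative_partial_within[OF wd(1)[OF xW]] int[OF xW x(2)]
          by (simp add: Du_def inner_vec_def mult.commute)
      qed
      show "(Du has_derivative (\<lambda>v. D2u x *v v)) (at x)" if x: "x \<in> K" "0 < x $ bd_coord" for x
      proof -
        have xW: "x \<in> W" using x K(3) by auto
        have "((\<lambda>y. Du y \<bullet> b) has_derivative (\<lambda>v. (D2u x *v v) \<bullet> b)) (at x)" if "b \<in> Basis" for b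
        proof -
          from that obtain k where k: "b = axis k 1" by (auto simp: Basis_vec_def)
          show ?thesis
            using has_derivative_partial_within[OF wd(2)[OF xW, of k]] int[OF xW x(2)]
            by (simp add: k inner_axis Du_def D2u_def matrix_vector_mult_def mult.commute)
        qed
        then show ?thesis
          using has_derivative_componentwise_within[of Du "\<lambda>v. D2u x *v v" x UNIV] by blast
      qed
      show "\<bar>(\<Sum>i\<in>UNIV. \<Sum>j\<in>UNIV. A x $ i $ j * D2u x $ i $ j) + bv x \<bullet> Du x\<bar> \<le> h"
        if x: "x \<in> K" "0 < x $ bd_coord" for x
      proof -
        have xW: "x \<in> W" using x K(3) by auto
        have sym: "A x $ i $ j = A x $ j $ i" for i j
          using inverse_symmetric[OF xW] unfolding A_def by (metis transpose_def vec_lambda_beta)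
        \<comment> \<open>\<open>div_op\<close> carries the second partials in the opposite order;
          the symmetry of \<open>A\<close> reconciles the two.\<close>
        have "(\<Sum>i\<in>UNIV. \<Sum>j\<in>UNIV. A x $ i $ j * D2u x $ i $ j) = (\<Sum>i\<in>UNIV. \<Sum>j\<in>UNIV. A x $ i $ j * D2u x $ j $ i)"
          by (subst sum.swap) (simp only: sym)
        then have "div_op W G w x = (\<Sum>i\<in>UNIV. \<Sum>j\<in>UNIV. A x $ i $ j * D2u x $ i $ j) + bv x \<bullet> Du x"
          using div_op_expansion[OF xW w(1)]
          by (simp add: A_def D2u_def Du_def bv_def pd_def inner_vec_def)
        then show ?thesis using w(4) xW by auto
      qed
    qed
    define \<rho> where "\<rho> = \<rho>0 / \<mu>"
    have \<rho>: "0 < \<rho>" "\<rho> \<le> \<rho>0" using \<rho>0(1) par by (auto simp: \<rho>_def field_simps)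
    have zH: "z \<in> half_space" and zd: "dist x0 z < R0 / 2" using z U(2) by auto
    have sub: "cball z (3 * \<rho>) \<inter> half_space \<subseteq> K"
    proof
      fix p assume p: "p \<in> cball z (3 * \<rho>) \<inter> half_space"
      have "dist x0 p \<le> dist x0 z + dist z p" by (rule dist_triangle)
      also have "\<dots> \<le> R0" using p zd \<rho>(2) \<rho>0(3) by auto
      finally show "p \<in> K" using p by (simp add: K_def)
    qed
    have small: "\<rho> * (2 * \<beta> + 3 * real CARD('n) * L) \<le> \<theta> / 2"
    proof -
      have "\<rho> * (2 * \<beta> + 3 * n * L) \<le> \<rho>0 * (2 * \<beta> + 3 * n * L + 1)"
        using \<rho> \<rho>0(1) \<beta> L n by (intro mult_mono) auto
      also have "\<dots> \<le> \<theta> / (2 * (2 * \<beta> + 3 * n * L + 1)) * (2 * \<beta> + 3 * n * L + 1)"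
        using \<rho>0(4) den by (intro mult_right_mono) auto
      also have "\<dots> = \<theta> / 2"
      proof -
        have "\<theta> / (2 * d) * d = \<theta> / 2" if "0 < d" for d using that by simp
        then show ?thesis using den by blast
      qed
      finally show ?thesis by (simp add: n_def)
    qed
    have \<rho>1: "\<rho> \<le> 1" using \<rho>(2) \<rho>0(2) by simp
    have "\<bar>partial_within W i w z\<bar> \<le> C0 * (m / \<rho> + \<rho> * h)"
    proof (rule partial_within_le[OF W _ wd(1) \<rho>(1), where k = "2 * m / \<rho>\<^sup>2"])
      fix x assume "x \<in> cball z \<rho> \<inter> W"
      then have "x \<in> cball z \<rho> \<inter> half_space" using U(2) by auto
      then show "\<bar>w x - w z\<bar> \<le> C0 * (m / \<rho> + \<rho> * h) * norm (x - z) + 2 * m / \<rho>\<^sup>2 * (norm (x - z))\<^sup>2"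
        using difference_bound[OF \<rho>(1) \<rho>1 zH sub small] unfolding C0_def c1_def c2_def n_def by simp
    qed (use z in auto)
    also have "m / \<rho> + \<rho> * h \<le> (1 / \<rho>0 + 1) * (\<mu> * m + h / \<mu>)"
    proof -
      have "m / \<rho> = (1 / \<rho>0) * (\<mu> * m)" using \<rho>0(1) par by (simp add: \<rho>_def)
      moreover have "\<rho> * h \<le> h / \<mu>"
        using mult_right_mono[OF \<rho>0(2), of h] par by (simp add: \<rho>_def divide_right_mono)
      moreover have "0 \<le> \<mu> * m" "0 \<le> (1 / \<rho>0) * (h / \<mu>)" using par \<rho>0(1) by auto
      moreover have "(1 / \<rho>0 + 1) * (\<mu> * m + h / \<mu>) = (1 / \<rho>0) * (\<mu> * m) + (1 / \<rho>0) * (h / \<mu>) + (\<mu> * m + h / \<mu>)"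
        by (simp only: distrib_left distrib_right mult_1_left add_ac)
      ultimately show ?thesis by linarith
    qed
    finally show ?thesis using C0 by (simp add: C_def mult.assoc mult_left_mono)
  qed
  show thesis
    by (rule that[OF _ C est, of "R0 / 2"]) (use R0(1) in simp_all)
qed

end

lemma sum_swap_triple:
  "(\<Sum>k\<in>J. \<Sum>i\<in>I. \<Sum>j\<in>L. f i j k) = (\<Sum>i\<in>I. \<Sum>j\<in>L. \<Sum>k\<in>J. f i j k)"
proof -
  have "(\<Sum>k\<in>J. \<Sum>i\<in>I. \<Sum>j\<in>L. f i j k) = (\<Sum>i\<in>I. \<Sum>k\<in>J. \<Sum>j\<in>L. f i j k)"
    by (rule sum.swap)
  also have "\<dots> = (\<Sum>i\<in>I. \<Sum>j\<in>L. \<Sum>k\<in>J. f i j k)"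
    by (intro sum.cong refl sum.swap)
  finally show ?thesis .
qed

lemma rel_open_cball:
  assumes "rel_open W" "x \<in> W"
  obtains r where "r > 0" "cball x r \<inter> half_space \<subseteq> W"
proof -
  obtain U where U: "open U" "W = half_space \<inter> U" using assms(1) by (auto simp: openin_open)
  then obtain r where "r > 0" "cball x r \<subseteq> U" using assms(2) by (auto simp: open_contains_cball)
  then show ?thesis using that U by blast
qed

text \<open>The squared length of a covector: the components of a differential are covariant, whence
  the inverse matrix.\<close>

definition metric_form :: "real^'n^'n \<Rightarrow> ('n \<Rightarrow> real) \<Rightarrow> real" where
  "metric_form P a = (\<chi> i. a i) \<bullet> (matrix_inv P *v (\<chi> i. a i))"

context chart_metric
begin

lemma metric_form_nonneg: "x \<in> W \<Longrightarrow> 0 \<le> metric_form (G x) a"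
  using inverse_posdef[of x "\<chi> i. a i"] by (cases "(\<chi> i. a i) = 0") (auto simp: metric_form_def)

lemma metric_form_bounded:
  assumes K: "compact K" "K \<subseteq> W"
  shows "\<exists>B\<ge>0. \<forall>x\<in>K. \<forall>a b. (\<forall>i. \<bar>a i\<bar> \<le> b) \<longrightarrow> metric_form (G x) a \<le> B * b\<^sup>2"
proof -
  have "\<exists>C\<ge>0. \<forall>x\<in>K. \<bar>matrix_inv (G x) $ i $ j\<bar> \<le> C" for i j
    using lip_on_bounds[OF coefficients_lip(2)[OF K, of i j] W K(2)] by blast
  then obtain B where B: "\<And>i j. 0 \<le> B i j" "\<And>i j x. x \<in> K \<Longrightarrow> \<bar>matrix_inv (G x) $ i $ j\<bar> \<le> B i j"
    by metis
  have "metric_form (G x) a \<le> (\<Sum>i\<in>UNIV. \<Sum>j\<in>UNIV. B i j) * b\<^sup>2"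
    if x: "x \<in> K" and a: "\<forall>i. \<bar>a i\<bar> \<le> b" for x a b
  proof -
    have b: "0 \<le> b" using a abs_ge_zero order_trans by blast
    have "metric_form (G x) a = (\<Sum>i\<in>UNIV. \<Sum>j\<in>UNIV. a i * a j * matrix_inv (G x) $ i $ j)"
      by (simp add: metric_form_def quad_form_sum)
    also have "\<dots> \<le> (\<Sum>i\<in>UNIV. \<Sum>j\<in>UNIV. b * b * B i j)"
    proof (intro sum_mono)
      fix i j
      have "\<bar>a i\<bar> * \<bar>a j\<bar> * \<bar>matrix_inv (G x) $ i $ j\<bar> \<le> b * b * B i j"
        using a b B x by (intro mult_mono) auto
      then show "a i * a j * matrix_inv (G x) $ i $ j \<le> b * b * B i j"
        by (simp add: abs_mult[symmetric])
    qed
    also have "\<dots> = (\<Sum>i\<in>UNIV. \<Sum>j\<in>UNIV. B i j) * b\<^sup>2"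
      by (simp add: sum_distrib_right sum_distrib_left power2_eq_square mult_ac)
    finally show ?thesis .
  qed
  moreover have "0 \<le> (\<Sum>i\<in>UNIV. \<Sum>j\<in>UNIV. B i j)" by (intro sum_nonneg B)
  ultimately show ?thesis by blast
qed

text \<open>On a compact ball the squared length is at most B times the square of a common bound for
  the components, so the estimates of the separate partials combine. B + 1 in place of B makes the
  new constant positive.\<close>

lemma local_length_estimate:
  assumes x0: "x0 \<in> W"
  obtains R C :: real where "0 < R" "0 < C"
    "\<And>w m h \<mu> z. C2_on W w \<Longrightarrow> \<forall>x\<in>W. x $ bd_coord = 0 \<longrightarrow> w x = 0 \<Longrightarrow> \<forall>x\<in>W. \<bar>w x\<bar> \<le> m \<Longrightarrow>
      \<forall>x\<in>W. \<bar>div_op W G w x\<bar> \<le> h \<Longrightarrow> 0 < m \<Longrightarrow> 0 < h \<Longrightarrow> 1 \<le> \<mu> \<Longrightarrow> z \<in> W \<inter> ball x0 R \<Longrightarrow>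
      metric_form (G z) (\<lambda>i. partial_within W i w z) \<le> (C * (\<mu> * m + h / \<mu>))\<^sup>2"
proof -
  obtain r where r: "r > 0" "cball x0 r \<inter> half_space \<subseteq> W" using rel_open_cball[OF W x0] .
  have "compact (cball x0 r \<inter> half_space)" by (intro compact_Int_closed closed_half_space) auto
  from metric_form_bounded[OF this r(2)] obtain B where B: "0 \<le> B"
    "\<And>x a b. x \<in> cball x0 r \<inter> half_space \<Longrightarrow> \<forall>i. \<bar>a i\<bar> \<le> b \<Longrightarrow> metric_form (G x) a \<le> B * b\<^sup>2" by metis
  show thesis
  proof (rule local_gradient_estimate[OF x0])
    fix R C :: real
    assume RC: "0 < R" "0 < C" and est:
      "\<And>w m h \<mu> z i. C2_on W w \<Longrightarrow> \<forall>x\<in>W. x $ bd_coord = 0 \<longrightarrow> w x = 0 \<Longrightarrow> \<forall>x\<in>W. \<bar>w x\<bar> \<le> m \<Longrightarrow>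
        \<forall>x\<in>W. \<bar>div_op W G w x\<bar> \<le> h \<Longrightarrow> 0 < m \<Longrightarrow> 0 < h \<Longrightarrow> 1 \<le> \<mu> \<Longrightarrow> z \<in> W \<inter> ball x0 R \<Longrightarrow>
        \<bar>partial_within W i w z\<bar> \<le> C * (\<mu> * m + h / \<mu>)"
    have *: "metric_form (G z) (\<lambda>i. partial_within W i w z) \<le> (sqrt (B + 1) * C * (\<mu> * m + h / \<mu>))\<^sup>2"
      if w: "C2_on W w" "\<forall>x\<in>W. x $ bd_coord = 0 \<longrightarrow> w x = 0" "\<forall>x\<in>W. \<bar>w x\<bar> \<le> m" "\<forall>x\<in>W. \<bar>div_op W G w x\<bar> \<le> h"
        "0 < m" "0 < h" "1 \<le> \<mu>" and z: "z \<in> W \<inter> ball x0 (min r R)" for w m h \<mu> z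
    proof -
      have zr: "z \<in> cball x0 r \<inter> half_space" "z \<in> W \<inter> ball x0 R"
        using z openin_subset[OF W] by auto
      have "\<forall>i. \<bar>partial_within W i w z\<bar> \<le> C * (\<mu> * m + h / \<mu>)"
        using est[OF w zr(2)] by blast
      then have "metric_form (G z) (\<lambda>i. partial_within W i w z) \<le> B * (C * (\<mu> * m + h / \<mu>))\<^sup>2"
        by (rule B(2)[OF zr(1)])
      also have "\<dots> \<le> (B + 1) * (C * (\<mu> * m + h / \<mu>))\<^sup>2" by (intro mult_right_mono) auto
      finally show ?thesis using B(1) by (simp add: power_mult_distrib mult.assoc)
    qed
    have "0 < min r R" "0 < sqrt (B + 1) * C" using r RC B(1) by simp_all
    from that[OF this *] show thesis .
  qed
qed

text \<open>Both orders of partials commute with l in the expanded form. It will be applied to real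
  and imaginary parts and to multiplication by a complex coefficient.\<close>

lemma div_op_linear:
  assumes x: "x \<in> W" and l: "bounded_linear l" and w: "C2_on W w"
  shows "div_op W G (\<lambda>y. l (w y)) x = l (div_op W G w x)"
proof -
  interpret l: bounded_linear l by (rule l)
  have 1: "partial_within W j (\<lambda>y. l (w y)) y = l (partial_within W j w y)" if "y \<in> W" for y j
    using w that by (intro partial_within_linear[OF W _ l]) (auto simp: C2_on_def differentiable_on_def)
  have 2: "partial_within W i (partial_within W j (\<lambda>y. l (w y))) x = l (partial_within W i (partial_within W j w) x)" for i j
  proof -
    have "partial_within W i (partial_within W j (\<lambda>y. l (w y))) x = partial_within W i (\<lambda>y. l (partial_within W j w y)) x"
      by (rule partial_within_cong[OF x 1])
    also have "\<dots> = l (partial_within W i (partial_within W j w) x)"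
      using w x by (intro partial_within_linear[OF W _ l]) (auto simp: C2_on_def differentiable_on_def)
    finally show ?thesis .
  qed
  show ?thesis
    unfolding div_op_expansion[OF x C2_on_linear[OF W l w]] div_op_expansion[OF x w]
    by (simp only: 1[OF x] 2 l.add l.sum l.scaleR)
qed

lemma div_op_sum:
  assumes x: "x \<in> W" and w: "\<And>k. k \<in> J \<Longrightarrow> C2_on W (w k)"
  shows "div_op W G (\<lambda>y. \<Sum>k\<in>J. w k y) x = (\<Sum>k\<in>J. div_op W G (w k) x)"
proof -
  have 1: "partial_within W j (\<lambda>y. \<Sum>k\<in>J. w k y) y = (\<Sum>k\<in>J. partial_within W j (w k) y)" if "y \<in> W" for y j
    using w that by (intro partial_within_sum[OF W]) (auto simp: C2_on_def differentiable_on_def)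
  have 2: "partial_within W i (partial_within W j (\<lambda>y. \<Sum>k\<in>J. w k y)) x = (\<Sum>k\<in>J. partial_within W i (partial_within W j (w k)) x)" for i j
  proof -
    have "partial_within W i (partial_within W j (\<lambda>y. \<Sum>k\<in>J. w k y)) x = partial_within W i (\<lambda>y. \<Sum>k\<in>J. partial_within W j (w k) y) x"
      by (rule partial_within_cong[OF x 1])
    also have "\<dots> = (\<Sum>k\<in>J. partial_within W i (partial_within W j (w k)) x)"
      using w x by (intro partial_within_sum[OF W]) (auto simp: C2_on_def differentiable_on_def)
    finally show ?thesis .
  qed
  have C2: "C2_on W (\<lambda>y. \<Sum>k\<in>J. w k y)" by (rule C2_on_sum[OF W]) (rule w)
  have "(\<Sum>k\<in>J. div_op W G (w k) x) = (\<Sum>k\<in>J. (\<Sum>i\<in>UNIV. \<Sum>j\<in>UNIV. (matrix_inv (G x) $ i $ j) *\<^sub>R partial_within W i (partial_within W j (w k)) x)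
    + (\<Sum>j\<in>UNIV. ((1 / sqrt (det (G x))) * (\<Sum>i\<in>UNIV. partial_within W i (\<lambda>y. matrix_inv (G y) $ i $ j * sqrt (det (G y))) x)) *\<^sub>R partial_within W j (w k) x))"
    by (intro sum.cong refl div_op_expansion[OF x] w)
  also have "\<dots> = (\<Sum>i\<in>UNIV. \<Sum>j\<in>UNIV. (matrix_inv (G x) $ i $ j) *\<^sub>R (\<Sum>k\<in>J. partial_within W i (partial_within W j (w k)) x))
    + (\<Sum>j\<in>UNIV. ((1 / sqrt (det (G x))) * (\<Sum>i\<in>UNIV. partial_within W i (\<lambda>y. matrix_inv (G y) $ i $ j * sqrt (det (G y))) x)) *\<^sub>R (\<Sum>k\<in>J. partial_within W j (w k) x))"
    unfolding sum.distrib scaleR_sum_right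
    by (rule arg_cong2[where f = "(+)", OF sum_swap_triple sum.swap])
  also have "\<dots> = div_op W G (\<lambda>y. \<Sum>k\<in>J. w k y) x"
    unfolding div_op_expansion[OF x C2] by (simp only: 1[OF x] 2)
  finally show ?thesis by simp
qed

end

section \<open>Charts, regularity and Laplacians on the manifold\<close>

locale riemannian_manifold =
  fixes A :: "('m::{t2_space,second_countable_topology}, 'n::finite) chart set" and g :: "('m, 'n) metric"
  assumes atlas: "smooth_atlas A" and metric: "riemannian_metric A g"
begin

lemma chart: "c \<in> A \<Longrightarrow> is_chart c"
  using atlas by (auto simp: smooth_atlas_def)

lemma chart_around: obtains c where "c \<in> A" "p \<in> cdom c"
proof -
  have "(\<Union>c\<in>A. cdom c) = UNIV" using atlas by (simp add: smooth_atlas_def)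
  then show ?thesis using that by blast
qed

lemma cdom_open: "c \<in> A \<Longrightarrow> open (cdom c)"
  and cimg_rel_open: "c \<in> A \<Longrightarrow> rel_open (cimg c)"
  and chart_homeomorphism: "c \<in> A \<Longrightarrow> homeomorphism (cdom c) (cimg c) (cmap c) (cinv c)"
  using chart by (auto simp: is_chart_def)

lemma cmap_in: "p \<in> cdom c \<Longrightarrow> cmap c p \<in> cimg c"
  by (auto simp: cimg_def)

lemma cinv_cmap: "c \<in> A \<Longrightarrow> p \<in> cdom c \<Longrightarrow> cinv c (cmap c p) = p"
  using chart_homeomorphism by (auto simp: homeomorphism_def)

lemma cinv_in: "c \<in> A \<Longrightarrow> x \<in> cimg c \<Longrightarrow> cinv c x \<in> cdom c"
  using chart_homeomorphism[of c] unfolding homeomorphism_def by blast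

lemma cmap_cinv: "c \<in> A \<Longrightarrow> x \<in> cimg c \<Longrightarrow> cmap c (cinv c x) = x"
  using chart_homeomorphism by (auto simp: homeomorphism_def)

lemma chart_metric: "c \<in> A \<Longrightarrow> chart_metric (cimg c) (g c)"
proof
  assume c: "c \<in> A"
  show "rel_open (cimg c)" by (rule cimg_rel_open[OF c])
  show "C2_on (cimg c) (\<lambda>x. g c x $ i $ j)" for i j
    using metric c by (intro smooth_on_C2 cimg_rel_open) (auto simp: riemannian_metric_def)
  show "transpose (g c x) = g c x" if "x \<in> cimg c" for x
    using metric c that by (auto simp: riemannian_metric_def)
  show "0 < v \<bullet> (g c x *v v)" if "x \<in> cimg c" "v \<noteq> 0" for x v
    using metric c that by (auto simp: riemannian_metric_def)
qed

definition C2_fun :: "('m \<Rightarrow> 'b::real_normed_vector) \<Rightarrow> bool" where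
  "C2_fun u \<longleftrightarrow> (\<forall>c\<in>A. C2_on (cimg c) (u \<circ> cinv c))"

lemma smooth_C2_fun: "smooth_fun A u \<Longrightarrow> C2_fun u"
  by (auto simp: smooth_fun_def C2_fun_def intro: smooth_on_C2 cimg_rel_open)

lemma C2_fun_linear: "bounded_linear l \<Longrightarrow> C2_fun u \<Longrightarrow> C2_fun (\<lambda>p. l (u p))"
  unfolding C2_fun_def o_def by (rule ballI, rule C2_on_linear[OF cimg_rel_open]) auto

lemma C2_fun_sum: "(\<And>k. k \<in> J \<Longrightarrow> C2_fun (u k)) \<Longrightarrow> C2_fun (\<lambda>p. \<Sum>k\<in>J. u k p)"
  unfolding C2_fun_def o_def by (rule ballI, rule C2_on_sum[OF cimg_rel_open]) auto

text \<open>Continuity is local and chart domains are open. The form with a family F suits the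
  gradient length, which is known only through its expressions in charts.\<close>

lemma continuous_from_charts:
  assumes "\<And>c. c \<in> A \<Longrightarrow> continuous_on (cimg c) (F c)" "\<And>c p. c \<in> A \<Longrightarrow> p \<in> cdom c \<Longrightarrow> f p = F c (cmap c p)"
  shows "continuous_on UNIV f"
proof -
  have "isCont f p" for p
  proof -
    obtain c where c: "c \<in> A" "p \<in> cdom c" by (rule chart_around)
    have "continuous_on (cdom c) (cmap c)" using chart_homeomorphism[OF c(1)] by (simp add: homeomorphism_def)
    then have "continuous_on (cdom c) (\<lambda>p. F c (cmap c p))"
      by (rule continuous_on_compose2[OF assms(1)[OF c(1)]]) (auto simp: cimg_def)
    then have "continuous_on (cdom c) f"
      by (rule continuous_on_eq) (simp add: assms(2)[OF c(1)])
    then show ?thesis using c cdom_open continuous_on_eq_continuous_at by blast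
  qed
  then show ?thesis by (simp add: continuous_on_eq_continuous_at)
qed

lemma C2_fun_continuous:
  assumes "C2_fun u"
  shows "continuous_on UNIV u"
proof (rule continuous_from_charts)
  fix c assume c: "c \<in> A"
  show "continuous_on (cimg c) (u \<circ> cinv c)"
    using assms c unfolding C2_fun_def C2_on_def by (blast intro: differentiable_imp_continuous_on)
  show "u p = (u \<circ> cinv c) (cmap c p)" if "p \<in> cdom c" for p
    using cinv_cmap[OF c that] by simp
qed

lemma chart_laplacian_div_op:
  "chart_laplacian g c u p = - div_op (cimg c) (g c) (u \<circ> cinv c) (cmap c p)"
  by (simp add: chart_laplacian_def div_op_def coord_partial_def)

lemma has_laplacian_linear:
  assumes "C2_fun u" "has_laplacian A g u h" "bounded_linear l"
  shows "has_laplacian A g (\<lambda>p. l (u p)) (\<lambda>p. l (h p))"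
  unfolding has_laplacian_def
proof (intro ballI)
  fix c p assume c: "c \<in> A" "p \<in> cdom c"
  interpret chart_metric "cimg c" "g c" by (rule chart_metric[OF c(1)])
  interpret l: bounded_linear l by (rule assms)
  have h: "h p = - div_op (cimg c) (g c) (u \<circ> cinv c) (cmap c p)"
    using assms(2) c by (simp add: has_laplacian_def chart_laplacian_div_op)
  have u: "C2_on (cimg c) (u \<circ> cinv c)" using assms(1) c(1) unfolding C2_fun_def by blast
  have "div_op (cimg c) (g c) (\<lambda>x. l ((u \<circ> cinv c) x)) (cmap c p) = l (div_op (cimg c) (g c) (u \<circ> cinv c) (cmap c p))"
    by (rule div_op_linear[OF cmap_in[OF c(2)] assms(3) u])
  with h show "l (h p) = chart_laplacian g c (\<lambda>p. l (u p)) p"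
    by (simp add: chart_laplacian_div_op linear_neg[OF l.linear] o_def)
qed

lemma has_laplacian_sum:
  assumes "\<And>k. k \<in> J \<Longrightarrow> C2_fun (u k)" "\<And>k. k \<in> J \<Longrightarrow> has_laplacian A g (u k) (h k)"
  shows "has_laplacian A g (\<lambda>p. \<Sum>k\<in>J. u k p) (\<lambda>p. \<Sum>k\<in>J. h k p)"
  unfolding has_laplacian_def
proof (intro ballI)
  fix c p assume c: "c \<in> A" "p \<in> cdom c"
  interpret chart_metric "cimg c" "g c" by (rule chart_metric[OF c(1)])
  have h: "h k p = - div_op (cimg c) (g c) (u k \<circ> cinv c) (cmap c p)" if "k \<in> J" for k
    using assms(2)[OF that] c by (simp add: has_laplacian_def chart_laplacian_div_op)
  have u: "C2_on (cimg c) (u k \<circ> cinv c)" if "k \<in> J" for k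
    using assms(1)[OF that] c(1) unfolding C2_fun_def by blast
  have "div_op (cimg c) (g c) (\<lambda>x. \<Sum>k\<in>J. (u k \<circ> cinv c) x) (cmap c p) = (\<Sum>k\<in>J. div_op (cimg c) (g c) (u k \<circ> cinv c) (cmap c p))"
    by (rule div_op_sum[OF cmap_in[OF c(2)] u])
  with h show "(\<Sum>k\<in>J. h k p) = chart_laplacian g c (\<lambda>p. \<Sum>k\<in>J. u k p) p"
    by (simp add: chart_laplacian_div_op o_def sum_negf)
qed

text \<open>The chart domains cover the manifold, so the chart formulas leave one candidate and the
  definite description is resolved.\<close>

lemma laplacian_eq:
  assumes "has_laplacian A g u h"
  shows "laplacian A g u = h"
  unfolding laplacian_def
proof (rule the_equality[where P = "has_laplacian A g u", OF assms])
  fix h' assume h': "has_laplacian A g u h'"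
  show "h' = h"
  proof
    fix p obtain c where "c \<in> A" "p \<in> cdom c" by (rule chart_around)
    then have "h' p = chart_laplacian g c u p" "h p = chart_laplacian g c u p"
      using h' assms unfolding has_laplacian_def by blast+
    then show "h' p = h p" by simp
  qed
qed

end

section \<open>Invariance of the gradient length and compactness\<close>

text \<open>Covectors transform by the transpose of J. As P is congruent to Q by J, the product of
  J, the inverse of P and the transpose of J is the inverse of Q.\<close>

lemma metric_form_congruence:
  fixes P Q J :: "real^'n^'n"
  assumes P: "P = transpose J ** Q ** J" and det: "det P \<noteq> 0"
  shows "metric_form P (\<lambda>i. (transpose J *v a) $ i) = metric_form Q (\<lambda>i. a $ i)"
proof -
  have dets: "det P = det J * det Q * det J" by (simp add: P det_mul det_transpose)
  then have dJ: "det J \<noteq> 0" and dQ: "det Q \<noteq> 0" using det by auto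
  let ?X = "J ** matrix_inv P ** transpose J"
  have "J ** (matrix_inv P ** P) = J" by (simp add: matrix_inv_inverse(2)[OF det])
  then have "?X ** Q ** J = J" unfolding P by (simp add: matrix_mul_assoc)
  then have "?X ** Q ** (J ** matrix_inv J) = J ** matrix_inv J" by (simp add: matrix_mul_assoc)
  then have "?X ** Q = mat 1" by (simp add: matrix_inv_inverse(1)[OF dJ])
  then have "?X ** (Q ** matrix_inv Q) = matrix_inv Q" by (simp add: matrix_mul_assoc)
  then have X: "?X = matrix_inv Q" by (simp add: matrix_inv_inverse(1)[OF dQ])
  have "metric_form P (\<lambda>i. (transpose J *v a) $ i) = (transpose J *v a) \<bullet> (matrix_inv P *v (transpose J *v a))"
    by (simp add: metric_form_def)
  also have "\<dots> = a \<bullet> (J *v (matrix_inv P *v (transpose J *v a)))"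
    by (simp only: transpose_matrix_vector dot_lmul_matrix)
  also have "\<dots> = a \<bullet> (?X *v a)"
    by (simp only: matrix_vector_mul_assoc matrix_mul_assoc)
  finally show ?thesis unfolding X by (simp add: metric_form_def)
qed

context riemannian_manifold
begin

text \<open>The chain rule through the transition map, carried out within the image of the overlap.
  That image is relatively open in the half space, so derivatives within it determine the same
  partials as within the whole chart image, also at the boundary.\<close>

lemma coord_partial_change:
  fixes u :: "'m \<Rightarrow> real"
  assumes c: "c \<in> A" and d: "d \<in> A" and p: "p \<in> cdom c" "p \<in> cdom d" and u: "C2_fun u"
  shows "coord_partial c i u (cmap c p) =
    (\<Sum>k\<in>UNIV. transition_jacobian c d p $ k $ i * coord_partial d k u (cmap d p))"
proof -
  define S where "S = cmap c ` (cdom c \<inter> cdom d)"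
  define \<phi> where "\<phi> = cmap d \<circ> cinv c"
  define x where "x = cmap c p"
  have xS: "x \<in> S" using p by (auto simp: x_def S_def)
  have xc: "x \<in> cimg c" using cmap_in[OF p(1)] by (simp add: x_def)
  have Sc: "S \<subseteq> cimg c" by (auto simp: S_def cimg_def)
  have "openin (top_of_set (cdom c)) (cdom c \<inter> cdom d)"
    using cdom_open[OF d] by (simp add: openin_open_Int)
  then have "openin (top_of_set (cimg c)) S"
    unfolding S_def by (rule homeomorphism_imp_open_map[OF chart_homeomorphism[OF c]])
  then have S: "rel_open S" using cimg_rel_open[OF c] by (rule openin_trans)
  have \<phi>x: "\<phi> x = cmap d p" using cinv_cmap[OF c p(1)] by (simp add: \<phi>_def x_def)
  have "smooth_on S \<phi>" using atlas c d unfolding smooth_atlas_def S_def \<phi>_def by blast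
  then have "\<phi> differentiable (at x within S)"
    using smooth_on_C2[OF S] xS by (auto simp: C2_on_def differentiable_on_def)
  then have D: "(\<phi> has_derivative frechet_derivative \<phi> (at x within S)) (at x within S)"
    by (simp only: frechet_derivative_works)
  have "transition_jacobian c d p = matrix (frechet_derivative \<phi> (at x within S))"
    by (simp add: transition_jacobian_def \<phi>_def x_def S_def)
  then have J: "frechet_derivative \<phi> (at x within S) v = transition_jacobian c d p *v v" for v
    using fun_cong[OF matrix_vector_mul(2)[OF has_derivative_linear[OF D]], of v] by simp
  have sub: "\<phi> ` S \<subseteq> cimg d"
    using cinv_cmap[OF c] by (auto simp: \<phi>_def S_def cimg_def)
  have "(u \<circ> cinv d) differentiable (at (\<phi> x) within cimg d)"
    using u d cmap_in[OF p(2)] \<phi>x by (auto simp: C2_fun_def C2_on_def differentiable_on_def)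
  from has_derivative_subset[OF has_derivative_partial_within[OF this] sub]
  have "((u \<circ> cinv d) has_derivative (\<lambda>v. \<Sum>k\<in>UNIV. v $ k *\<^sub>R partial_within (cimg d) k (u \<circ> cinv d) (\<phi> x))) (at (\<phi> x) within \<phi> ` S)"
    .
  from diff_chain_within[OF D this]
  have "(u \<circ> cinv d \<circ> \<phi> has_derivative (\<lambda>v. \<Sum>k\<in>UNIV. (transition_jacobian c d p *v v) $ k *\<^sub>R partial_within (cimg d) k (u \<circ> cinv d) (\<phi> x))) (at x within S)"
    by (simp add: o_def J)
  then have "((u \<circ> cinv c) has_derivative (\<lambda>v. \<Sum>k\<in>UNIV. (transition_jacobian c d p *v v) $ k *\<^sub>R partial_within (cimg d) k (u \<circ> cinv d) (\<phi> x))) (at x within S)"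
    by (rule has_derivative_transform[OF xS, rotated])
      (use cinv_cmap[OF c] cinv_cmap[OF d] in \<open>auto simp: S_def \<phi>_def\<close>)
  note eq1 = partial_within_eq[OF S xS this]
  have "(u \<circ> cinv c) differentiable (at x within cimg c)"
    using u c xc by (auto simp: C2_fun_def C2_on_def differentiable_on_def)
  note eq2 = partial_within_eq[OF S xS has_derivative_subset[OF has_derivative_partial_within[OF this] Sc]]
  have "partial_within (cimg c) i (u \<circ> cinv c) x = partial_within S i (u \<circ> cinv c) x"
    unfolding eq2 by (simp add: axis_def if_distrib[where f = "\<lambda>a. a * _"] cong: if_cong)
  also have "\<dots> = (\<Sum>k\<in>UNIV. transition_jacobian c d p $ k $ i * partial_within (cimg d) k (u \<circ> cinv d) (\<phi> x))"
    unfolding eq1 by (simp add: matrix_vector_mult_basis column_def)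
  finally show ?thesis by (simp add: coord_partial_def x_def[symmetric] \<phi>x)
qed

text \<open>The squared length of the differential of a real function at a point, read in one
  chart.\<close>

definition form_at :: "('m \<Rightarrow> real) \<Rightarrow> ('m, 'n) chart \<Rightarrow> 'm \<Rightarrow> real" where
  "form_at u c p = metric_form (g c (cmap c p)) (\<lambda>i. coord_partial c i u (cmap c p))"

lemma form_at_invariant:
  assumes c: "c \<in> A" and d: "d \<in> A" and p: "p \<in> cdom c" "p \<in> cdom d" and u: "C2_fun u"
  shows "form_at u c p = form_at u d p"
proof -
  interpret chart_metric "cimg c" "g c" by (rule chart_metric[OF c])
  let ?J = "transition_jacobian c d p"
  define a :: "real^'n" where "a = (\<chi> k. coord_partial d k u (cmap d p))"
  have P: "g c (cmap c p) = transpose ?J ** g d (cmap d p) ** ?J"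
    using metric c d p unfolding riemannian_metric_def by blast
  have "(\<lambda>i. coord_partial c i u (cmap c p)) = (\<lambda>i. (transpose ?J *v a) $ i)"
    using coord_partial_change[OF c d p u] by (simp add: matrix_vector_mult_def transpose_def a_def)
  moreover have "(\<lambda>i. coord_partial d i u (cmap d p)) = (\<lambda>i. a $ i)" by (simp add: a_def)
  ultimately show ?thesis
    using metric_form_congruence[OF P] det_pos[OF cmap_in[OF p(1)]] by (simp add: form_at_def)
qed

lemma form_at_nonneg: "c \<in> A \<Longrightarrow> p \<in> cdom c \<Longrightarrow> 0 \<le> form_at u c p"
  unfolding form_at_def by (rule chart_metric.metric_form_nonneg[OF chart_metric cmap_in])

text \<open>The inverse metric is real, so the real part of each product of a partial with a
  conjugate partial separates into a product of real parts plus a product of imaginary parts. The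
  complex case is thus reduced to two real ones.\<close>

lemma chart_gradient_length_eq:
  fixes u :: "'m \<Rightarrow> complex"
  assumes c: "c \<in> A" and p: "p \<in> cdom c" and u: "C2_fun u"
  shows "chart_gradient_length g c u p = sqrt (form_at (\<lambda>q. Re (u q)) c p + form_at (\<lambda>q. Im (u q)) c p)"
proof -
  let ?x = "cmap c p" and ?z = "\<lambda>i. coord_partial c i u (cmap c p)"
  have "(u \<circ> cinv c) differentiable (at ?x within cimg c)"
    using u c cmap_in[OF p] by (auto simp: C2_fun_def C2_on_def differentiable_on_def)
  then have "coord_partial c i (\<lambda>q. l (u q)) ?x = l (?z i)" if "bounded_linear l" for i and l :: "complex \<Rightarrow> real"
    using partial_within_linear[OF cimg_rel_open[OF c] cmap_in[OF p] that, of "u \<circ> cinv c" i]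
    by (simp add: coord_partial_def o_def)
  then have ReIm: "coord_partial c i (\<lambda>q. Re (u q)) ?x = Re (?z i)" "coord_partial c i (\<lambda>q. Im (u q)) ?x = Im (?z i)" for i
    using bounded_linear_Re bounded_linear_Im by auto
  have "Re (\<Sum>i\<in>UNIV. \<Sum>j\<in>UNIV. complex_of_real (matrix_inv (g c ?x) $ i $ j) * ?z i * cnj (?z j))
    = (\<Sum>i\<in>UNIV. \<Sum>j\<in>UNIV. Re (?z i) * Re (?z j) * matrix_inv (g c ?x) $ i $ j) +
      (\<Sum>i\<in>UNIV. \<Sum>j\<in>UNIV. Im (?z i) * Im (?z j) * matrix_inv (g c ?x) $ i $ j)"
    unfolding Re_sum sum.distrib[symmetric] by (intro sum.cong refl) (simp add: algebra_simps)
  then show ?thesis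
    by (simp add: chart_gradient_length_def form_at_def metric_form_def quad_form_sum ReIm)
qed

text \<open>The definite description has a value because all charts agree at a point: a chosen chart
  at every point supplies the function, and \<open>form_at_invariant\<close> the agreement with the
  others.\<close>

lemma gradient_length_eq:
  fixes u :: "'m \<Rightarrow> complex"
  assumes c: "c \<in> A" and p: "p \<in> cdom c" and u: "C2_fun u"
  shows "gradient_length A g u p = sqrt (form_at (\<lambda>q. Re (u q)) c p + form_at (\<lambda>q. Im (u q)) c p)"
proof -
  define ch where "ch p = (SOME c. c \<in> A \<and> p \<in> cdom c)" for p
  have ch: "ch p \<in> A \<and> p \<in> cdom (ch p)" for p
  proof -
    have "\<exists>c. c \<in> A \<and> p \<in> cdom c" using chart_around[of p] by metis
    then show ?thesis unfolding ch_def by (rule someI_ex)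
  qed
  define r where "r p = chart_gradient_length g (ch p) u p" for p
  have ReIm: "C2_fun (\<lambda>q. Re (u q))" "C2_fun (\<lambda>q. Im (u q))"
    by (rule C2_fun_linear[OF bounded_linear_Re u] C2_fun_linear[OF bounded_linear_Im u])+
  have r: "r q = chart_gradient_length g d u q" if "d \<in> A" "q \<in> cdom d" for d q
    using ch[of q] that form_at_invariant[of "ch q" d q] ReIm u by (simp add: r_def chart_gradient_length_eq)
  then have "has_gradient_length A g u r" by (simp add: has_gradient_length_def)
  moreover have "r' = r" if "has_gradient_length A g u r'" for r'
  proof
    fix q show "r' q = r q" using that ch[of q] by (auto simp: has_gradient_length_def r_def)
  qed
  ultimately have "gradient_length A g u = r"
    unfolding gradient_length_def by (rule the_equality)
  then show ?thesis using r[OF c p] chart_gradient_length_eq[OF c p u] by simp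
qed

text \<open>This supplies the measurability with which a pointwise bound passes to the essential
  supremum.\<close>

lemma gradient_length_continuous:
  fixes u :: "'m \<Rightarrow> complex"
  assumes u: "C2_fun u"
  shows "continuous_on UNIV (gradient_length A g u)"
proof -
  define F where "F v c x = metric_form (g c x) (\<lambda>i. coord_partial c i v x)" for v :: "'m \<Rightarrow> real" and c x
  have F: "continuous_on (cimg c) (F v c)" if c: "c \<in> A" and v: "C2_fun v" for v c
  proof -
    interpret chart_metric "cimg c" "g c" by (rule chart_metric[OF c])
    have inv: "continuous_on (cimg c) (\<lambda>x. matrix_inv (g c x) $ i $ j)" for i j
      using coefficient_differentiable(2) by (intro differentiable_imp_continuous_on) (auto simp: differentiable_on_def)
    have cp: "continuous_on (cimg c) (\<lambda>x. coord_partial c i v x)" for i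
      using v c by (auto simp: C2_fun_def C2_on_def coord_partial_def intro!: differentiable_imp_continuous_on)
    show ?thesis
      unfolding F_def metric_form_def quad_form_sum vec_lambda_beta
      by (intro continuous_on_sum continuous_on_mult inv cp)
  qed
  have ReIm: "C2_fun (\<lambda>q. Re (u q))" "C2_fun (\<lambda>q. Im (u q))"
    by (rule C2_fun_linear[OF bounded_linear_Re u] C2_fun_linear[OF bounded_linear_Im u])+
  show ?thesis
  proof (rule continuous_from_charts)
    fix c assume c: "c \<in> A"
    show "continuous_on (cimg c) (\<lambda>x. sqrt (F (\<lambda>q. Re (u q)) c x + F (\<lambda>q. Im (u q)) c x))"
      using F[OF c] ReIm by (intro continuous_intros) auto
    show "gradient_length A g u p = sqrt (F (\<lambda>q. Re (u q)) c (cmap c p) + F (\<lambda>q. Im (u q)) c (cmap c p))"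
      if "p \<in> cdom c" for p
      using gradient_length_eq[OF c that u] by (simp add: F_def form_at_def)
  qed
qed

section \<open>A uniform gradient bound by compactness\<close>

text \<open>Everything except C and the point is quantified inside, so that compactness can act on
  the points alone and the constant is the same for all functions and all \<mu>.\<close>

definition gradient_bound :: "real \<Rightarrow> 'm \<Rightarrow> bool" where
  "gradient_bound C q \<longleftrightarrow> (\<forall>v h' m h \<mu>. C2_fun v \<longrightarrow> (\<forall>p\<in>manifold_boundary A. v p = 0) \<longrightarrow>
    has_laplacian A g v h' \<longrightarrow> (\<forall>p. \<bar>v p\<bar> \<le> m) \<longrightarrow> (\<forall>p. \<bar>h' p\<bar> \<le> h) \<longrightarrow> 0 < m \<longrightarrow> 0 < h \<longrightarrow> 1 \<le> \<mu> \<longrightarrow>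
    (\<forall>c\<in>A. q \<in> cdom c \<longrightarrow> form_at v c q \<le> (C * (\<mu> * m + h / \<mu>))\<^sup>2))"

lemma gradient_bound_mono:
  assumes "gradient_bound C q" "0 \<le> C" "C \<le> C'"
  shows "gradient_bound C' q"
  unfolding gradient_bound_def
proof (intro allI impI ballI)
  fix v h' and m h \<mu> :: real and c
  assume *: "C2_fun v" "\<forall>p\<in>manifold_boundary A. v p = 0" "has_laplacian A g v h'"
    "\<forall>p. \<bar>v p\<bar> \<le> m" "\<forall>p. \<bar>h' p\<bar> \<le> h" "0 < m" "0 < h" "1 \<le> \<mu>" "c \<in> A" "q \<in> cdom c"
  then have "form_at v c q \<le> (C * (\<mu> * m + h / \<mu>))\<^sup>2"
    using assms(1) unfolding gradient_bound_def by blast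
  also have "\<dots> \<le> (C' * (\<mu> * m + h / \<mu>))\<^sup>2"
    using assms *(6-8) by (intro power_mono mult_right_mono) auto
  finally show "form_at v c q \<le> (C' * (\<mu> * m + h / \<mu>))\<^sup>2" .
qed

text \<open>One chart around p gives the estimate on a whole neighbourhood; the invariance of
  \<open>form_at\<close> carries it to every other chart at the same point.\<close>

lemma local_gradient_bound: "\<exists>V C. open V \<and> p \<in> V \<and> 0 < C \<and> (\<forall>q\<in>V. gradient_bound C q)"
proof -
  obtain c where c: "c \<in> A" "p \<in> cdom c" by (rule chart_around)
  interpret chart_metric "cimg c" "g c" by (rule chart_metric[OF c(1)])
  show ?thesis
  proof (rule local_length_estimate[OF cmap_in[OF c(2)]])
  fix R C :: real
  assume RC: "0 < R" "0 < C" and est: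
    "\<And>w m h \<mu> z. C2_on (cimg c) w \<Longrightarrow> \<forall>x\<in>cimg c. x $ bd_coord = 0 \<longrightarrow> w x = 0 \<Longrightarrow> \<forall>x\<in>cimg c. \<bar>w x\<bar> \<le> m \<Longrightarrow>
      \<forall>x\<in>cimg c. \<bar>div_op (cimg c) (g c) w x\<bar> \<le> h \<Longrightarrow> 0 < m \<Longrightarrow> 0 < h \<Longrightarrow> 1 \<le> \<mu> \<Longrightarrow> z \<in> cimg c \<inter> ball (cmap c p) R \<Longrightarrow>
      metric_form (g c z) (\<lambda>i. partial_within (cimg c) i w z) \<le> (C * (\<mu> * m + h / \<mu>))\<^sup>2"
  define V where "V = cdom c \<inter> cmap c -` ball (cmap c p) R"
  have "continuous_on (cdom c) (cmap c)" using chart_homeomorphism[OF c(1)] by (simp add: homeomorphism_def)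
  then have "open V" unfolding V_def
    using cdom_open[OF c(1)] by (intro continuous_open_preimage) auto
  moreover have "p \<in> V" using c RC by (simp add: V_def)
  moreover have "gradient_bound C q" if q: "q \<in> V" for q
    unfolding gradient_bound_def
  proof (intro allI impI ballI)
    fix v h' and m h \<mu> :: real and d
    assume *: "C2_fun v" "\<forall>p\<in>manifold_boundary A. v p = 0" "has_laplacian A g v h'"
      "\<forall>p. \<bar>v p\<bar> \<le> m" "\<forall>p. \<bar>h' p\<bar> \<le> h" "0 < m" "0 < h" "1 \<le> \<mu>" "d \<in> A" "q \<in> cdom d"
    have qc: "q \<in> cdom c" "cmap c q \<in> ball (cmap c p) R" using q by (auto simp: V_def)
    have 1: "C2_on (cimg c) (v \<circ> cinv c)" using *(1) c by (simp add: C2_fun_def)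
    have 2: "\<forall>x\<in>cimg c. x $ bd_coord = 0 \<longrightarrow> (v \<circ> cinv c) x = 0"
    proof (intro ballI impI)
      fix x assume x: "x \<in> cimg c" "x $ bd_coord = 0"
      then have "cinv c x \<in> manifold_boundary A"
        unfolding manifold_boundary_def using cinv_in[OF c(1) x(1)] cmap_cinv[OF c(1) x(1)]
        by (intro CollectI bexI[OF _ c(1)]) simp
      then show "(v \<circ> cinv c) x = 0" using *(2) by simp
    qed
    have 3: "\<forall>x\<in>cimg c. \<bar>(v \<circ> cinv c) x\<bar> \<le> m" using *(4) by simp
    have 4: "\<forall>x\<in>cimg c. \<bar>div_op (cimg c) (g c) (v \<circ> cinv c) x\<bar> \<le> h"
    proof
      fix x assume x: "x \<in> cimg c"
      have "h' (cinv c x) = - div_op (cimg c) (g c) (v \<circ> cinv c) x"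
        using *(3) c(1) cinv_in[OF c(1) x] cmap_cinv[OF c(1) x]
        by (simp add: has_laplacian_def chart_laplacian_div_op)
      then show "\<bar>div_op (cimg c) (g c) (v \<circ> cinv c) x\<bar> \<le> h"
        using *(5) by (metis abs_minus_cancel)
    qed
    have "form_at v c q \<le> (C * (\<mu> * m + h / \<mu>))\<^sup>2"
      using est[OF 1 2 3 4 *(6-8), of "cmap c q"] qc cmap_in[OF qc(1)]
      by (simp add: form_at_def coord_partial_def)
    then show "form_at v d q \<le> (C * (\<mu> * m + h / \<mu>))\<^sup>2"
      using form_at_invariant[OF *(9) c(1) *(10) qc(1) *(1)] by simp
  qed
  ultimately show ?thesis using RC by blast
  qed
qed

text \<open>A finite subcover, with the sum of the finitely many positive constants dominating each
  of them.\<close>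

lemma global_gradient_bound:
  assumes "compact (UNIV :: 'm set)"
  shows "\<exists>C>0. \<forall>q. gradient_bound C q"
proof -
  obtain V C where VC: "\<And>p. open (V p)" "\<And>p. p \<in> V p" "\<And>p. 0 < (C p :: real)" "\<And>p q. q \<in> V p \<Longrightarrow> gradient_bound (C p) q"
    using local_gradient_bound by metis
  have cover: "UNIV \<subseteq> (\<Union>p\<in>UNIV. V p)" using VC(2) by auto
  obtain F where F: "finite F" "UNIV \<subseteq> (\<Union>p\<in>F. V p)"
    by (rule compactE_image[OF assms VC(1) cover])
  then have "F \<noteq> {}" by auto
  have "gradient_bound (\<Sum>p\<in>F. C p) q" for q
  proof -
    obtain p where p: "p \<in> F" "q \<in> V p" using F(2) by blast
    have "C p \<le> (\<Sum>p\<in>F. C p)"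
      by (rule member_le_sum[OF p(1) _ F(1)]) (rule less_imp_le[OF VC(3)])
    then show ?thesis
      using gradient_bound_mono[OF VC(4)[OF p(2)] less_imp_le[OF VC(3)]] by blast
  qed
  moreover have "0 < (\<Sum>p\<in>F. C p)" using F(1) \<open>F \<noteq> {}\<close> VC(3) by (intro sum_pos) auto
  ultimately show ?thesis by blast
qed

section \<open>Essential suprema and norms\<close>

text \<open>The image of the open set in a chart may touch the flat boundary, so a short step inward
  is made to a point with a full Euclidean ball in the image; on that ball the density is bounded
  below.\<close>

lemma open_emeasure_pos:
  assumes vol: "riemannian_density A g vol" and V: "open V" "V \<noteq> {}"
  shows "0 < emeasure vol V"
proof -
  obtain p where "p \<in> V" using V(2) by blast
  obtain c where c: "c \<in> A" "p \<in> cdom c" by (rule chart_around)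
  interpret chart_metric "cimg c" "g c" by (rule chart_metric[OF c(1)])
  define B where "B = cdom c \<inter> V"
  have B: "open B" "p \<in> B" "B \<subseteq> cdom c" using V(1) cdom_open[OF c(1)] c \<open>p \<in> V\<close> by (auto simp: B_def)
  have "openin (top_of_set (cdom c)) B" unfolding B_def using V(1) by (simp add: openin_open_Int)
  then have "openin (top_of_set (cimg c)) (cmap c ` B)"
    by (rule homeomorphism_imp_open_map[OF chart_homeomorphism[OF c(1)]])
  then have S: "rel_open (cmap c ` B)" using W by (rule openin_trans)
  obtain d where d: "d > 0" "\<And>t. 0 \<le> t \<Longrightarrow> t < d \<Longrightarrow> cmap c p + t *\<^sub>R axis bd_coord 1 \<in> cmap c ` B"
    using rel_open_path[OF S, of "cmap c p" bd_coord 1] B by auto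
  define x where "x = cmap c p + (d / 2) *\<^sub>R axis bd_coord 1"
  have xS: "x \<in> cmap c ` B" using d by (simp add: x_def)
  have "cmap c p \<in> half_space" using cmap_in[OF c(2)] openin_subset[OF W] by auto
  then have xpos: "0 < x $ bd_coord" using d(1) by (simp add: x_def half_space_def)
  obtain U where U: "open U" "cmap c ` B = half_space \<inter> U" using S by (auto simp: openin_open)
  have "open (U \<inter> {y. 0 < y $ bd_coord})"
    using U(1) by (intro open_Int open_Collect_less continuous_intros) auto
  moreover have "x \<in> U \<inter> {y. 0 < y $ bd_coord}" using xS xpos U(2) by auto
  ultimately obtain r where r: "r > 0" "cball x r \<subseteq> U \<inter> {y. 0 < y $ bd_coord}"
    by (meson open_contains_cball)
  have sub: "cball x r \<subseteq> cmap c ` B" using r(2) unfolding U(2) by (auto simp: half_space_def)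
  have sub': "cball x r \<subseteq> cimg c" using sub B(3) by (auto simp: cimg_def)
  obtain k where k: "k > 0" "\<And>y. y \<in> cball x r \<Longrightarrow> k \<le> det (g c y)"
    using coefficients_lip(4)[OF compact_cball sub'] by blast
  have "0 < emeasure lborel (cball x r)"
  proof -
    have "0 < emeasure lborel (ball x r)"
      using content_ball_pos[OF r(1), of x] by (simp add: measure_def enn2real_positive_iff)
    also have "\<dots> \<le> emeasure lborel (cball x r)" by (intro emeasure_mono) auto
    finally show ?thesis .
  qed
  then have "0 < ennreal (sqrt k) * emeasure lborel (cball x r)"
    using k(1) by (simp add: ennreal_zero_less_mult_iff)
  also have "\<dots> = (\<integral>\<^sup>+y. ennreal (sqrt k) * indicator (cball x r) y \<partial>lborel)"
    by (simp add: nn_integral_cmult_indicator)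
  also have "\<dots> \<le> (\<integral>\<^sup>+y\<in>cmap c ` B. ennreal (sqrt (det (g c y))) \<partial>lborel)"
    using sub k by (intro nn_integral_mono) (auto simp: indicator_def intro: ennreal_leI)
  also have "\<dots> = emeasure vol B"
  proof -
    have "\<forall>B\<in>sets borel. B \<subseteq> cdom c \<longrightarrow> emeasure vol B = (\<integral>\<^sup>+y\<in>cmap c ` B. ennreal (sqrt (det (g c y))) \<partial>lborel)"
      using vol c(1) unfolding riemannian_density_def by blast
    then show ?thesis using borel_open[OF B(1)] B(3) by simp
  qed
  also have "\<dots> \<le> emeasure vol V"
  proof (rule emeasure_mono)
    show "V \<in> sets vol" using vol borel_open[OF V(1)] by (simp add: riemannian_density_def)
  qed (simp add: B_def)
  finally show ?thesis .
qed

text \<open>The set where the norm of u exceeds its essential supremum is null, and open by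
  continuity, hence empty.\<close>

lemma le_Linf_norm:
  fixes u :: "'m \<Rightarrow> 'b::real_normed_vector"
  assumes vol: "riemannian_density A g vol" and u: "continuous_on UNIV u"
  shows "ereal (norm (u p)) \<le> Linf_norm vol u"
proof (rule ccontr)
  assume "\<not> ereal (norm (u p)) \<le> Linf_norm vol u"
  then have lt: "Linf_norm vol u < ereal (norm (u p))" by simp
  have sets: "sets vol = sets borel" using vol by (simp add: riemannian_density_def)
  then have space: "space vol = UNIV" using sets_eq_imp_space_eq by fastforce
  have cont: "continuous_on UNIV (\<lambda>p. ereal (norm (u p)))"
    using u by (intro continuous_on_ereal continuous_intros)
  define V where "V = {q. Linf_norm vol u < ereal (norm (u q))}"
  have "open V" unfolding V_def by (rule open_Collect_less[OF continuous_on_const cont])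
  moreover have "p \<in> V" using lt by (simp add: V_def)
  ultimately have "0 < emeasure vol V" using open_emeasure_pos[OF vol] by blast
  moreover have "emeasure vol V = 0"
    using esssup_zero_measure[of vol "\<lambda>p. ereal (norm (u p))"] by (simp add: V_def Linf_norm_def space)
  ultimately show False by simp
qed

text \<open>\<open>gradient_bound\<close> asks for positive bounds, whereas m and h may be 0; both
  are enlarged by \<delta>, tuned to cost exactly \<epsilon>. Real and imaginary part each
  contribute (C * K)^2, and twice this is at most (2 * C * K)^2.\<close>

lemma gradient_length_pointwise:
  fixes u h' :: "'m \<Rightarrow> complex"
  assumes C: "0 < C" "\<And>q. gradient_bound C q" and u: "C2_fun u"
    and bd: "\<forall>p\<in>manifold_boundary A. u p = 0" and lap: "has_laplacian A g u h'"
    and m: "\<And>p. cmod (u p) \<le> m" "\<And>p. cmod (h' p) \<le> h" "1 \<le> \<mu>"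
  shows "\<bar>gradient_length A g u q\<bar> \<le> 2 * C * (\<mu> * m + h / \<mu>)"
proof (rule field_le_epsilon)
  fix \<epsilon> :: real assume \<epsilon>: "0 < \<epsilon>"
  define \<delta> where "\<delta> = \<epsilon> / (2 * C * (\<mu> + 1 / \<mu>))"
  have D: "0 < 2 * C * (\<mu> + 1 / \<mu>)" using C(1) m(3) by (intro mult_pos_pos add_pos_pos) auto
  have \<delta>: "0 < \<delta>" "2 * C * (\<mu> + 1 / \<mu>) * \<delta> = \<epsilon>" using D \<epsilon> by (auto simp: \<delta>_def)
  have m0: "0 < m + \<delta>" "0 < h + \<delta>"
    using order_trans[OF norm_ge_zero m(1)[of q]] order_trans[OF norm_ge_zero m(2)[of q]] \<delta>(1) by auto
  define K where "K = \<mu> * (m + \<delta>) + (h + \<delta>) / \<mu>"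
  have K: "0 < K" using m0 m(3) by (simp add: K_def add_pos_pos)
  obtain c where c: "c \<in> A" "q \<in> cdom c" by (rule chart_around)
  have part: "form_at (\<lambda>p. l (u p)) c q \<le> (C * K)\<^sup>2"
    if l: "bounded_linear l" "\<And>z. \<bar>l z\<bar> \<le> cmod z" for l :: "complex \<Rightarrow> real"
  proof -
    have "l 0 = 0" using l(2)[of 0] by simp
    then have "\<forall>p\<in>manifold_boundary A. l (u p) = 0" using bd by simp
    moreover have "\<forall>p. \<bar>l (u p)\<bar> \<le> m + \<delta>" "\<forall>p. \<bar>l (h' p)\<bar> \<le> h + \<delta>"
      using order_trans[OF l(2) m(1)] order_trans[OF l(2) m(2)] \<delta>(1) by (auto intro: add_increasing2 order_less_imp_le)
    ultimately show ?thesis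
      using C(2)[of q] C2_fun_linear[OF l(1) u] has_laplacian_linear[OF u lap l(1)] m0 m(3) c
      unfolding gradient_bound_def K_def by blast
  qed
  have "form_at (\<lambda>p. Re (u p)) c q + form_at (\<lambda>p. Im (u p)) c q \<le> (C * K)\<^sup>2 + (C * K)\<^sup>2"
    by (intro add_mono part bounded_linear_Re bounded_linear_Im abs_Re_le_cmod abs_Im_le_cmod)
  also have "\<dots> \<le> (2 * C * K)\<^sup>2" using C(1) K by (simp add: power2_eq_square)
  finally have "gradient_length A g u q \<le> sqrt ((2 * C * K)\<^sup>2)"
    unfolding gradient_length_eq[OF c u] by (rule real_sqrt_le_mono)
  moreover have "0 \<le> gradient_length A g u q"
    unfolding gradient_length_eq[OF c u] using form_at_nonneg[OF c] by simp
  moreover have "sqrt ((2 * C * K)\<^sup>2) = 2 * C * K" using C(1) K by simp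
  moreover have "2 * C * K = 2 * C * (\<mu> * m + h / \<mu>) + 2 * C * (\<mu> + 1 / \<mu>) * \<delta>"
    by (simp add: K_def algebra_simps add_divide_distrib)
  ultimately show "\<bar>gradient_length A g u q\<bar> \<le> 2 * C * (\<mu> * m + h / \<mu>) + \<epsilon>"
    using \<delta>(2) by linarith
qed

text \<open>The norms are extended reals. If one on the right is infinite, the positive factors make
  the whole right-hand side infinite; otherwise both are real bounds valid at every point, by
  continuity, and the pointwise estimate applies.\<close>

lemma gradient_length_Linf:
  fixes u h' :: "'m \<Rightarrow> complex"
  assumes vol: "riemannian_density A g vol"
    and C: "0 < C" "\<And>q. gradient_bound C q" and u: "C2_fun u"
    and bd: "\<forall>p\<in>manifold_boundary A. u p = 0" and lap: "has_laplacian A g u h'"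
    and h': "continuous_on UNIV h'" and \<mu>: "1 \<le> \<mu>"
  shows "Linf_norm vol (gradient_length A g u) \<le>
    ereal (2 * C) * (ereal \<mu> * Linf_norm vol u + ereal (1 / \<mu>) * Linf_norm vol h')"
proof -
  have ua: "ereal (cmod (u p)) \<le> Linf_norm vol u" for p
    by (rule le_Linf_norm[OF vol C2_fun_continuous[OF u]])
  have hb: "ereal (cmod (h' p)) \<le> Linf_norm vol h'" for p
    by (rule le_Linf_norm[OF vol h'])
  have nn: "0 \<le> Linf_norm vol u" "0 \<le> Linf_norm vol h'"
    using order_trans[OF _ ua] order_trans[OF _ hb] by (metis ereal_less_eq(5) norm_ge_zero)+
  show ?thesis
  proof (cases "Linf_norm vol u = \<infinity> \<or> Linf_norm vol h' = \<infinity>")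
    case True
    have "0 < \<mu>" using \<mu> by simp
    then have "0 \<le> ereal \<mu> * Linf_norm vol u" "0 \<le> ereal (1 / \<mu>) * Linf_norm vol h'"
      using nn by simp_all
    moreover have "ereal \<mu> * Linf_norm vol u = \<infinity> \<or> ereal (1 / \<mu>) * Linf_norm vol h' = \<infinity>"
      using True \<open>0 < \<mu>\<close> by auto
    ultimately have inf: "ereal \<mu> * Linf_norm vol u + ereal (1 / \<mu>) * Linf_norm vol h' = \<infinity>"
      by auto
    have "ereal (2 * C) * (ereal \<mu> * Linf_norm vol u + ereal (1 / \<mu>) * Linf_norm vol h') = \<infinity>"
      unfolding inf using C(1) by simp
    then show ?thesis by (simp only: ereal_less_eq(1))
  next
    case False
    then obtain a b where ab: "Linf_norm vol u = ereal a" "Linf_norm vol h' = ereal b"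
      using nn by (metis ereal_cases ereal_infty_less_eq(2) MInfty_neq_ereal(1) not_MInfty_nonneg)
    have bound: "\<bar>gradient_length A g u q\<bar> \<le> 2 * C * (\<mu> * a + b / \<mu>)" for q
      by (rule gradient_length_pointwise[OF C u bd lap _ _ \<mu>]) (use ua hb ab in auto)
    have "(\<lambda>p. ereal (norm (gradient_length A g u p))) \<in> borel_measurable borel"
      by (intro borel_measurable_continuous_onI continuous_on_ereal continuous_on_norm gradient_length_continuous[OF u])
    moreover have sets: "sets vol = sets borel" using vol by (simp add: riemannian_density_def)
    ultimately have "(\<lambda>p. ereal (norm (gradient_length A g u p))) \<in> borel_measurable vol"
      unfolding measurable_cong_sets[OF sets refl] by blast
    then have "Linf_norm vol (gradient_length A g u) \<le> ereal (2 * C * (\<mu> * a + b / \<mu>))"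
      unfolding Linf_norm_def using bound by (intro esssup_I AE_I2) auto
    then show ?thesis by (simp add: ab)
  qed
qed

end

theorem theorem1p1:
  fixes A :: "('m::{t2_space,second_countable_topology}, 'n::finite) chart set"
    and g :: "('m, 'n) metric"
    and vol :: "'m measure"
  assumes "compact (UNIV :: 'm set)"
    and "smooth_atlas A"
    and "riemannian_metric A g"
    and "riemannian_density A g vol"
  shows "\<exists>C>0. \<forall>e lam. dirichlet_eigenbasis A g vol e lam \<longrightarrow>
    (\<forall>f. square_integrable vol f \<longrightarrow> (\<forall>\<mu>\<ge>1.
      Linf_norm vol (gradient_length A g (spectral_band vol e lam \<mu> f)) \<le>
        ereal C * (ereal \<mu> * Linf_norm vol (spectral_band vol e lam \<mu> f) +
          ereal (1 / \<mu>) * Linf_norm vol (laplacian A g (spectral_band vol e lam \<mu> f)))))"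
proof -
  interpret riemannian_manifold A g by unfold_locales fact+
  obtain C where C: "0 < C" "\<And>q. gradient_bound C q"
    using global_gradient_bound[OF assms(1)] by blast
  show ?thesis
  proof (intro exI[of _ "2 * C"] conjI allI impI)
    show "0 < 2 * C" using C(1) by simp
    fix e lam f and \<mu> :: real
    assume E: "dirichlet_eigenbasis A g vol e lam" and \<mu>: "1 \<le> \<mu>"
    \<comment> \<open>A sum over an infinite set is 0 by convention, as is the sum over the empty
      set. With this \<open>J\<close> the band is a finite combination in either case.\<close>
    define J where "J = (let S = {j. lam j \<in> {\<mu><..\<mu> + 1}} in if finite S then S else {})"
    define a where "a j = (LINT q|vol. f q * complex_of_real (e j q))" for j
    define u where "u = spectral_band vol e lam \<mu> f"
    define h' where "h' p = (\<Sum>j\<in>J. a j * complex_of_real ((lam j)\<^sup>2 * e j p))" for p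
    have u_eq: "u = (\<lambda>p. \<Sum>j\<in>J. a j * complex_of_real (e j p))"
      by (auto simp: u_def spectral_band_def eigen_projection_def J_def a_def Let_def)
    have e: "C2_fun (e j)" "\<forall>p\<in>manifold_boundary A. e j p = 0" "has_laplacian A g (e j) (\<lambda>p. (lam j)\<^sup>2 * e j p)" for j
      using E smooth_C2_fun unfolding dirichlet_eigenbasis_def by blast+
    \<comment> \<open>Multiplication by the complex coefficient is a bounded real-linear map on real
      values; the linearity lemmas thus lead from the real functions \<open>e j\<close> to the
      complex sum.\<close>
    have l: "bounded_linear (\<lambda>x. a j * complex_of_real x)" for j
      by (rule bounded_linear_compose[OF bounded_linear_mult_right bounded_linear_of_real])
    have l': "bounded_linear (\<lambda>x. a j * complex_of_real ((lam j)\<^sup>2 * x))" for j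
      by (rule bounded_linear_compose[OF l bounded_linear_mult_right])
    have u: "C2_fun u" unfolding u_eq by (intro C2_fun_sum C2_fun_linear[OF l] e)
    \<comment> \<open>The Laplacian of the band is again a finite combination of the
      \<open>e j\<close>, hence continuous, so its essential supremum bounds it at every
      point.\<close>
    have "C2_fun h'" unfolding h'_def[abs_def] by (intro C2_fun_sum C2_fun_linear[OF l'] e)
    then have h': "continuous_on UNIV h'" by (rule C2_fun_continuous)
    have lap: "has_laplacian A g u h'"
      unfolding u_eq h'_def[abs_def]
      by (intro has_laplacian_sum C2_fun_linear[OF l] has_laplacian_linear[OF _ _ l] e)
    have bd: "\<forall>p\<in>manifold_boundary A. u p = 0" using e(2) by (simp add: u_eq)
    show "Linf_norm vol (gradient_length A g (spectral_band vol e lam \<mu> f)) \<le>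
        ereal (2 * C) * (ereal \<mu> * Linf_norm vol (spectral_band vol e lam \<mu> f) +
          ereal (1 / \<mu>) * Linf_norm vol (laplacian A g (spectral_band vol e lam \<mu> f)))"
      using gradient_length_Linf[OF assms(4) C u bd lap h' \<mu>] laplacian_eq[OF lap] by (simp add: u_def)
  qed
qed

end
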